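(* Suppose $D$ and $D'$ are proper subdomains of $\mathbb R^2$. If $f:D\to D'$ is $K$-quasiconformal (in particular a homeomorphism of $D$ onto $D'$) and harmonic, then $f$ is bilipschitz with respect to the quasihyperbolic metrics on $D$ and $D'$; that is, there is a constant $C\ge 1$ such that $$\frac1C\,k_D(z_1,z_2)\le k_{D'}(f(z_1),f(z_2))\le C\,k_D(z_1,z_2)\qquad\text{for all }z_1,z_2\in D.$$
   Context: For a proper subdomain $D\subset\mathbb R^2$ the quasihyperbolic metric is $k_D(x,y)=\inf_\gamma\int_\gamma\frac{ds}{d(z,\partial D)}$, the infimum over all rectifiable curves $\gamma$ in $D$ joining $x$ and $y$, where $d(z,\partial D)$ is the Euclidean distance to $\partial D$. Harmonic means that both real coordinate functions of $f$ are harmonic. *)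

theory Defs
  imports "HOL-Analysis.Analysis"
begin

text \<open>The plane is the type \<^typ>\<open>complex\<close>, regarded as the real Euclidean space with basis \<open>{1, \<i>}\<close>.\<close>

definition proper_subdomain :: "complex set \<Rightarrow> bool" where
  "proper_subdomain D \<longleftrightarrow> open D \<and> connected D \<and> D \<noteq> {} \<and> D \<noteq> UNIV"


subsection \<open>The quasihyperbolic metric\<close>

text \<open>For a finite division of \<open>{a..b}\<close> into intervals \<open>k = {Inf k..Sup k}\<close>, the sum below is
  the length of the inscribed polygon.\<close>

definition polygon_lengths :: "(real \<Rightarrow> 'a::metric_space) \<Rightarrow> real \<Rightarrow> real \<Rightarrow> real set" where
  "polygon_lengths g a b =
     {(\<Sum>k\<in>\<K>. dist (g (Inf k)) (g (Sup k))) |\<K>. \<K> division_of {a..b}}"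

definition rectifiable_path :: "(real \<Rightarrow> 'a::metric_space) \<Rightarrow> bool" where
  "rectifiable_path g \<longleftrightarrow> path g \<and> bdd_above (polygon_lengths g 0 1)"

definition arclength :: "(real \<Rightarrow> 'a::metric_space) \<Rightarrow> real \<Rightarrow> real" where
  "arclength g t = Sup (polygon_lengths g 0 t)"

text \<open>The parametrization of a rectifiable path by arc length. The value does not depend on the
  choice of \<open>t\<close>, since the path is constant wherever its arc length is.\<close>

definition arclength_param :: "(real \<Rightarrow> 'a::metric_space) \<Rightarrow> real \<Rightarrow> 'a" where
  "arclength_param g s = g (SOME t. t \<in> {0..1} \<and> arclength g t = s)"

definition arclength_integral :: "('a::metric_space \<Rightarrow> real) \<Rightarrow> (real \<Rightarrow> 'a) \<Rightarrow> real" where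
  "arclength_integral \<rho> g = integral {0..arclength g 1} (\<lambda>s. \<rho> (arclength_param g s))"

definition quasihyperbolic_dist :: "complex set \<Rightarrow> complex \<Rightarrow> complex \<Rightarrow> real" where
  "quasihyperbolic_dist D x y =
     Inf {arclength_integral (\<lambda>z. 1 / infdist z (frontier D)) g |g.
            rectifiable_path g \<and> path_image g \<subseteq> D \<and> pathstart g = x \<and> pathfinish g = y}"


subsection \<open>Harmonic mappings\<close>

text \<open>A real function is harmonic if it is twice continuously (Frechet) differentiable and its
  Laplacian, the trace of the second derivative, vanishes.\<close>

definition harmonic_fun_on :: "'a::euclidean_space set \<Rightarrow> ('a \<Rightarrow> real) \<Rightarrow> bool" where
  "harmonic_fun_on D u \<longleftrightarrow>
     (\<exists>(u' :: 'a \<Rightarrow> 'a \<Rightarrow>\<^sub>L real) (u'' :: 'a \<Rightarrow> 'a \<Rightarrow>\<^sub>L 'a \<Rightarrow>\<^sub>L real).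
        (\<forall>z\<in>D. (u has_derivative blinfun_apply (u' z)) (at z)) \<and>
        (\<forall>z\<in>D. (u' has_derivative blinfun_apply (u'' z)) (at z)) \<and>
        continuous_on D u'' \<and>
        (\<forall>z\<in>D. (\<Sum>b\<in>Basis. blinfun_apply (blinfun_apply (u'' z) b) b) = 0))"

definition harmonic_map_on :: "complex set \<Rightarrow> (complex \<Rightarrow> complex) \<Rightarrow> bool" where
  "harmonic_map_on D f \<longleftrightarrow>
     harmonic_fun_on D (\<lambda>z. Re (f z)) \<and> harmonic_fun_on D (\<lambda>z. Im (f z))"


subsection \<open>Quasiconformal mappings\<close>

text \<open>The usual epsilon-delta definition; \<open>\<K>\<close> ranges over the finite families of
  non-overlapping compact intervals contained in \<open>I\<close>.\<close>

definition abs_continuous_on :: "real set \<Rightarrow> (real \<Rightarrow> 'a::metric_space) \<Rightarrow> bool" where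
  "abs_continuous_on I g \<longleftrightarrow>
     (\<forall>\<epsilon>>0. \<exists>\<delta>>0. \<forall>\<K>. \<K> division_of \<Union>\<K> \<and> \<Union>\<K> \<subseteq> I \<and> (\<Sum>k\<in>\<K>. Sup k - Inf k) < \<delta> \<longrightarrow>
        (\<Sum>k\<in>\<K>. dist (g (Inf k)) (g (Sup k))) < \<epsilon>)"

text \<open>Absolute continuity on lines (ACL).\<close>

definition ACL_on :: "complex set \<Rightarrow> (complex \<Rightarrow> complex) \<Rightarrow> bool" where
  "ACL_on D f \<longleftrightarrow> continuous_on D f \<and>
     (\<forall>a b c d. cbox (Complex a c) (Complex b d) \<subseteq> D \<longrightarrow>
        (AE y in lborel. y \<in> {c..d} \<longrightarrow> abs_continuous_on {a..b} (\<lambda>x. f (Complex x y))) \<and>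
        (AE x in lborel. x \<in> {a..b} \<longrightarrow> abs_continuous_on {c..d} (\<lambda>y. f (Complex x y))))"

text \<open>The determinant of a real-linear map with respect to the basis \<open>{1, \<i>}\<close>.\<close>

definition real_det :: "(complex \<Rightarrow> complex) \<Rightarrow> real" where
  "real_det A = Re (A 1) * Im (A \<i>) - Re (A \<i>) * Im (A 1)"

text \<open>The analytic definition of quasiconformality, in the form in which sense-reversing mappings
  are admitted. In dimension two the inequality \<open>\<parallel>f'\<parallel>\<^sup>2 \<le> K \<bar>J\<bar>\<close> also gives
  \<open>\<bar>J\<bar> \<le> K l\<^sup>2\<close> for the minimal stretching \<open>l\<close> of \<open>f'\<close>, because \<open>\<bar>J\<bar> = \<parallel>f'\<parallel> l\<close>.\<close>

definition quasiconformal ::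
    "real \<Rightarrow> complex set \<Rightarrow> complex set \<Rightarrow> (complex \<Rightarrow> complex) \<Rightarrow> bool" where
  "quasiconformal K D D' f \<longleftrightarrow>
     1 \<le> K \<and> (\<exists>g. homeomorphism D D' f g) \<and> ACL_on D f \<and>
     (AE z in lborel. z \<in> D \<longrightarrow>
        (\<exists>f'. (f has_derivative f') (at z) \<and> (onorm f')\<^sup>2 \<le> K * \<bar>real_det f'\<bar>))"

end

theory Submission
  imports Defs "HOL-Complex_Analysis.Complex_Analysis"
begin

text \<open>
  A harmonic \<open>f\<close> has derivative \<open>h \<mapsto> p h + cnj (q h)\<close> with \<open>p\<close> and \<open>q\<close> holomorphic, and quasiconformality
  makes one of them, say \<open>m\<close>, dominate the other by a factor \<open>> 1\<close> throughout \<open>D\<close>. The claim amounts to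
  \<open>\<bar>m z\<bar> \<approx> d(f z, \<partial>D') / d(z, \<partial>D)\<close>.
  The length-area method, applied to circles about \<open>z\<close> and about a nearest boundary point of \<open>z\<close>, shows
  that on discs \<open>B\<close> about \<open>z\<close> of radius comparable to \<open>d(z, \<partial>D)\<close> the oscillation of \<open>f\<close> is comparable to
  \<open>d(f z, \<partial>D')\<close>. The upper bound for \<open>\<bar>m z\<bar>\<close> is then a gradient estimate. For the lower bound, some
  point of \<open>B\<close> has the right size of \<open>\<bar>m\<bar>\<close>; since injectivity forces \<open>m\<close> to be zero-free (Lewy), Harnack's
  inequality for the harmonic function \<open>ln \<bar>m\<bar>\<close> carries that size over to \<open>z\<close>.
\<close>

subsection \<open>Arc length\<close>

text \<open>If the smaller coefficient is at most \<kappa> |m| with \<kappa> < 1, the derivative of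
  \<open>f\<close> stretches every vector by a factor between (1 - \<kappa>) |m| and 2 |m|. So a
  two-sided bound on |m| is the infinitesimal form of the claim for \<open>f\<close> and for its
  inverse at once. Paths are merely rectifiable; the passage from derivatives to path integrals
  therefore compares lengths on short pieces and adds the pieces by bisection, instead of
  differentiating the path. The length-area argument closes because of the weight 1 / |f - v|^2. If
  ln |f - v| oscillates by M on every circle of an annulus, the weighted energy of the annulus grows
  like M^2. Quasiconformality bounds this energy by the weighted image area, which, counted over
  dyadic shells of the image, grows only like M. Hence M is bounded in terms of K and the ratio of
  the radii.\<close>

lemma chord_in_polygon_lengths:
  assumes "a \<le> b" shows "dist (g a) (g b) \<in> polygon_lengths g a b"
proof -
  have "{{a..b}} division_of {a..b}"
    using division_of_self[of a b] assms by (simp add: cbox_interval)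
  then show ?thesis
    unfolding polygon_lengths_def using assms by force
qed

lemma polygon_lengths_not_empty: "polygon_lengths g a b \<noteq> {}"
proof -
  obtain p where "p division_of cbox a b" using elementary_interval by blast
  then show ?thesis unfolding polygon_lengths_def by (auto simp: cbox_interval)
qed

lemma singleton_if_interior_empty:
  fixes k :: "real set"
  assumes "k = cbox a b" "interior k = {}" "k \<noteq> {}"
  shows "Inf k = Sup k"
  using assms by (cases "a < b") (auto simp: cbox_interval interior_atLeastAtMost_real)

lemma polygon_lengths_join:
  assumes "x \<in> polygon_lengths g a c" "y \<in> polygon_lengths g c b" "a \<le> c" "c \<le> b"
  shows "x + y \<in> polygon_lengths g a b"
proof -
  let ?d = "\<lambda>k. dist (g (Inf k)) (g (Sup k))"
  obtain K1 K2 where K1: "K1 division_of {a..c}" "x = sum ?d K1"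
    and K2: "K2 division_of {c..b}" "y = sum ?d K2"
    using assms unfolding polygon_lengths_def by auto
  have "K1 \<union> K2 division_of {a..c} \<union> {c..b}"
    by (rule division_disjoint_union[OF K1(1) K2(1)]) (auto simp: interior_atLeastAtMost_real)
  moreover have "{a..c} \<union> {c..b} = {a..b}" using assms by auto
  moreover have "sum ?d (K1 \<union> K2) = x + y"
  proof -
    \<comment> \<open>A piece of both divisions lies in {a..c} and in {c..b}, so it is {c} and its
      chord vanishes; nothing is counted twice.\<close>
    have "sum ?d (K1 \<inter> K2) = 0"
    proof (rule sum.neutral, rule)
      fix k assume k: "k \<in> K1 \<inter> K2"
      have "k \<subseteq> {c}" "k \<noteq> {}"
        using division_ofD(2,3)[OF K1(1), of k] division_ofD(2)[OF K2(1), of k] k by fastforce+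
      then have "k = {c}" by auto
      then show "?d k = 0" by simp
    qed
    then show ?thesis
      using sum.union_inter[OF division_of_finite[OF K1(1)] division_of_finite[OF K2(1)], of ?d] K1(2) K2(2)
      by simp
  qed
  ultimately show ?thesis unfolding polygon_lengths_def by force
qed

text \<open>Cutting every piece at \<open>c\<close> replaces a chord across \<open>c\<close> by two
  chords, which by the triangle inequality can only lengthen the polygon. Hence an estimate by two
  polygons, one on each side.\<close>

lemma polygon_lengths_split:
  assumes "x \<in> polygon_lengths g a b" "a \<le> c" "c \<le> b"
  obtains y z where "y \<in> polygon_lengths g a c" "z \<in> polygon_lengths g c b" "x \<le> y + z"
proof -
  \<comment> \<open>The guard settles pieces with an empty trace on one side of \<open>c\<close>,
    where \<open>Inf\<close> and \<open>Sup\<close> carry no information.\<close>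
  define d where "d k = (if k = {} then 0 else dist (g (Inf k)) (g (Sup k)))" for k
  obtain K where K: "K division_of cbox a b" and "x = (\<Sum>k\<in>K. dist (g (Inf k)) (g (Sup k)))"
    using assms unfolding polygon_lengths_def by (auto simp: cbox_interval)
  then have x: "x = sum d K"
    using division_ofD(3)[OF K] by (auto simp: d_def intro!: sum.cong)
  note fin = division_of_finite[OF K]
  let ?L = "{x::real. x \<bullet> 1 \<le> c}" and ?R = "{x::real. c \<le> x \<bullet> 1}"
  let ?K1 = "{l \<inter> ?L |l. l \<in> K \<and> l \<inter> ?L \<noteq> {}}" and ?K2 = "{l \<inter> ?R |l. l \<in> K \<and> l \<inter> ?R \<noteq> {}}"
  have L: "{y. y \<le> c} = {..c}" and R: "{y. c \<le> y} = {c..}" by auto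
  have K1: "?K1 division_of {a..c}" and K2: "?K2 division_of {c..b}"
    using division_split[OF K, of 1 c] assms by (auto simp: cbox_interval L R)
  \<comment> \<open>Different pieces may leave the same trace on \<open>A\<close>; the set of traces
    counts it once, the sum over \<open>K\<close> several times. Such a trace has empty interior, so
    it is empty or a point and contributes 0 either way.\<close>
  have *: "(\<Sum>k\<in>{l \<inter> A |l. l \<in> K \<and> l \<inter> A \<noteq> {}}. dist (g (Inf k)) (g (Sup k))) = (\<Sum>k\<in>K. d (k \<inter> A))"
    if A: "\<And>k1 k2. k1 \<in> K \<Longrightarrow> k2 \<in> K \<Longrightarrow> k1 \<noteq> k2 \<Longrightarrow> k1 \<inter> A = k2 \<inter> A \<Longrightarrow> interior (k1 \<inter> A) = {}"
      "\<And>k. k \<in> K \<Longrightarrow> \<exists>u v. k \<inter> A = cbox u v" for A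
  proof -
    have "(\<Sum>k\<in>K. d (k \<inter> A)) = sum d ((\<lambda>k. k \<inter> A) ` K)"
    proof (rule sum.reindex_nontrivial[OF fin, unfolded o_def, symmetric])
      fix k1 k2 assume k: "k1 \<in> K" "k2 \<in> K" "k1 \<noteq> k2" "k1 \<inter> A = k2 \<inter> A"
      from A(2)[OF k(1)] obtain u v where "k1 \<inter> A = cbox u v" by auto
      then have "k1 \<inter> A \<noteq> {} \<Longrightarrow> Inf (k1 \<inter> A) = Sup (k1 \<inter> A)"
        using singleton_if_interior_empty A(1)[OF k] by metis
      then show "d (k1 \<inter> A) = 0" unfolding d_def by auto
    qed
    also have "\<dots> = sum d {l \<inter> A |l. l \<in> K \<and> l \<inter> A \<noteq> {}}"
      by (rule sum.mono_neutral_right) (use fin in \<open>auto simp: d_def\<close>)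
    also have "\<dots> = (\<Sum>k\<in>{l \<inter> A |l. l \<in> K \<and> l \<inter> A \<noteq> {}}. dist (g (Inf k)) (g (Sup k)))"
      by (rule sum.cong) (auto simp: d_def)
    finally show ?thesis by simp
  qed
  have cb: "\<exists>u v. k = {u..v} \<and> u \<le> v" if "k \<in> K" for k
    using division_ofD(3,4)[OF K that] by (auto simp: cbox_interval)
  have cuts: "\<exists>u v. k \<inter> ?L = cbox u v" "\<exists>u v. k \<inter> ?R = cbox u v" if "k \<in> K" for k
  proof -
    from cb[OF that] obtain u v where "k = {u..v}" by blast
    then have "k \<inter> ?L = cbox u (min v c)" "k \<inter> ?R = cbox (max u c) v"
      by (auto simp: cbox_interval)
    then show "\<exists>u v. k \<inter> ?L = cbox u v" "\<exists>u v. k \<inter> ?R = cbox u v" by blast+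
  qed
  have s1: "(\<Sum>k\<in>?K1. dist (g (Inf k)) (g (Sup k))) = (\<Sum>k\<in>K. d (k \<inter> ?L))"
  proof (rule *)
    show "interior (k1 \<inter> ?L) = {}" if "k1 \<in> K" "k2 \<in> K" "k1 \<noteq> k2" "k1 \<inter> ?L = k2 \<inter> ?L" for k1 k2
      by (rule division_split_left_inj[OF K that(4,1,2,3)])
  qed (rule cuts)
  have s2: "(\<Sum>k\<in>?K2. dist (g (Inf k)) (g (Sup k))) = (\<Sum>k\<in>K. d (k \<inter> ?R))"
  proof (rule *)
    show "interior (k1 \<inter> ?R) = {}" if "k1 \<in> K" "k2 \<in> K" "k1 \<noteq> k2" "k1 \<inter> ?R = k2 \<inter> ?R" for k1 k2
      by (rule division_split_right_inj[OF K that(4,1,2,3)])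
  qed (rule cuts)
  have s3: "sum d K \<le> (\<Sum>k\<in>K. d (k \<inter> ?L)) + (\<Sum>k\<in>K. d (k \<inter> ?R))"
    unfolding sum.distrib[symmetric]
  proof (rule sum_mono)
    fix k assume "k \<in> K"
    then obtain u v where k: "k = {u..v}" "u \<le> v" using cb by blast
    consider "v < c" | "c < u" | "u \<le> c" "c \<le> v" by linarith
    then show "d k \<le> d (k \<inter> ?L) + d (k \<inter> ?R)"
    proof cases
      case 1
      then have "k \<inter> ?L = k" "k \<inter> ?R = {}" using k by auto
      then show ?thesis by (simp add: d_def)
    next
      case 2
      then have "k \<inter> ?R = k" "k \<inter> ?L = {}" using k by auto
      then show ?thesis by (simp add: d_def)
    next
      case 3
      then have "k \<inter> ?L = {u..c}" "k \<inter> ?R = {c..v}" using k by auto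
      then show ?thesis using k 3 by (simp add: d_def dist_triangle)
    qed
  qed
  show ?thesis
  proof (rule that)
    show "(\<Sum>k\<in>?K1. dist (g (Inf k)) (g (Sup k))) \<in> polygon_lengths g a c"
      unfolding polygon_lengths_def using K1 by blast
    show "(\<Sum>k\<in>?K2. dist (g (Inf k)) (g (Sup k))) \<in> polygon_lengths g c b"
      unfolding polygon_lengths_def using K2 by blast
    show "x \<le> (\<Sum>k\<in>?K1. dist (g (Inf k)) (g (Sup k))) + (\<Sum>k\<in>?K2. dist (g (Inf k)) (g (Sup k)))"
      unfolding s1 s2 x by (rule s3)
  qed
qed

section \<open>Length over a subinterval: additivity and smallness\<close>

definition path_length :: "(real \<Rightarrow> 'a::metric_space) \<Rightarrow> real \<Rightarrow> real \<Rightarrow> real" where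
  "path_length g a b = Sup (polygon_lengths g a b)"

lemma polygon_lengths_bdd_sub:
  assumes "bdd_above (polygon_lengths g a b)" "a \<le> a'" "a' \<le> b'" "b' \<le> b"
  shows "bdd_above (polygon_lengths g a' b')"
proof -
  obtain M where M: "\<And>x. x \<in> polygon_lengths g a b \<Longrightarrow> x \<le> M"
    using assms(1) by (auto simp: bdd_above_def)
  show ?thesis
  proof (rule bdd_aboveI)
    fix x assume x: "x \<in> polygon_lengths g a' b'"
    have "dist (g a) (g a') + x \<in> polygon_lengths g a b'"
      using polygon_lengths_join[OF chord_in_polygon_lengths x] assms by auto
    then have "dist (g a) (g a') + x + dist (g b') (g b) \<in> polygon_lengths g a b"
      by (rule polygon_lengths_join[OF _ chord_in_polygon_lengths]) (use assms in auto)
    then show "x \<le> M" using M[of "dist (g a) (g a') + x + dist (g b') (g b)"]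
      zero_le_dist[of "g a" "g a'"] zero_le_dist[of "g b'" "g b"] by linarith
  qed
qed

lemma polygon_lengths_bdd_join:
  assumes "bdd_above (polygon_lengths g a c)" "bdd_above (polygon_lengths g c b)" "a \<le> c" "c \<le> b"
  shows "bdd_above (polygon_lengths g a b)"
proof -
  obtain M N where M: "\<And>x. x \<in> polygon_lengths g a c \<Longrightarrow> x \<le> M"
     and N: "\<And>x. x \<in> polygon_lengths g c b \<Longrightarrow> x \<le> N"
    using assms(1,2) by (auto simp: bdd_above_def)
  show ?thesis
  proof (rule bdd_aboveI)
    fix x assume "x \<in> polygon_lengths g a b"
    then obtain y z where "y \<in> polygon_lengths g a c" "z \<in> polygon_lengths g c b" "x \<le> y + z"
      by (rule polygon_lengths_split[OF _ assms(3,4)])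
    then show "x \<le> M + N" using M[of y] N[of z] by linarith
  qed
qed

lemma path_length_add:
  assumes "bdd_above (polygon_lengths g a b)" "a \<le> c" "c \<le> b"
  shows "path_length g a b = path_length g a c + path_length g c b"
proof (rule antisym)
  have b1: "bdd_above (polygon_lengths g a c)" and b2: "bdd_above (polygon_lengths g c b)"
    using polygon_lengths_bdd_sub[OF assms(1)] assms by auto
  show "path_length g a b \<le> path_length g a c + path_length g c b"
    unfolding path_length_def[of g a b]
  proof (rule cSup_least[OF polygon_lengths_not_empty])
    fix x assume "x \<in> polygon_lengths g a b"
    then obtain y z where "y \<in> polygon_lengths g a c" "z \<in> polygon_lengths g c b" "x \<le> y + z"
      by (rule polygon_lengths_split[OF _ assms(2,3)])
    then show "x \<le> path_length g a c + path_length g c b"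
      using cSup_upper[OF _ b1, of y] cSup_upper[OF _ b2, of z] unfolding path_length_def by linarith
  qed
  have "y + z \<le> path_length g a b" if "y \<in> polygon_lengths g a c" "z \<in> polygon_lengths g c b" for y z
    unfolding path_length_def by (rule cSup_upper[OF polygon_lengths_join assms(1)]) (use that assms in auto)
  then have "z \<le> path_length g a b - y" if "y \<in> polygon_lengths g a c" "z \<in> polygon_lengths g c b" for y z
    using that by (simp add: algebra_simps)
  then have "path_length g c b \<le> path_length g a b - y" if "y \<in> polygon_lengths g a c" for y
    unfolding path_length_def[of g c b] using that by (intro cSup_least[OF polygon_lengths_not_empty]) auto
  then have "y \<le> path_length g a b - path_length g c b" if "y \<in> polygon_lengths g a c" for y
    using that by (simp add: algebra_simps)
  then have "path_length g a c \<le> path_length g a b - path_length g c b"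
    unfolding path_length_def[of g a c] by (intro cSup_least[OF polygon_lengths_not_empty]) auto
  then show "path_length g a c + path_length g c b \<le> path_length g a b" by simp
qed

lemma dist_le_path_length:
  assumes "bdd_above (polygon_lengths g a b)" "a \<le> b"
  shows "dist (g a) (g b) \<le> path_length g a b"
  unfolding path_length_def using cSup_upper[OF chord_in_polygon_lengths assms(1)] assms(2) by blast

lemma path_length_nonneg:
  assumes "bdd_above (polygon_lengths g a b)" "a \<le> b"
  shows "0 \<le> path_length g a b"
  using dist_le_path_length[OF assms] zero_le_dist order_trans by blast

lemma polygon_lengths_const:
  assumes "x \<in> polygon_lengths g a b" "\<And>t. t \<in> {a..b} \<Longrightarrow> g t = c"
  shows "x = 0"
proof -
  obtain K where K: "K division_of {a..b}" "x = (\<Sum>k\<in>K. dist (g (Inf k)) (g (Sup k)))"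
    using assms unfolding polygon_lengths_def by auto
  have "Inf k \<in> {a..b} \<and> Sup k \<in> {a..b}" if "k \<in> K" for k
    using division_ofD(2,3,4)[OF K(1) that] by (auto simp: cbox_interval)
  then show ?thesis unfolding K(2) by (intro sum.neutral) (simp add: assms(2))
qed

lemma polygon_lengths_mono:
  assumes "x \<in> polygon_lengths h a b" "\<And>s t. s \<in> {a..b} \<Longrightarrow> t \<in> {a..b} \<Longrightarrow> dist (h s) (h t) \<le> c * dist (g s) (g t)"
  obtains y where "y \<in> polygon_lengths g a b" "x \<le> c * y"
proof -
  obtain K where K: "K division_of {a..b}" "x = (\<Sum>k\<in>K. dist (h (Inf k)) (h (Sup k)))"
    using assms unfolding polygon_lengths_def by auto
  have "Inf k \<in> {a..b} \<and> Sup k \<in> {a..b}" if "k \<in> K" for k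
    using division_ofD(2,3,4)[OF K(1) that] by (auto simp: cbox_interval)
  then have "x \<le> c * (\<Sum>k\<in>K. dist (g (Inf k)) (g (Sup k)))"
    unfolding K(2) sum_distrib_left by (intro sum_mono assms(2)) auto
  then show ?thesis using that K(1) unfolding polygon_lengths_def by blast
qed

text \<open>This is right continuity of arc length at \<open>t\<close>. A polygon within e/2 of the
  full length is fixed. If the path is frozen at \<open>g s\<close> up to time \<open>s\<close>, the
  same polygon loses less than e/2 once \<open>s\<close> is near \<open>t\<close>, yet what remains
  is at most the length over {s..b}. So less than e is left for {t..s}.\<close>

lemma path_length_right_small:
  assumes bdd: "bdd_above (polygon_lengths g t b)" and "t \<le> b" and cont: "continuous_on {t..b} g"
    and "0 < e"
  obtains d where "0 < d" "\<And>s. s \<in> {t..b} \<Longrightarrow> s < t + d \<Longrightarrow> path_length g t s < e"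
proof -
  obtain x where x: "x \<in> polygon_lengths g t b" "path_length g t b - e / 2 < x"
    using less_cSupD[OF polygon_lengths_not_empty, of "path_length g t b - e / 2" g t b] \<open>0 < e\<close>
    unfolding path_length_def by auto
  obtain K where K: "K division_of {t..b}" "x = (\<Sum>k\<in>K. dist (g (Inf k)) (g (Sup k)))"
    using x unfolding polygon_lengths_def by auto
  have inK: "Inf k \<in> {t..b} \<and> Sup k \<in> {t..b}" if "k \<in> K" for k
    using division_ofD(2,3,4)[OF K(1) that] by (auto simp: cbox_interval)
  define \<phi> where "\<phi> s = (\<Sum>k\<in>K. dist (g (max (Inf k) s)) (g (max (Sup k) s)))" for s
  have "continuous_on {t..b} \<phi>"
    unfolding \<phi>_def using inK
    by (intro continuous_on_sum continuous_on_dist continuous_on_compose2[OF cont] continuous_intros) auto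
  then obtain d where d: "d > 0" "\<And>s. s \<in> {t..b} \<Longrightarrow> dist s t < d \<Longrightarrow> dist (\<phi> s) (\<phi> t) < e / 2"
    using \<open>0 < e\<close> \<open>t \<le> b\<close> unfolding continuous_on_iff by (metis atLeastAtMost_iff half_gt_zero order_refl)
  have \<phi>t: "\<phi> t = x"
    unfolding \<phi>_def K(2) using inK by (intro sum.cong) (auto simp: max_absorb1)
  show ?thesis
  proof (rule that[OF d(1)])
    fix s assume s: "s \<in> {t..b}" "s < t + d"
    have "\<phi> s \<in> polygon_lengths (\<lambda>u. g (max u s)) t b"
      unfolding polygon_lengths_def \<phi>_def using K(1) by blast
    then obtain y z where yz: "y \<in> polygon_lengths (\<lambda>u. g (max u s)) t s"
        "z \<in> polygon_lengths (\<lambda>u. g (max u s)) s b" "\<phi> s \<le> y + z"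
      by (rule polygon_lengths_split) (use s in auto)
    have "y = 0"
      by (rule polygon_lengths_const[OF yz(1), of "g s"]) (auto simp: max_absorb2)
    moreover obtain w where "w \<in> polygon_lengths g s b" "z \<le> 1 * w"
      by (rule polygon_lengths_mono[OF yz(2), where c = 1 and g = g]) (auto simp: max_absorb1)
    moreover have "w \<le> path_length g s b"
      unfolding path_length_def
      using cSup_upper[OF \<open>w \<in> _\<close>] polygon_lengths_bdd_sub[OF bdd, of s b] s by auto
    moreover have "path_length g t b = path_length g t s + path_length g s b"
      by (rule path_length_add[OF bdd]) (use s in auto)
    moreover have "dist (\<phi> s) x < e / 2"
      using d(2)[of s] s \<phi>t by (simp add: dist_real_def)
    ultimately show "path_length g t s < e"
      using x(2) yz(3) unfolding dist_real_def by (simp add: abs_if split: if_splits)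
  qed
qed

text \<open>Mirror image at the right end: the path is frozen from time \<open>s\<close> on, by
  \<open>min\<close> in place of \<open>max\<close>.\<close>

lemma path_length_left_small:
  assumes bdd: "bdd_above (polygon_lengths g a t)" and "a \<le> t" and cont: "continuous_on {a..t} g"
    and "0 < e"
  obtains d where "0 < d" "\<And>s. s \<in> {a..t} \<Longrightarrow> t - d < s \<Longrightarrow> path_length g s t < e"
proof -
  obtain x where x: "x \<in> polygon_lengths g a t" "path_length g a t - e / 2 < x"
    using less_cSupD[OF polygon_lengths_not_empty, of "path_length g a t - e / 2" g a t] \<open>0 < e\<close>
    unfolding path_length_def by auto
  obtain K where K: "K division_of {a..t}" "x = (\<Sum>k\<in>K. dist (g (Inf k)) (g (Sup k)))"
    using x unfolding polygon_lengths_def by auto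
  have inK: "Inf k \<in> {a..t} \<and> Sup k \<in> {a..t}" if "k \<in> K" for k
    using division_ofD(2,3,4)[OF K(1) that] by (auto simp: cbox_interval)
  define \<phi> where "\<phi> s = (\<Sum>k\<in>K. dist (g (min (Inf k) s)) (g (min (Sup k) s)))" for s
  have "continuous_on {a..t} \<phi>"
    unfolding \<phi>_def using inK
    by (intro continuous_on_sum continuous_on_dist continuous_on_compose2[OF cont] continuous_intros) auto
  then obtain d where d: "d > 0" "\<And>s. s \<in> {a..t} \<Longrightarrow> dist s t < d \<Longrightarrow> dist (\<phi> s) (\<phi> t) < e / 2"
    using \<open>0 < e\<close> \<open>a \<le> t\<close> unfolding continuous_on_iff by (metis atLeastAtMost_iff half_gt_zero order_refl)
  have \<phi>t: "\<phi> t = x"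
    unfolding \<phi>_def K(2) using inK by (intro sum.cong) (auto simp: min_absorb1)
  show ?thesis
  proof (rule that[OF d(1)])
    fix s assume s: "s \<in> {a..t}" "t - d < s"
    have "\<phi> s \<in> polygon_lengths (\<lambda>u. g (min u s)) a t"
      unfolding polygon_lengths_def \<phi>_def using K(1) by blast
    then obtain y z where yz: "y \<in> polygon_lengths (\<lambda>u. g (min u s)) a s"
        "z \<in> polygon_lengths (\<lambda>u. g (min u s)) s t" "\<phi> s \<le> y + z"
      by (rule polygon_lengths_split) (use s in auto)
    have "z = 0"
      by (rule polygon_lengths_const[OF yz(2), of "g s"]) (auto simp: min_absorb2)
    moreover obtain w where "w \<in> polygon_lengths g a s" "y \<le> 1 * w"
      by (rule polygon_lengths_mono[OF yz(1), where c = 1 and g = g]) (auto simp: min_absorb1)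
    moreover have "w \<le> path_length g a s"
      unfolding path_length_def
      using cSup_upper[OF \<open>w \<in> _\<close>] polygon_lengths_bdd_sub[OF bdd, of a s] s by auto
    moreover have "path_length g a t = path_length g a s + path_length g s t"
      by (rule path_length_add[OF bdd]) (use s in auto)
    moreover have "dist (\<phi> s) x < e / 2"
      using d(2)[of s] s \<phi>t by (simp add: dist_real_def)
    ultimately show "path_length g s t < e"
      using x(2) yz(3) unfolding dist_real_def by (simp add: abs_if split: if_splits)
  qed
qed

section \<open>Arc length as a parameter\<close>

lemma arclength_eq_path_length: "arclength g t = path_length g 0 t"
  by (simp add: arclength_def path_length_def)

lemma rectifiable_path_bdd:
  assumes "rectifiable_path g" "0 \<le> a" "a \<le> b" "b \<le> 1"
  shows "bdd_above (polygon_lengths g a b)"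
  using polygon_lengths_bdd_sub[of g 0 1 a b] assms unfolding rectifiable_path_def by auto

lemma rectifiable_path_continuous:
  "rectifiable_path g \<Longrightarrow> 0 \<le> a \<Longrightarrow> b \<le> 1 \<Longrightarrow> continuous_on {a..b} g"
  unfolding rectifiable_path_def path_def by (auto elim: continuous_on_subset)

lemma arclength_diff:
  assumes "rectifiable_path g" "0 \<le> a" "a \<le> b" "b \<le> 1"
  shows "arclength g b - arclength g a = path_length g a b"
  using path_length_add[OF rectifiable_path_bdd[OF assms(1), of 0 b], of a] assms
  by (simp add: arclength_eq_path_length)

lemma arclength_mono:
  assumes "rectifiable_path g" "0 \<le> a" "a \<le> b" "b \<le> 1"
  shows "arclength g a \<le> arclength g b"
  using arclength_diff[OF assms] path_length_nonneg[OF rectifiable_path_bdd[OF assms] assms(3)] by simp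

lemma arclength_0:
  assumes "rectifiable_path g" shows "arclength g 0 = 0"
  using path_length_add[OF rectifiable_path_bdd[OF assms, of 0 0], of 0] 
  by (simp add: arclength_eq_path_length)

lemma continuous_on_arclength:
  assumes g: "rectifiable_path g"
  shows "continuous_on {0..1} (arclength g)"
  unfolding continuous_on_iff
proof (intro ballI allI impI)
  fix t e :: real assume t: "t \<in> {0..1}" and e: "0 < e"
  obtain d1 where d1: "0 < d1" "\<And>s. s \<in> {t..1} \<Longrightarrow> s < t + d1 \<Longrightarrow> path_length g t s < e"
    using path_length_right_small[OF rectifiable_path_bdd[OF g, of t 1] _ rectifiable_path_continuous[OF g] e] t
    by auto
  obtain d2 where d2: "0 < d2" "\<And>s. s \<in> {0..t} \<Longrightarrow> t - d2 < s \<Longrightarrow> path_length g s t < e"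
    using path_length_left_small[OF rectifiable_path_bdd[OF g, of 0 t] _ rectifiable_path_continuous[OF g] e] t
    by auto
  show "\<exists>d>0. \<forall>s\<in>{0..1}. dist s t < d \<longrightarrow> dist (arclength g s) (arclength g t) < e"
  proof (intro exI[of _ "min d1 d2"] conjI ballI impI)
    fix s :: real assume s: "s \<in> {0..1}" "dist s t < min d1 d2"
    show "dist (arclength g s) (arclength g t) < e"
    proof (cases "t \<le> s")
      case True
      then show ?thesis
        using d1(2)[of s] s t arclength_diff[OF g, of t s] arclength_mono[OF g, of t s]
        by (simp add: dist_real_def)
    next
      case False
      then show ?thesis
        using d2(2)[of s] s t arclength_diff[OF g, of s t] arclength_mono[OF g, of s t]
        by (simp add: dist_real_def)
    qed
  qed (use d1 d2 in auto)
qed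

lemma arclength_attained:
  assumes "rectifiable_path g" "0 \<le> a" "a \<le> b" "b \<le> 1" "s \<in> {arclength g a..arclength g b}"
  obtains t where "t \<in> {a..b}" "arclength g t = s"
proof -
  have "continuous_on {a..b} (arclength g)"
    by (rule continuous_on_subset[OF continuous_on_arclength[OF assms(1)]]) (use assms in auto)
  then show ?thesis using IVT'[of "arclength g" a s b] assms that by auto
qed

text \<open>A chord is at most the arc length between its two times, here 0. This makes the choice
  in \<open>arclength_param\<close> harmless.\<close>

lemma arclength_eq_imp_eq:
  assumes g: "rectifiable_path g" and "s \<in> {0..1}" "t \<in> {0..1}" "arclength g s = arclength g t"
  shows "g s = g t"
proof -
  have *: "g s = g t" if "s \<in> {0..1}" "t \<in> {0..1}" "arclength g s = arclength g t" "s \<le> t" for s t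
    using dist_le_path_length[OF rectifiable_path_bdd[OF g], of s t] arclength_diff[OF g, of s t] that by auto
  show ?thesis using *[of s t] *[of t s] assms by fastforce
qed

lemma arclength_param_arclength:
  assumes g: "rectifiable_path g" and t: "t \<in> {0..1}"
  shows "arclength_param g (arclength g t) = g t"
proof -
  define t' where "t' = (SOME u. u \<in> {0..1} \<and> arclength g u = arclength g t)"
  have "t' \<in> {0..1} \<and> arclength g t' = arclength g t"
    unfolding t'_def by (rule someI[of _ t]) (use t in auto)
  then show ?thesis
    using arclength_eq_imp_eq[OF g, of t' t] t unfolding arclength_param_def t'_def by auto
qed

text \<open>A chord is at most as long as its arc, so the parametrization is even
  1-Lipschitz.\<close>

lemma continuous_on_arclength_param:
  assumes g: "rectifiable_path g"
  shows "continuous_on {0..arclength g 1} (arclength_param g)"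
proof -
  have *: "dist (arclength_param g s) (arclength_param g s') \<le> s' - s"
    if "s \<in> {0..arclength g 1}" "s' \<in> {0..arclength g 1}" "s \<le> s'" for s s'
  proof -
    note s = that
    obtain t where t: "t \<in> {0..1}" "arclength g t = s"
      by (rule arclength_attained[OF g, of 0 1 s]) (use s arclength_0[OF g] in auto)
    obtain t' where t': "t' \<in> {t..1}" "arclength g t' = s'"
      by (rule arclength_attained[OF g, of t 1 s']) (use s t in auto)
    then show ?thesis
      using arclength_param_arclength[OF g, of t] arclength_param_arclength[OF g, of t'] t
        dist_le_path_length[OF rectifiable_path_bdd[OF g], of t t'] arclength_diff[OF g, of t t'] by auto
  qed
  have **: "dist (arclength_param g s) (arclength_param g s') \<le> dist s s'"
    if "s \<in> {0..arclength g 1}" "s' \<in> {0..arclength g 1}" for s s'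
    using *[of s s'] *[of s' s] that by (cases "s \<le> s'") (auto simp: dist_real_def dist_commute)
  show ?thesis
    unfolding continuous_on_iff using ** order_le_less_trans by blast
qed

lemma arclength_param_in:
  assumes g: "rectifiable_path g" and "0 \<le> a" "a \<le> b" "b \<le> 1" "s \<in> {arclength g a..arclength g b}"
  shows "arclength_param g s \<in> g ` {a..b}"
proof -
  obtain t where "t \<in> {a..b}" "arclength g t = s" using arclength_attained[OF assms] .
  then show ?thesis using arclength_param_arclength[OF g, of t] assms by auto
qed

lemma arclength_integrand_integrable:
  fixes \<rho> :: "'a::metric_space \<Rightarrow> real"
  assumes g: "rectifiable_path g" and \<rho>: "continuous_on (path_image g) \<rho>"
    and "0 \<le> a" "a \<le> b" "b \<le> 1"
  shows "(\<lambda>s. \<rho> (arclength_param g s)) integrable_on {arclength g a..arclength g b}"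
proof (rule integrable_continuous_interval, rule continuous_on_compose2[OF \<rho>])
  have "{arclength g a..arclength g b} \<subseteq> {0..arclength g 1}"
    using arclength_mono[OF g, of 0 a] arclength_mono[OF g, of b 1] arclength_0[OF g] assms by auto
  then show "continuous_on {arclength g a..arclength g b} (arclength_param g)"
    using continuous_on_arclength_param[OF g] continuous_on_subset by blast
  show "arclength_param g ` {arclength g a..arclength g b} \<subseteq> path_image g"
    using arclength_param_in[OF g assms(3-5)] assms(3-5) unfolding path_image_def by fastforce
qed

lemma arclength_integral_bounds:
  fixes \<rho> :: "'a::metric_space \<Rightarrow> real"
  assumes g: "rectifiable_path g" and \<rho>: "continuous_on (path_image g) \<rho>"
    and ab: "0 \<le> a" "a \<le> b" "b \<le> 1"
  shows "(\<And>t. t \<in> {a..b} \<Longrightarrow> \<rho> (g t) \<le> M) \<Longrightarrow>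
      integral {arclength g a..arclength g b} (\<lambda>s. \<rho> (arclength_param g s)) \<le> M * path_length g a b"
    and "(\<And>t. t \<in> {a..b} \<Longrightarrow> m \<le> \<rho> (g t)) \<Longrightarrow>
      m * path_length g a b \<le> integral {arclength g a..arclength g b} (\<lambda>s. \<rho> (arclength_param g s))"
proof -
  note len = arclength_diff[OF g ab, symmetric] arclength_mono[OF g ab]
  note int = arclength_integrand_integrable[OF g \<rho> ab]
  have const: "integral {arclength g a..arclength g b} (\<lambda>s. c) = c * path_length g a b" for c :: real
    using len by simp
  show "integral {arclength g a..arclength g b} (\<lambda>s. \<rho> (arclength_param g s)) \<le> M * path_length g a b"
    if "\<And>t. t \<in> {a..b} \<Longrightarrow> \<rho> (g t) \<le> M"
    unfolding const[symmetric] using arclength_param_in[OF g ab] that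
    by (intro integral_le int) fastforce+
  show "m * path_length g a b \<le> integral {arclength g a..arclength g b} (\<lambda>s. \<rho> (arclength_param g s))"
    if "\<And>t. t \<in> {a..b} \<Longrightarrow> m \<le> \<rho> (g t)"
    unfolding const[symmetric] using arclength_param_in[OF g ab] that
    by (intro integral_le int) fastforce+
qed

lemma arclength_integral_nonneg:
  assumes g: "rectifiable_path g" and \<rho>: "continuous_on (path_image g) \<rho>" "\<And>x. x \<in> path_image g \<Longrightarrow> 0 \<le> \<rho> x"
  shows "0 \<le> arclength_integral \<rho> g"
  using arclength_integral_bounds(2)[OF g \<rho>(1), of 0 1 0] \<rho>(2) arclength_0[OF g]
  unfolding arclength_integral_def path_image_def by auto

text \<open>The arc-length parameters of \<open>g\<close> and \<open>f \<circ> g\<close> are not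
  linked by a formula, since \<open>f\<close> is only locally Lipschitz on the path. On a short
  interval around each time both weights are controlled up to a factor 2 by their values at that
  time, so each integral compares with weight times length. Both sides are additive over intervals,
  and the bisection principle \<open>Bolzano\<close> turns the local inequality into the global
  one.\<close>

lemma arclength_integral_image_le:
  fixes f :: "'a::metric_space \<Rightarrow> 'b::metric_space" and \<rho> :: "'a \<Rightarrow> real" and \<rho>' :: "'b \<Rightarrow> real"
  assumes g: "rectifiable_path g" and f: "continuous_on (path_image g) f"
    and \<rho>: "continuous_on (path_image g) \<rho>" "\<And>x. x \<in> path_image g \<Longrightarrow> 0 < \<rho> x"
    and \<rho>': "continuous_on (f ` path_image g) \<rho>'" "\<And>x. x \<in> path_image g \<Longrightarrow> 0 < \<rho>' (f x)"
    and C: "0 \<le> C"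
    and loc: "\<And>z. z \<in> path_image g \<Longrightarrow> \<exists>r>0. \<forall>x \<in> path_image g \<inter> ball z r. \<forall>y \<in> path_image g \<inter> ball z r.
       \<rho>' (f z) * dist (f x) (f y) \<le> C * \<rho> z * dist x y"
  shows "rectifiable_path (f \<circ> g)"
    and "arclength_integral \<rho>' (f \<circ> g) \<le> 4 * C * arclength_integral \<rho> g"
proof -
  have cont_g: "continuous_on {0..1} g" using g unfolding rectifiable_path_def path_def by simp
  have img: "g t \<in> path_image g" if "t \<in> {0..1}" for t using that unfolding path_image_def by auto
  have path: "path (f \<circ> g)"
    using g f unfolding rectifiable_path_def by (intro path_continuous_image) auto
  have local: "\<exists>d>0. \<exists>c. c * \<rho>' (f (g t0)) = C * \<rho> (g t0) \<and> (\<forall>t\<in>{0..1}. dist t t0 < d \<longrightarrow> \<rho> (g t0) / 2 \<le> \<rho> (g t) \<and> \<rho>' (f (g t)) \<le> 2 * \<rho>' (f (g t0))) \<and>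
      (\<forall>s\<in>{0..1}. \<forall>t\<in>{0..1}. dist s t0 < d \<longrightarrow> dist t t0 < d \<longrightarrow> dist (f (g s)) (f (g t)) \<le> c * dist (g s) (g t))"
    if t0: "t0 \<in> {0..1}" for t0
  proof -
    let ?z = "g t0"
    note z = img[OF t0]
    obtain r where r: "r > 0" "\<And>x y. x \<in> path_image g \<inter> ball ?z r \<Longrightarrow> y \<in> path_image g \<inter> ball ?z r \<Longrightarrow>
       \<rho>' (f ?z) * dist (f x) (f y) \<le> C * \<rho> ?z * dist x y"
      using loc[OF z] by blast
    obtain d1 where d1: "d1 > 0" "\<And>t. t \<in> {0..1} \<Longrightarrow> dist t t0 < d1 \<Longrightarrow> dist (g t) ?z < r"
      using cont_g t0 r(1) unfolding continuous_on_iff by blast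
    have "continuous_on {0..1} (\<lambda>t. \<rho> (g t))"
      by (rule continuous_on_compose2[OF \<rho>(1) cont_g]) (auto simp: path_image_def)
    then obtain d2 where d2: "d2 > 0" "\<And>t. t \<in> {0..1} \<Longrightarrow> dist t t0 < d2 \<Longrightarrow> dist (\<rho> (g t)) (\<rho> ?z) < \<rho> ?z / 2"
      using t0 \<rho>(2)[OF z] unfolding continuous_on_iff by (meson half_gt_zero)
    have "continuous_on {0..1} (\<lambda>t. f (g t))"
      by (rule continuous_on_compose2[OF f cont_g]) (auto simp: path_image_def)
    then have "continuous_on {0..1} (\<lambda>t. \<rho>' (f (g t)))"
      by (intro continuous_on_compose2[OF \<rho>'(1)]) (auto simp: path_image_def)
    then obtain d3 where d3: "d3 > 0" "\<And>t. t \<in> {0..1} \<Longrightarrow> dist t t0 < d3 \<Longrightarrow> dist (\<rho>' (f (g t))) (\<rho>' (f ?z)) < \<rho>' (f ?z)"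
      using t0 \<rho>'(2)[OF z] unfolding continuous_on_iff by meson
    let ?c = "C * \<rho> ?z / \<rho>' (f ?z)" and ?d = "min d1 (min d2 d3)"
    have *: "dist (f (g s)) (f (g t)) \<le> ?c * dist (g s) (g t)"
      if "s \<in> {0..1}" "t \<in> {0..1}" "dist s t0 < ?d" "dist t t0 < ?d" for s t
      using r(2)[of "g s" "g t"] d1(2)[of s] d1(2)[of t] img that \<rho>'(2)[OF z]
      by (simp add: field_simps dist_commute)
    have "\<rho> ?z / 2 \<le> \<rho> (g t) \<and> \<rho>' (f (g t)) \<le> 2 * \<rho>' (f ?z)" if "t \<in> {0..1}" "dist t t0 < ?d" for t
      using d2(2)[of t] d3(2)[of t] that unfolding dist_real_def by (simp add: abs_if split: if_splits)
    then show ?thesis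
      using * d1(1) d2(1) d3(1) \<rho>'(2)[OF z] by (intro exI[of _ ?d] conjI exI[of _ ?c]) auto
  qed
  \<comment> \<open>The local facts recast for subintervals {a..b} containing \<open>t0\<close>, the
    form in which bisection consumes them.\<close>
  have near: "\<exists>d>0. \<forall>a b. a \<le> t0 \<and> t0 \<le> b \<and> b - a < d \<longrightarrow> 0 \<le> a \<and> b \<le> 1 \<longrightarrow>
      (\<exists>c. c * \<rho>' (f (g t0)) = C * \<rho> (g t0) \<and> (\<forall>t\<in>{a..b}. \<rho> (g t0) / 2 \<le> \<rho> (g t) \<and> \<rho>' (f (g t)) \<le> 2 * \<rho>' (f (g t0))) \<and>
      (\<forall>s\<in>{a..b}. \<forall>t\<in>{a..b}. dist (f (g s)) (f (g t)) \<le> c * dist (g s) (g t)))"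
    if t0: "t0 \<in> {0..1}" for t0
  proof -
    obtain d c where dc: "d > 0" "c * \<rho>' (f (g t0)) = C * \<rho> (g t0)"
      "\<And>t. t \<in> {0..1} \<Longrightarrow> dist t t0 < d \<Longrightarrow> \<rho> (g t0) / 2 \<le> \<rho> (g t) \<and> \<rho>' (f (g t)) \<le> 2 * \<rho>' (f (g t0))"
      "\<And>s t. s \<in> {0..1} \<Longrightarrow> t \<in> {0..1} \<Longrightarrow> dist s t0 < d \<Longrightarrow> dist t t0 < d \<Longrightarrow> dist (f (g s)) (f (g t)) \<le> c * dist (g s) (g t)"
      using local[OF t0] by blast
    have "t \<in> {0..1} \<and> dist t t0 < d" if "a \<le> t0" "t0 \<le> b" "b - a < d" "0 \<le> a" "b \<le> 1" "t \<in> {a..b}" for a b t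
      using that by (auto simp: dist_real_def)
    then show ?thesis using dc by (intro exI[of _ d]) (metis (no_types, lifting))
  qed
  have len: "bdd_above (polygon_lengths (f \<circ> g) a b)" "path_length (f \<circ> g) a b \<le> c * path_length g a b"
    if c: "\<And>s t. s \<in> {a..b} \<Longrightarrow> t \<in> {a..b} \<Longrightarrow> dist (f (g s)) (f (g t)) \<le> c * dist (g s) (g t)" "0 \<le> c"
      and ab: "0 \<le> a" "a \<le> b" "b \<le> 1" for a b c
  proof -
    have *: "x \<le> c * path_length g a b" if "x \<in> polygon_lengths (f \<circ> g) a b" for x
    proof -
      note x = that
      obtain y where "y \<in> polygon_lengths g a b" "x \<le> c * y"
        by (rule polygon_lengths_mono[OF x, where c = c and g = g]) (use c(1) in auto)
      moreover have "y \<le> path_length g a b"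
        unfolding path_length_def by (rule cSup_upper[OF \<open>y \<in> _\<close> rectifiable_path_bdd[OF g ab]])
      ultimately show ?thesis using c(2) by (meson mult_left_mono order_trans)
    qed
    then show "bdd_above (polygon_lengths (f \<circ> g) a b)" by (rule bdd_aboveI)
    show "path_length (f \<circ> g) a b \<le> c * path_length g a b"
      unfolding path_length_def[of "f \<circ> g"] using * by (intro cSup_least[OF polygon_lengths_not_empty]) auto
  qed
  have cpos: "0 \<le> c" if "c * \<rho>' (f (g t0)) = C * \<rho> (g t0)" "t0 \<in> {0..1}" for c t0
    using that C \<rho>(2)[OF img[OF that(2)]] \<rho>'(2)[OF img[OF that(2)]]
    by (metis less_eq_real_def mult_nonneg_nonneg zero_le_mult_iff not_le)
  \<comment> \<open>Rectifiability of \<open>f \<circ> g\<close> comes first, by the same bisection: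
    its arc length, and with it the integral to be bounded, is meaningful only afterwards.\<close>
  have "0 \<le> (0::real) \<and> 1 \<le> (1::real) \<longrightarrow> bdd_above (polygon_lengths (f \<circ> g) 0 1)"
  proof (rule Bolzano[of 0 1 "\<lambda>a b. 0 \<le> a \<and> b \<le> 1 \<longrightarrow> bdd_above (polygon_lengths (f \<circ> g) a b)"])
    fix a b c :: real
    assume "0 \<le> a \<and> b \<le> 1 \<longrightarrow> bdd_above (polygon_lengths (f \<circ> g) a b)"
      "0 \<le> b \<and> c \<le> 1 \<longrightarrow> bdd_above (polygon_lengths (f \<circ> g) b c)" "a \<le> b" "b \<le> c"
    then show "0 \<le> a \<and> c \<le> 1 \<longrightarrow> bdd_above (polygon_lengths (f \<circ> g) a c)"
      using polygon_lengths_bdd_join[of "f \<circ> g" a b c] by auto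
  next
    fix t0 :: real assume "0 \<le> t0" "t0 \<le> 1"
    then have t0: "t0 \<in> {0..1}" by simp
    from near[OF t0] obtain d where d: "d > 0" "\<forall>a b. a \<le> t0 \<and> t0 \<le> b \<and> b - a < d \<longrightarrow> 0 \<le> a \<and> b \<le> 1 \<longrightarrow>
      (\<exists>c. c * \<rho>' (f (g t0)) = C * \<rho> (g t0) \<and> (\<forall>t\<in>{a..b}. \<rho> (g t0) / 2 \<le> \<rho> (g t) \<and> \<rho>' (f (g t)) \<le> 2 * \<rho>' (f (g t0))) \<and>
      (\<forall>s\<in>{a..b}. \<forall>t\<in>{a..b}. dist (f (g s)) (f (g t)) \<le> c * dist (g s) (g t)))"
      by blast
    show "\<exists>d>0. \<forall>a b. a \<le> t0 \<and> t0 \<le> b \<and> b - a < d \<longrightarrow> 0 \<le> a \<and> b \<le> 1 \<longrightarrow> bdd_above (polygon_lengths (f \<circ> g) a b)"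
    proof (intro exI[of _ d] conjI allI impI)
      fix a b assume ab: "a \<le> t0 \<and> t0 \<le> b \<and> b - a < d" "0 \<le> a \<and> b \<le> 1"
      then obtain c where "c * \<rho>' (f (g t0)) = C * \<rho> (g t0)"
        "\<And>s t. s\<in>{a..b} \<Longrightarrow> t\<in>{a..b} \<Longrightarrow> dist (f (g s)) (f (g t)) \<le> c * dist (g s) (g t)"
        using d(2)[rule_format, of a b] ab by blast
      then show "bdd_above (polygon_lengths (f \<circ> g) a b)"
        using len(1)[of a b c] cpos[OF _ t0] ab by auto
    qed (rule d)
  qed auto
  then show rect: "rectifiable_path (f \<circ> g)"
    unfolding rectifiable_path_def using path by simp
  define I where "I a b = integral {arclength g a..arclength g b} (\<lambda>s. \<rho> (arclength_param g s))" for a b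
  define I' where "I' a b = integral {arclength (f \<circ> g) a..arclength (f \<circ> g) b} (\<lambda>s. \<rho>' (arclength_param (f \<circ> g) s))" for a b
  have \<rho>'_cont: "continuous_on (path_image (f \<circ> g)) \<rho>'"
    using \<rho>'(1) by (simp add: path_image_compose)
  have I_add: "I a c = I a b + I b c" "I' a c = I' a b + I' b c" if "0 \<le> a" "a \<le> b" "b \<le> c" "c \<le> 1" for a b c
    using Henstock_Kurzweil_Integration.integral_combine[OF _ _ arclength_integrand_integrable[OF g \<rho>(1), of a c]]
      Henstock_Kurzweil_Integration.integral_combine[OF _ _ arclength_integrand_integrable[OF rect \<rho>'_cont, of a c]]
      arclength_mono[OF g] arclength_mono[OF rect] that unfolding I_def I'_def by auto
  have "0 \<le> (0::real) \<and> 1 \<le> (1::real) \<longrightarrow> I' 0 1 \<le> 4 * C * I 0 1"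
  proof (rule Bolzano[of 0 1 "\<lambda>a b. 0 \<le> a \<and> b \<le> 1 \<longrightarrow> I' a b \<le> 4 * C * I a b"])
    fix a b c :: real
    assume "0 \<le> a \<and> b \<le> 1 \<longrightarrow> I' a b \<le> 4 * C * I a b"
      "0 \<le> b \<and> c \<le> 1 \<longrightarrow> I' b c \<le> 4 * C * I b c" "a \<le> b" "b \<le> c"
    then show "0 \<le> a \<and> c \<le> 1 \<longrightarrow> I' a c \<le> 4 * C * I a c"
      using I_add[of a b c] by (auto simp: algebra_simps)
  next
    fix t0 :: real assume "0 \<le> t0" "t0 \<le> 1"
    then have t0: "t0 \<in> {0..1}" by simp
    from near[OF t0] obtain d where d: "d > 0" "\<forall>a b. a \<le> t0 \<and> t0 \<le> b \<and> b - a < d \<longrightarrow> 0 \<le> a \<and> b \<le> 1 \<longrightarrow>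
      (\<exists>c. c * \<rho>' (f (g t0)) = C * \<rho> (g t0) \<and> (\<forall>t\<in>{a..b}. \<rho> (g t0) / 2 \<le> \<rho> (g t) \<and> \<rho>' (f (g t)) \<le> 2 * \<rho>' (f (g t0))) \<and>
      (\<forall>s\<in>{a..b}. \<forall>t\<in>{a..b}. dist (f (g s)) (f (g t)) \<le> c * dist (g s) (g t)))"
      by blast
    show "\<exists>d>0. \<forall>a b. a \<le> t0 \<and> t0 \<le> b \<and> b - a < d \<longrightarrow> 0 \<le> a \<and> b \<le> 1 \<longrightarrow> I' a b \<le> 4 * C * I a b"
    proof (intro exI[of _ d] conjI allI impI)
      fix a b assume ab': "a \<le> t0 \<and> t0 \<le> b \<and> b - a < d" "0 \<le> a \<and> b \<le> 1"
      then have ab: "0 \<le> a" "a \<le> b" "b \<le> 1" by auto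
      obtain c where c: "c * \<rho>' (f (g t0)) = C * \<rho> (g t0)"
        "\<And>t. t\<in>{a..b} \<Longrightarrow> \<rho> (g t0) / 2 \<le> \<rho> (g t)" "\<And>t. t\<in>{a..b} \<Longrightarrow> \<rho>' (f (g t)) \<le> 2 * \<rho>' (f (g t0))"
        "\<And>s t. s\<in>{a..b} \<Longrightarrow> t\<in>{a..b} \<Longrightarrow> dist (f (g s)) (f (g t)) \<le> c * dist (g s) (g t)"
        using d(2)[rule_format, of a b] ab' by blast
      have "I' a b \<le> 2 * \<rho>' (f (g t0)) * path_length (f \<circ> g) a b"
        unfolding I'_def by (rule arclength_integral_bounds(1)[OF rect \<rho>'_cont ab]) (use c in auto)
      also have "\<dots> \<le> 2 * \<rho>' (f (g t0)) * (c * path_length g a b)"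
        using len(2)[OF c(4) cpos[OF c(1) t0] ab] \<rho>'(2)[OF img[OF t0]] by (intro mult_left_mono) auto
      \<comment> \<open>The factor 4 is 2 from the upper bound for \<rho>' times 2 from the lower
        bound \<open>\<rho> (g t0) / 2\<close>; the defining relation of \<open>c\<close> exchanges
        the two weights.\<close>
      also have "\<dots> = 4 * C * (\<rho> (g t0) / 2 * path_length g a b)"
        using c(1) by (simp add: algebra_simps)
      also have "\<dots> \<le> 4 * C * I a b"
        unfolding I_def using C c(2) by (intro mult_left_mono arclength_integral_bounds(2)[OF g \<rho>(1) ab]) auto
      finally show "I' a b \<le> 4 * C * I a b" .
    qed (rule d)
  qed auto
  then show "arclength_integral \<rho>' (f \<circ> g) \<le> 4 * C * arclength_integral \<rho> g"
    unfolding arclength_integral_def I_def I'_def arclength_0[OF g] arclength_0[OF rect] by simp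
qed

subsection \<open>Derivatives of harmonic quasiconformal maps\<close>

text \<open>The mean value theorem is applied twice: in direction \<open>a\<close> to the difference
  of \<open>u\<close> and its translate by \<open>s b\<close>, then in direction \<open>b\<close> to
  the first derivative along \<open>a\<close>. The second difference is symmetric in
  \<open>a\<close> and \<open>b\<close>, which is what makes it useful for the symmetry of
  \<open>u''\<close>.\<close>

lemma second_difference:
  fixes u :: "'a::real_normed_vector \<Rightarrow> real" and u' :: "'a \<Rightarrow> 'a \<Rightarrow>\<^sub>L real"
    and u'' :: "'a \<Rightarrow> 'a \<Rightarrow>\<^sub>L 'a \<Rightarrow>\<^sub>L real"
  assumes u: "\<And>w. w \<in> ball z r \<Longrightarrow> (u has_derivative blinfun_apply (u' w)) (at w)"
    and u': "\<And>w. w \<in> ball z r \<Longrightarrow> (u' has_derivative blinfun_apply (u'' w)) (at w)"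
    and s: "0 < s" "s * norm a + s * norm b < r"
  obtains w where "w \<in> ball z r"
    "u (z + s *\<^sub>R a + s *\<^sub>R b) - u (z + s *\<^sub>R a) - (u (z + s *\<^sub>R b) - u z) = s * (s * u'' w b a)"
proof -
  have inb: "z + x *\<^sub>R a + y *\<^sub>R b \<in> ball z r" if "0 \<le> x" "x \<le> s" "0 \<le> y" "y \<le> s" for x y
  proof -
    have "norm (x *\<^sub>R a + y *\<^sub>R b) \<le> x * norm a + y * norm b"
      using norm_triangle_ineq[of "x *\<^sub>R a" "y *\<^sub>R b"] that by simp
    also have "\<dots> \<le> s * norm a + s * norm b" using that by (intro add_mono mult_right_mono) auto
    finally have "norm (x *\<^sub>R a + y *\<^sub>R b) < r" using s(2) by simp
    then show ?thesis by (simp add: dist_norm norm_minus_commute algebra_simps)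
  qed
  have inb0: "z + x *\<^sub>R a \<in> ball z r" if "0 \<le> x" "x \<le> s" for x
    using inb[of x 0] that s(1) by simp
  have "\<exists>x>0. x < s \<and> (u (z + s *\<^sub>R a + s *\<^sub>R b) - u (z + s *\<^sub>R a)) - (u (z + 0 *\<^sub>R a + s *\<^sub>R b) - u (z + 0 *\<^sub>R a))
      = (s - 0) * (u' (z + x *\<^sub>R a + s *\<^sub>R b) a - u' (z + x *\<^sub>R a) a)"
  proof (rule MVT2[OF s(1)])
    fix x assume x: "0 \<le> x" "x \<le> s"
    have 1: "((\<lambda>x. u (z + x *\<^sub>R a + s *\<^sub>R b)) has_derivative (\<lambda>h. u' (z + x *\<^sub>R a + s *\<^sub>R b) (h *\<^sub>R a))) (at x)"
      by (rule has_derivative_compose[where g = u and f = "\<lambda>x. z + x *\<^sub>R a + s *\<^sub>R b", OF _ u[OF inb[of x s]]]) (use x s in \<open>auto intro!: derivative_eq_intros\<close>)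
    have 2: "((\<lambda>x. u (z + x *\<^sub>R a)) has_derivative (\<lambda>h. u' (z + x *\<^sub>R a) (h *\<^sub>R a))) (at x)"
      by (rule has_derivative_compose[where g = u and f = "\<lambda>x. z + x *\<^sub>R a", OF _ u[OF inb0[of x]]]) (use x in \<open>auto intro!: derivative_eq_intros\<close>)
    show "((\<lambda>x. u (z + x *\<^sub>R a + s *\<^sub>R b) - u (z + x *\<^sub>R a)) has_real_derivative
        u' (z + x *\<^sub>R a + s *\<^sub>R b) a - u' (z + x *\<^sub>R a) a) (at x)"
      unfolding has_field_derivative_def
      by (rule has_derivative_eq_rhs[OF has_derivative_diff[OF 1 2]])
         (auto simp: blinfun.scaleR_right algebra_simps)
  qed
  then obtain x where x: "0 < x" "x < s"
    "(u (z + s *\<^sub>R a + s *\<^sub>R b) - u (z + s *\<^sub>R a)) - (u (z + s *\<^sub>R b) - u z)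
      = s * (u' (z + x *\<^sub>R a + s *\<^sub>R b) a - u' (z + x *\<^sub>R a) a)"
    by auto
  have "\<exists>y>0. y < s \<and> u' (z + x *\<^sub>R a + s *\<^sub>R b) a - u' (z + x *\<^sub>R a + 0 *\<^sub>R b) a = (s - 0) * u'' (z + x *\<^sub>R a + y *\<^sub>R b) b a"
  proof (rule MVT2[OF s(1)])
    fix y assume y: "0 \<le> y" "y \<le> s"
    have 1: "((\<lambda>y. u' (z + x *\<^sub>R a + y *\<^sub>R b)) has_derivative (\<lambda>h. u'' (z + x *\<^sub>R a + y *\<^sub>R b) (h *\<^sub>R b))) (at y)"
      by (rule has_derivative_compose[where g = u' and f = "\<lambda>y. z + x *\<^sub>R a + y *\<^sub>R b", OF _ u'[OF inb[of x y]]]) (use x y in \<open>auto intro!: derivative_eq_intros\<close>)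
    have 2: "((\<lambda>y. u' (z + x *\<^sub>R a + y *\<^sub>R b) a) has_derivative (\<lambda>h. u'' (z + x *\<^sub>R a + y *\<^sub>R b) (h *\<^sub>R b) a)) (at y)"
      by (rule has_derivative_eq_rhs[OF blinfun.FDERIV[OF 1 has_derivative_const]]) simp
    show "((\<lambda>y. u' (z + x *\<^sub>R a + y *\<^sub>R b) a) has_real_derivative u'' (z + x *\<^sub>R a + y *\<^sub>R b) b a) (at y)"
      unfolding has_field_derivative_def
      by (rule has_derivative_eq_rhs[OF 2]) (auto simp: blinfun.scaleR_right blinfun.scaleR_left)
  qed
  then obtain y where "0 < y" "y < s"
    "u' (z + x *\<^sub>R a + s *\<^sub>R b) a - u' (z + x *\<^sub>R a) a = s * u'' (z + x *\<^sub>R a + y *\<^sub>R b) b a"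
    by auto
  then show ?thesis using that[OF inb[of x y]] x by auto
qed

text \<open>Evaluating the same second difference with \<open>a\<close> and \<open>b\<close>
  exchanged equates mixed values of \<open>u''\<close> at two points near \<open>z\<close>; by
  continuity the two mixed values at \<open>z\<close> cannot differ.\<close>

lemma second_derivative_symmetric:
  fixes u :: "'a::real_normed_vector \<Rightarrow> real" and u' :: "'a \<Rightarrow> 'a \<Rightarrow>\<^sub>L real"
    and u'' :: "'a \<Rightarrow> 'a \<Rightarrow>\<^sub>L 'a \<Rightarrow>\<^sub>L real"
  assumes "open D" and z: "z \<in> D"
    and u: "\<And>w. w \<in> D \<Longrightarrow> (u has_derivative blinfun_apply (u' w)) (at w)"
    and u': "\<And>w. w \<in> D \<Longrightarrow> (u' has_derivative blinfun_apply (u'' w)) (at w)"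
    and cont: "continuous_on D u''"
  shows "u'' z a b = u'' z b a"
proof (rule ccontr)
  assume ne: "u'' z a b \<noteq> u'' z b a"
  define e where "e = \<bar>u'' z a b - u'' z b a\<bar> / 2"
  have "e > 0" using ne by (simp add: e_def)
  have "continuous_on D (\<lambda>w. u'' w a b - u'' w b a)" "continuous_on D (\<lambda>w. u'' w a b)" "continuous_on D (\<lambda>w. u'' w b a)"
    using cont by (auto intro!: continuous_intros)
  then obtain d1 d2 where d: "d1 > 0" "\<And>w. w \<in> D \<Longrightarrow> dist w z < d1 \<Longrightarrow> dist (u'' w a b) (u'' z a b) < e"
    "d2 > 0" "\<And>w. w \<in> D \<Longrightarrow> dist w z < d2 \<Longrightarrow> dist (u'' w b a) (u'' z b a) < e"
    using z \<open>e > 0\<close> unfolding continuous_on_iff by metis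
  obtain r0 where r0: "r0 > 0" "ball z r0 \<subseteq> D" using \<open>open D\<close> z open_contains_ball by blast
  define r where "r = min r0 (min d1 d2)"
  \<comment> \<open>Keeps both increments together inside the ball; the summand 1 covers
    \<open>a = b = 0\<close>.\<close>
  define s where "s = r / (norm a + norm b + 1)"
  have r: "r > 0" using r0 d by (simp add: r_def)
  have pos: "norm a + norm b + 1 > 0" using norm_ge_zero[of a] norm_ge_zero[of b] by linarith
  then have s: "s > 0" using r by (simp add: s_def)
  have "s * norm a + s * norm b = r * ((norm a + norm b) / (norm a + norm b + 1))"
    by (simp add: s_def add_divide_distrib distrib_left)
  also have "\<dots> < r * 1" using r pos by (intro mult_strict_left_mono) auto
  finally have s2: "s * norm a + s * norm b < r" "s * norm b + s * norm a < r" by auto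
  have sub: "ball z r \<subseteq> D" using r0 by (auto simp: r_def)
  obtain w1 where w1: "w1 \<in> ball z r"
    "u (z + s *\<^sub>R a + s *\<^sub>R b) - u (z + s *\<^sub>R a) - (u (z + s *\<^sub>R b) - u z) = s * (s * u'' w1 b a)"
    using second_difference[of z r u u' u'' s a b] u u' sub s s2 by (metis subsetD)
  obtain w2 where w2: "w2 \<in> ball z r"
    "u (z + s *\<^sub>R b + s *\<^sub>R a) - u (z + s *\<^sub>R b) - (u (z + s *\<^sub>R a) - u z) = s * (s * u'' w2 a b)"
    using second_difference[of z r u u' u'' s b a] u u' sub s s2 by (metis subsetD)
  have "u (z + s *\<^sub>R a + s *\<^sub>R b) = u (z + s *\<^sub>R b + s *\<^sub>R a)"
    by (rule arg_cong[of _ _ u]) simp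
  then have "s * (s * u'' w1 b a) = s * (s * u'' w2 a b)"
    using w1(2) w2(2) by linarith
  then have "u'' w1 b a = u'' w2 a b" using s by simp
  moreover have "dist (u'' w1 b a) (u'' z b a) < e" "dist (u'' w2 a b) (u'' z a b) < e"
    using d(4)[of w1] d(2)[of w2] w1(1) w2(1) subsetD[OF sub w1(1)] subsetD[OF sub w2(1)]
    by (auto simp: r_def dist_commute)
  ultimately show False unfolding e_def dist_real_def by (auto simp: abs_if split: if_splits)
qed

text \<open>The function is \<open>a = u_x - i u_y\<close>. Its Cauchy-Riemann equations are the
  vanishing of the Laplacian and the symmetry of the mixed derivatives.\<close>

lemma harmonic_fun_derivative:
  assumes "open D" "harmonic_fun_on D u"
  obtains a where "a holomorphic_on D" "\<And>z. z \<in> D \<Longrightarrow> (u has_derivative (\<lambda>h. Re (a z * h))) (at z)"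
proof -
  obtain u' :: "complex \<Rightarrow> complex \<Rightarrow>\<^sub>L real" and u'' :: "complex \<Rightarrow> complex \<Rightarrow>\<^sub>L complex \<Rightarrow>\<^sub>L real"
    where u: "\<And>z. z \<in> D \<Longrightarrow> (u has_derivative blinfun_apply (u' z)) (at z)"
      and u': "\<And>z. z \<in> D \<Longrightarrow> (u' has_derivative blinfun_apply (u'' z)) (at z)"
      and cont: "continuous_on D u''"
      and lap: "\<And>z. z \<in> D \<Longrightarrow> (\<Sum>b\<in>Basis. u'' z b b) = 0"
    using assms(2) unfolding harmonic_fun_on_def by blast
  define a where "a z = Complex (u' z 1) (- u' z \<i>)" for z
  have lin: "h = Re h *\<^sub>R 1 + Im h *\<^sub>R \<i>" for h
    by (simp add: complex_eq_iff)
  show ?thesis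
  proof (rule that)
    show "a holomorphic_on D"
    proof (rule holomorphic_onI)
      fix z assume z: "z \<in> D"
      define c where "c = Complex (u'' z 1 1) (- u'' z 1 \<i>)"
      have sym: "u'' z \<i> 1 = u'' z 1 \<i>"
        by (rule second_derivative_symmetric[OF assms(1) z u u' cont])
      have lap': "u'' z \<i> \<i> = - u'' z 1 1"
        using lap[OF z] by (simp add: Basis_complex_def)
      have app: "u'' z h v = Re h * u'' z 1 v + Im h * u'' z \<i> v" for h v
        by (subst lin[of h]) (simp add: blinfun.add_right blinfun.add_left blinfun.scaleR_right blinfun.scaleR_left)
      have 1: "((\<lambda>w. u' w v) has_derivative (\<lambda>h. u'' z h v)) (at z)" for v
        by (rule has_derivative_eq_rhs[OF blinfun.FDERIV[OF u'[OF z] has_derivative_const]]) simp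
      have a_alt: "a = (\<lambda>w. of_real (u' w 1) - \<i> * of_real (u' w \<i>))"
        by (auto simp: a_def complex_eq_iff)
      have "(a has_derivative (\<lambda>h. of_real (u'' z h 1) - \<i> * of_real (u'' z h \<i>))) (at z)"
        unfolding a_alt
        by (intro has_derivative_diff has_derivative_mult_right bounded_linear.has_derivative[OF bounded_linear_of_real] 1)
      moreover have "of_real (u'' z h 1) - \<i> * of_real (u'' z h \<i>) = c * h" for h
        unfolding app[of h] by (simp add: c_def complex_eq_iff sym lap' algebra_simps)
      ultimately have "(a has_field_derivative c) (at z)"
        unfolding has_field_derivative_def by simp
      then show "a field_differentiable at z within D"
        using field_differentiable_at_within field_differentiable_def by blast
    qed
  next
    fix z assume z: "z \<in> D"
    have "u' z h = Re (a z * h)" for h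
      by (subst lin[of h]) (simp add: a_def blinfun.add_right blinfun.scaleR_right)
    then have "blinfun_apply (u' z) = (\<lambda>h. Re (a z * h))" by (rule ext)
    then show "(u has_derivative (\<lambda>h. Re (a z * h))) (at z)" using u[OF z] by (simp only:)
  qed
qed

text \<open>If \<open>a\<close> and \<open>b\<close> belong to Re f and Im f, then
  \<open>p = (a + i b) / 2\<close> and \<open>q = (a - i b) / 2\<close>. In Wirtinger notation
  \<open>p\<close> is f_z and \<open>q\<close> is the conjugate of f_zbar.\<close>

lemma harmonic_map_derivative:
  assumes "open D" "harmonic_map_on D f"
  obtains p q where "p holomorphic_on D" "q holomorphic_on D"
    "\<And>z. z \<in> D \<Longrightarrow> (f has_derivative (\<lambda>h. p z * h + cnj (q z * h))) (at z)"
proof -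
  obtain a where a: "a holomorphic_on D" "\<And>z. z \<in> D \<Longrightarrow> ((\<lambda>z. Re (f z)) has_derivative (\<lambda>h. Re (a z * h))) (at z)"
    using harmonic_fun_derivative assms unfolding harmonic_map_on_def by metis
  obtain b where b: "b holomorphic_on D" "\<And>z. z \<in> D \<Longrightarrow> ((\<lambda>z. Im (f z)) has_derivative (\<lambda>h. Re (b z * h))) (at z)"
    using harmonic_fun_derivative assms unfolding harmonic_map_on_def by metis
  have f: "f = (\<lambda>z. of_real (Re (f z)) + \<i> * of_real (Im (f z)))"
    by (auto simp: complex_eq_iff)
  show ?thesis
  proof (rule that)
    show "(\<lambda>z. (a z + \<i> * b z) / 2) holomorphic_on D" "(\<lambda>z. (a z - \<i> * b z) / 2) holomorphic_on D"
      using a b by (auto intro!: holomorphic_intros)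
    fix z assume z: "z \<in> D"
    have "(f has_derivative (\<lambda>h. of_real (Re (a z * h)) + \<i> * of_real (Re (b z * h)))) (at z)"
      by (subst f) (intro has_derivative_add has_derivative_mult_right bounded_linear.has_derivative[OF bounded_linear_of_real] a(2)[OF z] b(2)[OF z])
    moreover have "of_real (Re (a z * h)) + \<i> * of_real (Re (b z * h)) =
       (a z + \<i> * b z) / 2 * h + cnj ((a z - \<i> * b z) / 2 * h)" for h
      by (simp add: complex_eq_iff field_simps)
    ultimately show "(f has_derivative (\<lambda>h. (a z + \<i> * b z) / 2 * h + cnj ((a z - \<i> * b z) / 2 * h))) (at z)"
      by simp
  qed
qed

section \<open>Dilatation and orientation\<close>

lemma real_det_harmonic: "real_det (\<lambda>h. p * h + cnj (q * h)) = (cmod p)\<^sup>2 - (cmod q)\<^sup>2"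
  unfolding real_det_def cmod_power2 by (simp add: power2_eq_square algebra_simps)

text \<open>The squared norms of the images of 1 and i add up to 2 (|p|^2 + |q|^2), and each is at
  most the squared operator norm. The exact norm is |p| + |q|; the quadratic bound keeps the later
  inequalities polynomial.\<close>

lemma harmonic_onorm_ge:
  "(cmod p)\<^sup>2 + (cmod q)\<^sup>2 \<le> (onorm (\<lambda>h. p * h + cnj (q * h)))\<^sup>2"
proof -
  let ?L = "\<lambda>h. p * h + cnj (q * h)"
  have bl: "bounded_linear ?L"
    by (intro bounded_linear_add bounded_linear_mult_right bounded_linear_compose[OF bounded_linear_cnj])
  have "cmod (?L 1) \<le> onorm ?L" "cmod (?L \<i>) \<le> onorm ?L"
    using onorm[OF bl, of 1] onorm[OF bl, of \<i>] by auto
  then have le: "(cmod (?L 1))\<^sup>2 \<le> (onorm ?L)\<^sup>2" "(cmod (?L \<i>))\<^sup>2 \<le> (onorm ?L)\<^sup>2"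
    by (auto intro: power_mono)
  have "(cmod (?L 1))\<^sup>2 + (cmod (?L \<i>))\<^sup>2 = 2 * ((cmod p)\<^sup>2 + (cmod q)\<^sup>2)"
    unfolding cmod_power2 by (simp add: power2_eq_square algebra_simps)
  then have "2 * ((cmod p)\<^sup>2 + (cmod q)\<^sup>2) \<le> (onorm ?L)\<^sup>2 + (onorm ?L)\<^sup>2"
    using add_mono[OF le] by simp
  then show ?thesis by simp
qed

text \<open>Both sides are continuous in \<open>z\<close>, so a violation at one point would persist
  on a disc, which has positive measure.\<close>

lemma quasiconformal_harmonic_dilatation:
  assumes "open D" and pq: "continuous_on D p" "continuous_on D q"
    and f: "\<And>z. z \<in> D \<Longrightarrow> (f has_derivative (\<lambda>h. p z * h + cnj (q z * h))) (at z)"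
    and ae: "AE z in lborel. z \<in> D \<longrightarrow>
        (\<exists>f'. (f has_derivative f') (at z) \<and> (onorm f')\<^sup>2 \<le> K * \<bar>real_det f'\<bar>)"
    and z: "z \<in> D"
  shows "(cmod (p z))\<^sup>2 + (cmod (q z))\<^sup>2 \<le> K * \<bar>(cmod (p z))\<^sup>2 - (cmod (q z))\<^sup>2\<bar>"
proof (rule ccontr)
  let ?\<phi> = "\<lambda>z. (cmod (p z))\<^sup>2 + (cmod (q z))\<^sup>2 - K * \<bar>(cmod (p z))\<^sup>2 - (cmod (q z))\<^sup>2\<bar>"
  assume "\<not> ?thesis"
  then have pos: "?\<phi> z > 0" by simp
  have ae': "AE z in lborel. z \<in> D \<longrightarrow> ?\<phi> z \<le> 0"
  proof (rule AE_mp[OF ae], rule AE_I2, intro impI)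
    fix w assume "w \<in> D \<longrightarrow> (\<exists>f'. (f has_derivative f') (at w) \<and> (onorm f')\<^sup>2 \<le> K * \<bar>real_det f'\<bar>)" and w: "w \<in> D"
    then obtain f' where f': "(f has_derivative f') (at w)" "(onorm f')\<^sup>2 \<le> K * \<bar>real_det f'\<bar>" by blast
    have "f' = (\<lambda>h. p w * h + cnj (q w * h))" using has_derivative_unique[OF f'(1) f[OF w]] .
    then show "?\<phi> w \<le> 0"
      using f'(2) harmonic_onorm_ge[of "p w" "q w"] real_det_harmonic[of "p w" "q w"] by simp
  qed
  have "continuous_on D ?\<phi>" using pq by (intro continuous_intros)
  then have "open (D \<inter> ?\<phi> -` {0<..})"
    using \<open>open D\<close> by (intro continuous_open_preimage) auto
  then obtain r where r: "r > 0" "ball z r \<subseteq> D \<inter> ?\<phi> -` {0<..}"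
    using z pos open_contains_ball by (metis (no_types, lifting) IntI greaterThan_iff vimageI)
  have "AE w in lborel. w \<notin> ball z r"
    using ae' by (rule AE_mp) (use r in \<open>force intro!: AE_I2\<close>)
  then have "emeasure lborel (ball z r) = 0"
    by (subst (asm) AE_iff_measurable[of "ball z r"]) auto
  then show False using content_ball_pos[OF r(1), of z] by (simp add: measure_def)
qed

lemma dilatation_dominated:
  fixes a b K :: real
  assumes "a\<^sup>2 + b\<^sup>2 \<le> K * \<bar>a\<^sup>2 - b\<^sup>2\<bar>" "0 \<le> b" "b \<le> a" "1 \<le> K"
  shows "b\<^sup>2 \<le> ((K - 1) / (K + 1)) * a\<^sup>2"
proof -
  have "b\<^sup>2 \<le> a\<^sup>2" using assms by (intro power_mono) auto
  then have "(K + 1) * b\<^sup>2 \<le> (K - 1) * a\<^sup>2" using assms(1) by (simp add: algebra_simps)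
  then show "b\<^sup>2 \<le> ((K - 1) / (K + 1)) * a\<^sup>2" using assms(4) by (simp add: field_simps)
qed

text \<open>Where |p| = |q| the dilatation inequality forces p = q = 0. The zeros of
  \<open>p\<close> form a countable set, and a planar domain minus a countable set is connected, so
  |p| - |q| cannot change sign off these zeros.\<close>

lemma dilatation_sense:
  assumes D: "open D" "connected D" and p: "p holomorphic_on D" and q: "q holomorphic_on D"
    and dil: "\<And>z. z \<in> D \<Longrightarrow> (cmod (p z))\<^sup>2 + (cmod (q z))\<^sup>2 \<le> K * \<bar>(cmod (p z))\<^sup>2 - (cmod (q z))\<^sup>2\<bar>"
    and z0: "z0 \<in> D" "cmod (q z0) < cmod (p z0)" and z: "z \<in> D"
  shows "cmod (q z) \<le> cmod (p z)"
proof (rule ccontr)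
  assume less: "\<not> cmod (q z) \<le> cmod (p z)"
  have pc: "continuous_on D p" and qc: "continuous_on D q"
    using p q holomorphic_on_imp_continuous_on by auto
  define Z where "Z = {w \<in> D. p w = 0}"
  have Z: "countable Z"
  proof (cases "p constant_on D")
    case True
    then have "Z = {}" using z0 by (force simp: Z_def constant_on_def)
    then show ?thesis by simp
  next
    case False
    \<comment> \<open>Exhaustion by compact sets shows \<open>D\<close> to be an F-sigma set, as the
      countability theorem for zeros asks.\<close>
    obtain C :: "nat \<Rightarrow> complex set" where C: "\<And>n. compact (C n)" "\<Union>(range C) = D"
      using open_Union_compact_subsets[OF D(1)] by metis
    then have "fsigma D" using fsigma.intros[of C] compact_imp_closed by auto
    then show ?thesis unfolding Z_def by (intro holomorphic_countable_zeros p D False)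
  qed
  then have conn: "connected (D - Z)" using connected_open_diff_countable[of D Z] D by simp
  define A where "A = D \<inter> (\<lambda>w. cmod (p w) - cmod (q w)) -` {0<..}"
  define B where "B = D \<inter> (\<lambda>w. cmod (p w) - cmod (q w)) -` {..<0}"
  have "open A" "open B"
    unfolding A_def B_def using D pc qc by (auto intro!: continuous_open_preimage continuous_intros)
  have "z \<in> B" using less z by (simp add: B_def)
  then obtain r where "r > 0" "ball z r \<subseteq> B"
    using \<open>open B\<close> open_contains_ball by blast
  \<comment> \<open>\<open>B\<close> contains a disc and is therefore too large to consist of zeros
    of \<open>p\<close> alone.\<close>
  then have "uncountable B" using uncountable_ball countable_subset by blast
  then obtain w where w: "w \<in> B - Z" using countable_subset[OF _ Z, of B] by auto
  have "A \<union> B \<supseteq> D - Z"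
  proof
    fix w assume w: "w \<in> D - Z"
    have "cmod (p w) \<noteq> cmod (q w)"
    proof
      assume "cmod (p w) = cmod (q w)"
      then have "(cmod (p w))\<^sup>2 + (cmod (q w))\<^sup>2 \<le> 0" using dil[of w] w by simp
      then have "p w = 0" by (metis norm_eq_zero sum_power2_le_zero_iff)
      then show False using w by (simp add: Z_def)
    qed
    then show "w \<in> A \<union> B" using w by (auto simp: A_def B_def)
  qed
  moreover have "z0 \<in> A \<inter> (D - Z)" using z0 by (auto simp: A_def Z_def)
  moreover have "w \<in> B \<inter> (D - Z)" using w by (auto simp: B_def)
  moreover have "A \<inter> B \<inter> (D - Z) = {}" by (auto simp: A_def B_def)
  ultimately show False
    using connectedD[OF conn \<open>open A\<close> \<open>open B\<close>] by blast
qed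

section \<open>Winding numbers and zeros of the dominating coefficient\<close>

lemma winding_number_power_circle:
  fixes N :: nat and v c :: complex
  assumes c: "c \<noteq> 0"
  defines "\<Gamma> \<equiv> \<lambda>t. v + c * exp (2 * of_real pi * \<i> * of_nat N * of_real t)"
  shows "path \<Gamma>" "pathfinish \<Gamma> = pathstart \<Gamma>" "winding_number \<Gamma> v = of_nat N"
proof -
  let ?k = "2 * of_real pi * \<i> * of_nat N :: complex"
  have der: "(\<Gamma> has_vector_derivative c * ?k * exp (?k * of_real t)) (at t)" for t
  proof -
    have "((\<lambda>z. v + c * exp (?k * z)) has_field_derivative c * ?k * exp (?k * of_real t)) (at (of_real t))"
      by (auto intro!: derivative_eq_intros)
    from has_vector_derivative_real_field[OF this] show ?thesis by (simp add: \<Gamma>_def o_def)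
  qed
  have "\<Gamma> C1_differentiable_on {0..1}"
    unfolding C1_differentiable_on_def using der
    by (intro exI[of _ "\<lambda>t. c * ?k * exp (?k * of_real t)"]) (auto intro!: continuous_intros)
  then have vp: "valid_path \<Gamma>"
    unfolding valid_path_def by (rule C1_differentiable_imp_piecewise)
  then show "path \<Gamma>" by (rule valid_path_imp_path)
  have "exp ?k = 1"
    using exp_integer_2pi[of "of_nat N"] by (simp add: mult_ac)
  then show "pathfinish \<Gamma> = pathstart \<Gamma>" by (simp add: pathfinish_def pathstart_def \<Gamma>_def)
  have nv: "v \<notin> path_image \<Gamma>" using c by (auto simp: path_image_def \<Gamma>_def)
  \<comment> \<open>The derivative of \<Gamma> is \<open>?k\<close> times \<Gamma> - v, so the
    integrand along the path is the constant 2 pi i N.\<close>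
  have "((\<lambda>w. 1 / (w - v)) has_contour_integral ?k) \<Gamma>"
    unfolding has_contour_integral_def
  proof (rule has_integral_eq)
    show "((\<lambda>t. ?k) has_integral ?k) {0..1::real}"
      using has_integral_const_real[of ?k 0 1] by simp
    fix t :: real assume "t \<in> {0..1}"
    then have "vector_derivative \<Gamma> (at t within {0..1}) = c * ?k * exp (?k * of_real t)"
      by (intro vector_derivative_at_within_ivl[OF der]) auto
    then show "?k = 1 / (\<Gamma> t - v) * vector_derivative \<Gamma> (at t within {0..1})"
      using c by (simp add: \<Gamma>_def)
  qed
  then have "contour_integral \<Gamma> (\<lambda>w. 1 / (w - v)) = ?k" by (rule contour_integral_unique)
  then show "winding_number \<Gamma> v = of_nat N"
    by (subst winding_number_valid_path[OF vp nv]) (simp add: field_simps)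
qed

text \<open>At a zero of order \<open>n \<ge> 1\<close> of \<open>p\<close> the map is close to
  \<open>z \<mapsto> f z0 + a (z - z0)\<^sup>n\<^sup>+\<^sup>1 / (n + 1)\<close>, so the image of a small circle winds \<open>n + 1 \<ge> 2\<close> times around \<open>f z0\<close>.\<close>

lemma injective_harmonic_nonvanishing:
  fixes f p q :: "complex \<Rightarrow> complex"
  assumes D: "open D" "connected D" and p: "p holomorphic_on D"
    and f: "\<And>z. z \<in> D \<Longrightarrow> (f has_derivative (\<lambda>h. p z * h + cnj (q z * h))) (at z)"
    and dom: "\<And>z. z \<in> D \<Longrightarrow> cmod (q z) \<le> \<kappa> * cmod (p z)" and \<kappa>: "0 \<le> \<kappa>" "\<kappa> < 1"
    and inj: "inj_on f D" and z0: "z0 \<in> D" and nz: "z1 \<in> D" "p z1 \<noteq> 0"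
  shows "p z0 \<noteq> 0"
proof
  assume p0: "p z0 = 0"
  have "\<not> p constant_on D" unfolding constant_on_def using p0 z0 nz by metis
  then obtain g r n where g: "0 < n" "0 < r" "ball z0 r \<subseteq> D" "g holomorphic_on ball z0 r"
    "\<And>w. w \<in> ball z0 r \<Longrightarrow> p w = (w - z0) ^ n * g w" "\<And>w. w \<in> ball z0 r \<Longrightarrow> g w \<noteq> 0"
    using holomorphic_factor_zero_nonconstant[OF p D z0 p0] by metis
  define a where "a = g z0"
  have a: "a \<noteq> 0" using g by (simp add: a_def)
  \<comment> \<open>\<theta> is the total relative error: \<epsilon> from replacing \<open>g\<close>
    by \<open>a\<close>, and \<kappa> (1 + \<epsilon>) from the conjugate term. With this \<epsilon>
    it is at most (1 + \<kappa>) / 2.\<close>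
  define \<epsilon> where "\<epsilon> = (1 - \<kappa>) / 4"
  have \<epsilon>: "0 < \<epsilon>" using \<kappa> by (simp add: \<epsilon>_def)
  define \<theta> where "\<theta> = \<epsilon> + \<kappa> * (1 + \<epsilon>)"
  have "\<kappa> * \<epsilon> \<le> 1 * \<epsilon>" using \<kappa> \<epsilon> by (intro mult_right_mono) auto
  then have "\<theta> \<le> 2 * \<epsilon> + \<kappa>" by (simp add: \<theta>_def distrib_left)
  also have "\<dots> < 1" using \<kappa> by (simp add: \<epsilon>_def field_simps)
  finally have \<theta>: "\<theta> < 1" "0 \<le> \<theta>" using \<kappa> \<epsilon> by (auto simp: \<theta>_def)
  have "continuous_on (ball z0 r) g" using g holomorphic_on_imp_continuous_on by blast
  then obtain \<rho>' where \<rho>': "\<rho>' > 0" "\<And>w. w \<in> ball z0 r \<Longrightarrow> dist w z0 < \<rho>' \<Longrightarrow> dist (g w) (g z0) < \<epsilon> * cmod a"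
    using \<epsilon> a g(2) unfolding continuous_on_iff by (metis centre_in_ball mult_pos_pos zero_less_norm_iff)
  define s where "s = min r \<rho>' / 2"
  have s: "0 < s" "s < r" "s < \<rho>'" using g \<rho>' by (auto simp: s_def)
  have near: "z0 + \<zeta> \<in> ball z0 r \<and> cmod (g (z0 + \<zeta>) - a) \<le> \<epsilon> * cmod a" if "cmod \<zeta> \<le> s" for \<zeta>
    using that s \<rho>'(2)[of "z0 + \<zeta>"] by (auto simp: dist_norm a_def)
  have est: "cmod (f (z0 + \<zeta>) - f z0 - a * \<zeta> ^ Suc n / of_nat (Suc n)) \<le> \<theta> * cmod (a * \<zeta> ^ Suc n / of_nat (Suc n))"
    if \<zeta>: "cmod \<zeta> = s" for \<zeta>
  proof -
    \<comment> \<open>\<psi> is the error along the radius to \<open>z0 + \<zeta>\<close>, and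
      \<phi> is a majorant: the norm of the derivative of \<psi> is at most the derivative of
      \<phi>, so the increments compare in the same way.\<close>
    define \<psi> where "\<psi> t = f (z0 + of_real t * \<zeta>) - a * (of_real t * \<zeta>) ^ Suc n / of_nat (Suc n)" for t
    define \<phi> where "\<phi> t = \<theta> * cmod a * s ^ Suc n * t ^ Suc n / real (Suc n)" for t
    have inD: "z0 + of_real t * \<zeta> \<in> D" if "0 \<le> t" "t \<le> 1" for t
      using near[of "of_real t * \<zeta>"] that \<zeta> g(3) s(1) by (auto simp: norm_mult mult_left_le_one_le)
    have der: "(\<psi> has_vector_derivative p (z0 + of_real t * \<zeta>) * \<zeta> + cnj (q (z0 + of_real t * \<zeta>) * \<zeta>) - a * of_real t ^ n * \<zeta> ^ Suc n) (at t)"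
      if t: "0 \<le> t" "t \<le> 1" for t
    proof -
      have "((\<lambda>t. z0 + of_real t * \<zeta>) has_derivative (\<lambda>h. of_real h * \<zeta>)) (at t)"
        by (auto intro!: derivative_eq_intros)
      from has_derivative_compose[OF this f[OF inD[OF t]]]
      have 1: "((\<lambda>t. f (z0 + of_real t * \<zeta>)) has_vector_derivative p (z0 + of_real t * \<zeta>) * \<zeta> + cnj (q (z0 + of_real t * \<zeta>) * \<zeta>)) (at t)"
        unfolding has_vector_derivative_def
        by (rule has_derivative_eq_rhs) (auto simp: scaleR_conv_of_real algebra_simps)
      have "((\<lambda>z. a * (z * \<zeta>) ^ Suc n / of_nat (Suc n)) has_field_derivative a * of_real t ^ n * \<zeta> ^ Suc n) (at (of_real t))"
        by (rule derivative_eq_intros refl | simp add: power_mult_distrib field_simps del: of_nat_Suc)+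
      from has_vector_derivative_real_field[OF this]
      have 2: "((\<lambda>t. a * (of_real t * \<zeta>) ^ Suc n / of_nat (Suc n)) has_vector_derivative a * of_real t ^ n * \<zeta> ^ Suc n) (at t)"
        by (simp add: o_def)
      show ?thesis unfolding \<psi>_def[abs_def] by (rule has_vector_derivative_diff[OF 1 2])
    qed
    have "norm (\<psi> 1 - \<psi> 0) \<le> \<phi> 1 - \<phi> 0"
    proof (rule differentiable_bound_general[of 0 1 \<psi> \<phi>, OF zero_less_one])
      show "continuous_on {0..1} \<psi>"
        using has_vector_derivative_continuous[OF der] by (intro continuous_at_imp_continuous_on) auto
      show "continuous_on {0..1} \<phi>" unfolding \<phi>_def by (intro continuous_intros) auto
      fix t :: real assume t: "0 < t" "t < 1"
      show "(\<psi> has_vector_derivative p (z0 + of_real t * \<zeta>) * \<zeta> + cnj (q (z0 + of_real t * \<zeta>) * \<zeta>) - a * of_real t ^ n * \<zeta> ^ Suc n) (at t)"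
        using der t by simp
      have "(\<phi> has_real_derivative \<theta> * cmod a * s ^ Suc n * t ^ n) (at t)"
        unfolding \<phi>_def by (rule derivative_eq_intros refl | simp add: field_simps del: of_nat_Suc)+
      then show "(\<phi> has_vector_derivative \<theta> * cmod a * s ^ Suc n * t ^ n) (at t)"
        by (simp add: has_real_derivative_iff_has_vector_derivative)
      define w where "w = z0 + of_real t * \<zeta>"
      have le: "cmod (of_real t * \<zeta>) \<le> s" using t \<zeta> s by (simp add: norm_mult mult_left_le_one_le)
      have w: "w \<in> ball z0 r" "cmod (g w - a) \<le> \<epsilon> * cmod a"
        using near[OF le] by (auto simp: w_def)
      have pw: "p w = of_real t ^ n * \<zeta> ^ n * g w" using g(5)[OF w(1)] by (simp add: w_def power_mult_distrib)
      have gw: "cmod (g w) \<le> (1 + \<epsilon>) * cmod a"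
        using w(2) norm_triangle_ineq2[of "g w" a] by (simp add: algebra_simps)
      have eq: "p w * \<zeta> + cnj (q w * \<zeta>) - a * of_real t ^ n * \<zeta> ^ Suc n
          = of_real t ^ n * \<zeta> ^ Suc n * (g w - a) + cnj (q w * \<zeta>)"
        unfolding pw by (simp add: algebra_simps)
      have "cmod (p w * \<zeta> + cnj (q w * \<zeta>) - a * of_real t ^ n * \<zeta> ^ Suc n)
          \<le> t ^ n * s ^ Suc n * cmod (g w - a) + cmod (q w) * s"
        unfolding eq
        using norm_triangle_ineq[of "of_real t ^ n * \<zeta> ^ Suc n * (g w - a)" "cnj (q w * \<zeta>)"] t \<zeta>
        by (simp add: norm_mult norm_power)
      also have "\<dots> \<le> t ^ n * s ^ Suc n * (\<epsilon> * cmod a) + (\<kappa> * (t ^ n * s ^ n * ((1 + \<epsilon>) * cmod a))) * s"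
      proof (intro add_mono mult_left_mono mult_right_mono w(2))
        have "cmod (q w) \<le> \<kappa> * cmod (p w)" using dom w(1) g(3) by blast
        also have "cmod (p w) = t ^ n * s ^ n * cmod (g w)" unfolding pw using t \<zeta> by (simp add: norm_mult norm_power)
        also have "\<kappa> * (t ^ n * s ^ n * cmod (g w)) \<le> \<kappa> * (t ^ n * s ^ n * ((1 + \<epsilon>) * cmod a))"
          using \<kappa> t s gw by (intro mult_left_mono) auto
        finally show "cmod (q w) \<le> \<kappa> * (t ^ n * s ^ n * ((1 + \<epsilon>) * cmod a))" .
      qed (use t s in auto)
      also have "\<dots> = \<theta> * cmod a * s ^ Suc n * t ^ n" by (simp add: \<theta>_def algebra_simps)
      finally show "norm (p (z0 + of_real t * \<zeta>) * \<zeta> + cnj (q (z0 + of_real t * \<zeta>) * \<zeta>) - a * of_real t ^ n * \<zeta> ^ Suc n) \<le> \<theta> * cmod a * s ^ Suc n * t ^ n"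
        by (simp add: w_def)
    qed
    moreover have "\<phi> 1 - \<phi> 0 = \<theta> * cmod (a * \<zeta> ^ Suc n / of_nat (Suc n))"
      unfolding \<phi>_def using \<zeta> by (simp add: norm_mult norm_divide norm_power del: of_nat_Suc)
    moreover have "\<psi> 1 - \<psi> 0 = f (z0 + \<zeta>) - f z0 - a * \<zeta> ^ Suc n / of_nat (Suc n)"
      unfolding \<psi>_def by simp
    ultimately show ?thesis by simp
  qed
  define v where "v = f z0"
  define c where "c = a * of_real s ^ Suc n / of_nat (Suc n)"
  have c: "c \<noteq> 0" using a s by (simp add: c_def del: of_nat_Suc)
  define \<Gamma> where "\<Gamma> = (\<lambda>t. v + c * exp (2 * of_real pi * \<i> * of_nat (Suc n) * of_real t))"
  note \<Gamma> = winding_number_power_circle[OF c, where v = v and N = "Suc n", folded \<Gamma>_def]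
  define \<gamma> where "\<gamma> = f \<circ> circlepath z0 s"
  have sub: "path_image (circlepath z0 s) \<subseteq> D"
    using s g(3) by (auto simp: subset_iff dist_norm)
  have contf: "continuous_on D f"
    using f by (auto intro!: continuous_at_imp_continuous_on has_derivative_continuous)
  have simple: "simple_path \<gamma>"
    unfolding \<gamma>_def using s sub contf inj
    by (intro simple_path_continuous_image) (auto simp: simple_path_circlepath intro: continuous_on_subset inj_on_subset)
  have loop: "pathfinish \<gamma> = pathstart \<gamma>"
    unfolding \<gamma>_def by (simp add: pathfinish_compose pathstart_compose)
  have v: "v \<notin> path_image \<gamma>"
  proof
    assume "v \<in> path_image \<gamma>"
    then obtain z where "z \<in> path_image (circlepath z0 s)" "f z = f z0" by (auto simp: \<gamma>_def path_image_compose v_def)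
    then have "z0 \<in> path_image (circlepath z0 s)" using inj sub z0 by (metis inj_onD subsetD)
    then show False using s by simp
  qed
  \<comment> \<open>Comparison as in Rouche's theorem: at each time the image curve is closer to
    \<Gamma> than \<Gamma> is to \<open>v\<close>, so the straight homotopy avoids
    \<open>v\<close>.\<close>
  have "homotopic_loops (- {v}) \<Gamma> \<gamma>"
  proof (rule homotopic_loops_nearby_explicit)
    fix t :: real and x assume "t \<in> {0..1}" "x \<notin> - {v}"
    then have x: "x = v" by simp
    define \<zeta> where "\<zeta> = of_real s * exp (2 * of_real pi * \<i> * of_real t)"
    have \<zeta>s: "cmod \<zeta> = s" using s by (simp add: \<zeta>_def norm_mult)
    have \<gamma>t: "\<gamma> t = f (z0 + \<zeta>)" by (simp add: \<gamma>_def circlepath \<zeta>_def)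
    have "exp (2 * of_real pi * \<i> * of_nat (Suc n) * of_real t) = exp (2 * of_real pi * \<i> * of_real t) ^ Suc n"
      by (subst exp_of_nat_mult[symmetric]) (simp add: algebra_simps)
    then have \<Gamma>t: "\<Gamma> t - v = a * \<zeta> ^ Suc n / of_nat (Suc n)"
      by (simp add: \<Gamma>_def c_def \<zeta>_def power_mult_distrib del: of_nat_Suc power_Suc)
    have "norm (\<gamma> t - \<Gamma> t) = cmod (f (z0 + \<zeta>) - f z0 - a * \<zeta> ^ Suc n / of_nat (Suc n))"
      unfolding \<gamma>t \<Gamma>t[symmetric] v_def by (simp add: algebra_simps)
    also have "\<dots> \<le> \<theta> * cmod (\<Gamma> t - v)" unfolding \<Gamma>t by (rule est[OF \<zeta>s])
    also have "\<dots> < 1 * cmod (\<Gamma> t - v)"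
      using \<theta> c by (intro mult_strict_right_mono) (auto simp: \<Gamma>_def)
    finally show "norm (\<gamma> t - \<Gamma> t) < norm (\<Gamma> t - x)" by (simp add: x)
  qed (use \<Gamma> simple loop simple_path_imp_path in auto)
  then have "winding_number \<gamma> v = of_nat (Suc n)"
    using winding_number_homotopic_loops \<Gamma>(3) by metis
  then have "Re (winding_number \<gamma> v) = real (Suc n)" by simp
  \<comment> \<open>Injectivity makes \<gamma> a simple closed curve, which winds at most once,
    against n + 1 \<ge> 2.\<close>
  moreover have "winding_number \<gamma> v \<in> {-1, 0, 1}"
    by (rule simple_closed_path_winding_number_cases[OF simple loop v])
  then have "Re (winding_number \<gamma> v) \<le> 1" by auto
  ultimately show False using g(1) by simp
qed

subsection \<open>The length-area estimate\<close>

text \<open>The change of variables formula applied below is stated on \<open>real^n\<close>, so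
  Lebesgue measure is moved to \<open>real^2\<close>.\<close>

lemma lborel_complex_eq_vec:
  "lborel = distr (lborel :: (real^2) measure) borel (\<lambda>v. Complex (v $ 1) (v $ 2))"
proof (rule lborel_eqI)
  let ?e = "\<lambda>v :: real^2. Complex (v $ 1) (v $ 2)"
  have meas: "?e \<in> borel \<rightarrow>\<^sub>M borel"
    by (intro borel_measurable_continuous_onI continuous_intros)
  fix l u :: complex assume le: "\<And>b. b \<in> Basis \<Longrightarrow> l \<bullet> b \<le> u \<bullet> b"
  let ?l = "vector [Re l, Im l] :: real^2" and ?u = "vector [Re u, Im u] :: real^2"
  have B: "(Basis :: (real^2) set) = {axis 1 1, axis 2 1}"
    by (auto simp: Basis_vec_def UNIV_2)
  have ne: "axis 1 1 \<noteq> (axis 2 1 :: real^2)" by (simp add: axis_eq_axis)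
  have *: "?e -` box l u = box ?l ?u"
    by (auto simp: box_def Basis_complex_def B inner_axis)
  have "Re l \<le> Re u" "Im l \<le> Im u" using le[of 1] le[of \<i>] by (auto simp: Basis_complex_def)
  then have "emeasure lborel (box ?l ?u) = ennreal ((Re u - Re l) * (Im u - Im l))"
    by (subst emeasure_lborel_box) (use ne in \<open>auto simp: B inner_axis inner_diff_left\<close>)
  moreover have "(\<Prod>b\<in>Basis. (u - l) \<bullet> b) = (Re u - Re l) * (Im u - Im l)"
    by (simp add: Basis_complex_def)
  ultimately show "emeasure (distr lborel borel ?e) (box l u) = (\<Prod>b\<in>Basis. (u - l) \<bullet> b)"
    using meas * by (subst emeasure_distr) auto
qed simp

text \<open>The product form of the same transfer, for Tonelli's theorem.\<close>

lemma lborel_complex_eq_pair: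
  "lborel = distr (lborel :: (real \<times> real) measure) borel (\<lambda>(x, y). Complex x y)"
proof (rule lborel_eqI)
  let ?e = "\<lambda>(x, y). Complex x y"
  have meas: "?e \<in> borel \<rightarrow>\<^sub>M borel"
    unfolding case_prod_unfold by (intro borel_measurable_continuous_onI continuous_intros)
  fix l u :: complex assume le: "\<And>b. b \<in> Basis \<Longrightarrow> l \<bullet> b \<le> u \<bullet> b"
  have le': "Re l \<le> Re u" "Im l \<le> Im u" using le[of 1] le[of \<i>] by (auto simp: Basis_complex_def)
  have *: "?e -` box l u = {Re l<..<Re u} \<times> {Im l<..<Im u}"
    by (auto simp: box_def Basis_complex_def)
  have "emeasure (lborel :: (real \<times> real) measure) ({Re l<..<Re u} \<times> {Im l<..<Im u}) = ennreal (Re u - Re l) * ennreal (Im u - Im l)"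
    unfolding lborel_prod[symmetric] using le' by (subst lborel.emeasure_pair_measure_Times) auto
  also have "\<dots> = (\<Prod>b\<in>Basis. (u - l) \<bullet> b)"
    using le' by (simp add: Basis_complex_def ennreal_mult)
  finally show "emeasure (distr lborel borel ?e) (box l u) = (\<Prod>b\<in>Basis. (u - l) \<bullet> b)"
    using meas * by (subst emeasure_distr) auto
qed simp

lemma nn_integral_complex_eq_iterated:
  fixes \<phi> :: "complex \<Rightarrow> ennreal"
  assumes [measurable]: "\<phi> \<in> borel_measurable borel"
  shows "(\<integral>\<^sup>+z. \<phi> z \<partial>lborel) = (\<integral>\<^sup>+x. \<integral>\<^sup>+y. \<phi> (Complex x y) \<partial>lborel \<partial>lborel)"
proof -
  have [measurable]: "(\<lambda>(x, y). Complex x y) \<in> borel \<Otimes>\<^sub>M borel \<rightarrow>\<^sub>M borel"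
    unfolding case_prod_unfold borel_prod by (intro borel_measurable_continuous_onI continuous_intros)
  have "(\<integral>\<^sup>+z. \<phi> z \<partial>lborel) = (\<integral>\<^sup>+v. \<phi> (case v of (x, y) \<Rightarrow> Complex x y) \<partial>(lborel \<Otimes>\<^sub>M lborel))"
    unfolding lborel_prod by (subst lborel_complex_eq_pair, subst nn_integral_distr) (auto simp: borel_prod[symmetric])
  also have "\<dots> = (\<integral>\<^sup>+x. \<integral>\<^sup>+y. \<phi> (Complex x y) \<partial>lborel \<partial>lborel)"
    by (subst lborel.nn_integral_fst[symmetric]) auto
  finally show ?thesis .
qed

lemma borel_measurable_indicator_ennreal:
  fixes \<phi> :: "'a::topological_space \<Rightarrow> real"
  assumes "open A" "continuous_on A \<phi>"
  shows "(\<lambda>z. indicator A z * ennreal (\<phi> z)) \<in> borel_measurable borel"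
proof -
  have "(\<lambda>z. indicator A z *\<^sub>R \<phi> z) \<in> borel_measurable borel"
    using assms by (intro borel_measurable_continuous_on_indicator) auto
  then have "(\<lambda>z. ennreal (indicator A z *\<^sub>R \<phi> z)) \<in> borel_measurable borel"
    by measurable
  moreover have "(\<lambda>z. ennreal (indicator A z *\<^sub>R \<phi> z)) = (\<lambda>z. indicator A z * ennreal (\<phi> z))"
    by (auto simp: indicator_def)
  ultimately show ?thesis by (simp only:)
qed

text \<open>Change of variables for the constant 1 on the image. As an inequality it is trivial for
  images of infinite area, and for finite area the constant is integrable.\<close>

lemma area_image_ge:
  fixes H :: "complex \<Rightarrow> complex"
  assumes R: "open R" and der: "\<And>z. z \<in> R \<Longrightarrow> (H has_derivative H' z) (at z)" and inj: "inj_on H R"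
    and cont: "continuous_on R (\<lambda>z. real_det (H' z))"
  shows "(\<integral>\<^sup>+z. indicator R z * ennreal \<bar>real_det (H' z)\<bar> \<partial>lborel) \<le> emeasure lborel (H ` R)"
proof (cases "emeasure lborel (H ` R) = \<infinity>")
  case False
  let ?e = "\<lambda>v :: real^2. Complex (v $ 1) (v $ 2)"
  let ?d = "\<lambda>z. vector [Re z, Im z] :: real^2"
  have de [simp]: "?d (?e v) = v" "?e (?d z) = z" for v z
    by (auto simp: vec_eq_iff forall_2)
  have dfun: "?d = (\<lambda>z. Re z *\<^sub>R axis 1 1 + Im z *\<^sub>R axis 2 1)"
    by (auto simp: vec_eq_iff forall_2 axis_def)
  have d_bl: "bounded_linear ?d"
    unfolding dfun by (intro bounded_linear_add bounded_linear_scaleR_const bounded_linear_Re bounded_linear_Im)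
  have efun: "?e = (\<lambda>v. of_real (v $ 1) + \<i> * of_real (v $ 2))"
    by (auto simp: complex_eq_iff)
  have e_bl: "bounded_linear ?e"
    unfolding efun by (intro bounded_linear_add bounded_linear_compose[OF bounded_linear_mult_right]
        bounded_linear_compose[OF bounded_linear_of_real] bounded_linear_vec_nth)
  have meas: "?e \<in> borel \<rightarrow>\<^sub>M borel"
    by (intro borel_measurable_continuous_onI continuous_intros)
  define S where "S = ?e -` R"
  define g where "g v = ?d (H (?e v))" for v
  define g' where "g' v h = ?d (H' (?e v) (?e h))" for v h
  have openS: "open S"
    unfolding S_def by (rule open_vimage[OF R]) (intro continuous_intros)
  have derg: "(g has_derivative g' v) (at v within S)" if "v \<in> S" for v
  proof -
    have "(H has_derivative H' (?e v)) (at (?e v))" using der that by (auto simp: S_def)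
    from has_derivative_compose[OF bounded_linear_imp_has_derivative[OF e_bl] this]
    have "((\<lambda>v. H (?e v)) has_derivative (\<lambda>h. H' (?e v) (?e h))) (at v within S)" .
    from bounded_linear.has_derivative[OF d_bl this] show ?thesis
      unfolding g_def[abs_def] g'_def[abs_def] .
  qed
  have injg: "inj_on g S"
  proof (rule inj_onI)
    fix v w assume "v \<in> S" "w \<in> S" "g v = g w"
    then have "H (?e v) = H (?e w)" using de(2) unfolding g_def by metis
    then have "?e v = ?e w" using inj \<open>v \<in> S\<close> \<open>w \<in> S\<close> by (auto simp: S_def inj_on_def)
    then show "v = w" using de(1) by metis
  qed
  have det: "det (matrix (g' v)) = real_det (H' (?e v))" for v
  proof -
    have "?e (axis 1 1) = 1" "?e (axis 2 1) = \<i>" by (auto simp: complex_eq_iff axis_def)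
    then show ?thesis
      by (simp add: det_2 matrix_def g'_def real_det_def)
  qed
  have contH: "continuous_on R H"
    using der by (auto intro!: continuous_at_imp_continuous_on has_derivative_continuous)
  \<comment> \<open>Invariance of domain makes the image open, hence measurable.\<close>
  have HR: "open (H ` R)"
    using invariance_of_domain_gen[OF R contH inj] by simp
  have gS: "g ` S = ?e -` (H ` R)"
  proof (intro equalityI subsetI)
    fix w assume "w \<in> g ` S"
    then obtain v where "v \<in> S" "w = g v" by blast
    then have "?e w = H (?e v)" "?e v \<in> R" by (auto simp: g_def S_def)
    then show "w \<in> ?e -` (H ` R)" by blast
  next
    fix w assume "w \<in> ?e -` (H ` R)"
    then obtain z where z: "?e w = H z" "z \<in> R" by blast
    then have "w = g (?d z)" "?d z \<in> S" using de(1)[of w] de(2)[of z] by (auto simp: g_def S_def)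
    then show "w \<in> g ` S" by blast
  qed
  have openA: "open (g ` S)"
    unfolding gS by (rule open_vimage[OF HR]) (intro continuous_intros)
  have em: "emeasure lborel (H ` R) = emeasure lborel (g ` S)"
    unfolding gS using HR meas by (subst lborel_complex_eq_vec, subst emeasure_distr) auto
  define m where "m = measure lborel (g ` S)"
  have m: "emeasure lborel (g ` S) = ennreal m"
    using False em unfolding m_def by (intro emeasure_eq_ennreal_measure) auto
  have lm: "g ` S \<in> lmeasurable"
    using m openA by (intro fmeasurableI) (auto simp: emeasure_completion)
  have "((\<lambda>x. 1) has_integral m) (g ` S)"
    unfolding m_def by (rule has_integral_measure_lborel) (use openA m in auto)
  \<comment> \<open>The formula is for vector-valued integrands, so the constant is written in
    \<open>real^1\<close> and read off by its coordinate at the end.\<close>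
  then have int1: "((\<lambda>x. (1::real) *\<^sub>R (vec 1 :: real^1)) has_integral m *\<^sub>R vec 1) (g ` S)"
    by (rule has_integral_scaleR_left)
  have ai: "(\<lambda>x. (vec 1 :: real^1)) absolutely_integrable_on (g ` S)"
    using lm by (rule absolutely_integrable_on_const)
  from has_absolute_integral_change_of_variables[OF _ derg injg, of "\<lambda>x. vec 1 :: real^1" "m *\<^sub>R vec 1"]
  have cv: "(\<lambda>x. \<bar>det (matrix (g' x))\<bar> *\<^sub>R (vec 1 :: real^1)) absolutely_integrable_on S"
    "integral S (\<lambda>x. \<bar>det (matrix (g' x))\<bar> *\<^sub>R (vec 1 :: real^1)) = m *\<^sub>R vec 1"
    using ai int1 openS by (auto simp: integral_unique)
  then have "((\<lambda>x. \<bar>det (matrix (g' x))\<bar> *\<^sub>R (vec 1 :: real^1)) has_integral m *\<^sub>R vec 1) S"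
    using set_lebesgue_integral_eq_integral(1) integrable_integral by metis
  from has_integral_linear[OF this bounded_linear_vec_nth[of 1]]
  have "((\<lambda>x. \<bar>det (matrix (g' x))\<bar>) has_integral m) S"
    by (simp add: o_def)
  then have "(\<integral>\<^sup>+v. ennreal \<bar>det (matrix (g' v))\<bar> * indicator S v \<partial>lborel) = ennreal m"
    by (intro nn_integral_has_integral_lebesgue') auto
  moreover have "(\<integral>\<^sup>+z. indicator R z * ennreal \<bar>real_det (H' z)\<bar> \<partial>lborel) =
      (\<integral>\<^sup>+v. ennreal \<bar>det (matrix (g' v))\<bar> * indicator S v \<partial>lborel)"
  proof -
    have "(\<lambda>z. indicator R z * ennreal \<bar>real_det (H' z)\<bar>) \<in> borel_measurable borel"
      using R cont by (intro borel_measurable_indicator_ennreal) (auto intro!: continuous_intros)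
    then show ?thesis
      by (subst lborel_complex_eq_vec, subst nn_integral_distr)
         (use meas in \<open>auto simp: det S_def indicator_def intro!: nn_integral_cong\<close>)
  qed
  ultimately show ?thesis using em m by simp
qed simp

text \<open>Dyadic shells. Where 2^j \<delta> \<le> |H| < 2^(j+1) \<delta> the weight is at most 1 /
  (2^j \<delta>)^2, while the image of \<open>A j\<close> lies in a disc of area pi (2^(j+1)
  \<delta>)^2 and is covered injectively. Each of the N shells thus contributes at most 4 pi, so the
  bound is logarithmic in the ratio of the extreme moduli.\<close>

lemma log_area_bound:
  fixes H :: "complex \<Rightarrow> complex"
  assumes R: "open R" and der: "\<And>z. z \<in> R \<Longrightarrow> (H has_derivative H' z) (at z)" and inj: "inj_on H R"
    and cont: "continuous_on R (\<lambda>z. real_det (H' z))"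
    and \<delta>: "0 < \<delta>" and bound: "\<And>z. z \<in> R \<Longrightarrow> \<delta> \<le> cmod (H z) \<and> cmod (H z) < 2 ^ N * \<delta>"
  shows "(\<integral>\<^sup>+z. indicator R z * ennreal (\<bar>real_det (H' z)\<bar> / (cmod (H z))\<^sup>2) \<partial>lborel) \<le> ennreal (4 * pi * real N)"
proof -
  let ?J = "\<lambda>z. \<bar>real_det (H' z)\<bar>"
  have contH: "continuous_on R H"
    using der by (auto intro!: continuous_at_imp_continuous_on has_derivative_continuous)
  define A where "A j = R \<inter> H -` ball 0 (2 ^ Suc j * \<delta>)" for j
  have A: "open (A j)" for j
    unfolding A_def by (rule continuous_open_preimage[OF contH R]) simp
  have area: "(\<integral>\<^sup>+z. indicator (A j) z * ennreal (?J z) \<partial>lborel) \<le> ennreal (pi * (2 ^ Suc j * \<delta>)\<^sup>2)" for j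
  proof -
    have "(\<integral>\<^sup>+z. indicator (A j) z * ennreal (?J z) \<partial>lborel) \<le> emeasure lborel (H ` A j)"
      by (rule area_image_ge[OF A]) (use der inj cont in \<open>auto simp: A_def elim: inj_on_subset continuous_on_subset\<close>)
    also have "\<dots> \<le> emeasure lborel (ball 0 (2 ^ Suc j * \<delta>) :: complex set)"
      by (rule emeasure_mono) (auto simp: A_def)
    also have "\<dots> = ennreal (pi * (2 ^ Suc j * \<delta>)\<^sup>2)"
      using \<delta> by (subst emeasure_ball) (auto simp: unit_ball_vol_2)
    finally show ?thesis .
  qed
  have meas: "(\<lambda>z. indicator (A j) z * ennreal (?J z)) \<in> borel_measurable borel" for j
    using A cont by (intro borel_measurable_indicator_ennreal)
      (auto simp: A_def intro!: continuous_intros elim: continuous_on_subset)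
  have pt: "indicator R z * ennreal (?J z / (cmod (H z))\<^sup>2) \<le>
     (\<Sum>j<N. ennreal (1 / (2 ^ j * \<delta>)\<^sup>2) * (indicator (A j) z * ennreal (?J z)))" for z
  proof (cases "z \<in> R")
    case True
    define j where "j = (LEAST j. cmod (H z) < 2 ^ j * \<delta>)"
    have j: "cmod (H z) < 2 ^ j * \<delta>" unfolding j_def using bound[OF True] by (metis LeastI)
    have "j \<noteq> 0" using j bound[OF True] by (cases j) auto
    then obtain i where i: "j = Suc i" by (cases j) auto
    have ge: "2 ^ i * \<delta> \<le> cmod (H z)"
      using not_less_Least[of i "\<lambda>j. cmod (H z) < 2 ^ j * \<delta>"] i unfolding j_def by auto
    have "i < N" using Least_le[of "\<lambda>j. cmod (H z) < 2 ^ j * \<delta>" N] bound[OF True] i unfolding j_def by auto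
    have "?J z / (cmod (H z))\<^sup>2 \<le> ?J z / (2 ^ i * \<delta>)\<^sup>2"
    proof (rule divide_left_mono)
      have "0 < 2 ^ i * \<delta>" using \<delta> by simp
      then show "(2 ^ i * \<delta>)\<^sup>2 \<le> (cmod (H z))\<^sup>2" "0 < (cmod (H z))\<^sup>2 * (2 ^ i * \<delta>)\<^sup>2"
        using ge by (auto intro!: power_mono mult_pos_pos)
    qed simp
    then have "ennreal (?J z / (cmod (H z))\<^sup>2) \<le> ennreal (1 / (2 ^ i * \<delta>)\<^sup>2 * ?J z)"
      by (intro ennreal_leI) simp
    also have "\<dots> = ennreal (1 / (2 ^ i * \<delta>)\<^sup>2) * (indicator (A i) z * ennreal (?J z))"
      using True j i by (subst ennreal_mult) (auto simp: A_def)
    also have "\<dots> \<le> (\<Sum>j<N. ennreal (1 / (2 ^ j * \<delta>)\<^sup>2) * (indicator (A j) z * ennreal (?J z)))"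
      by (rule member_le_sum) (use \<open>i < N\<close> in auto)
    finally show ?thesis using True by simp
  qed simp
  have "(\<integral>\<^sup>+z. indicator R z * ennreal (?J z / (cmod (H z))\<^sup>2) \<partial>lborel)
    \<le> (\<integral>\<^sup>+z. (\<Sum>j<N. ennreal (1 / (2 ^ j * \<delta>)\<^sup>2) * (indicator (A j) z * ennreal (?J z))) \<partial>lborel)"
    by (rule nn_integral_mono) (rule pt)
  also have "\<dots> = (\<Sum>j<N. ennreal (1 / (2 ^ j * \<delta>)\<^sup>2) * (\<integral>\<^sup>+z. indicator (A j) z * ennreal (?J z) \<partial>lborel))"
    using meas by (subst nn_integral_sum) (auto intro!: sum.cong nn_integral_cmult)
  also have "\<dots> \<le> (\<Sum>j<N. ennreal (1 / (2 ^ j * \<delta>)\<^sup>2) * ennreal (pi * (2 ^ Suc j * \<delta>)\<^sup>2))"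
    by (intro sum_mono mult_left_mono area) auto
  also have "\<dots> = (\<Sum>j<N. ennreal (4 * pi))"
  proof (rule sum.cong)
    fix j :: nat
    have "1 / (2 ^ j * \<delta>)\<^sup>2 * (pi * (2 ^ Suc j * \<delta>)\<^sup>2) = 4 * pi"
      using \<delta> by (simp add: power_mult_distrib field_simps)
    then show "ennreal (1 / (2 ^ j * \<delta>)\<^sup>2) * ennreal (pi * (2 ^ Suc j * \<delta>)\<^sup>2) = ennreal (4 * pi)"
      by (subst ennreal_mult[symmetric]) auto
  qed simp
  also have "\<dots> = ennreal (4 * pi * real N)"
    by (simp add: ennreal_of_nat_eq_real_of_nat ennreal_mult[symmetric] mult.commute)
  finally show ?thesis .
qed

text \<open>For increasing order, \<open>t\<close> is the first time at level \<open>L\<close> and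
  \<open>s\<close> the last time before it at level \<delta>; between them the values stay in
  [\<delta>, L]. If \<open>y2 < y1\<close> the parameter is reversed, which explains the two
  alternatives at the endpoints.\<close>

lemma crossing_interval:
  fixes \<phi> :: "real \<Rightarrow> real"
  assumes cont: "continuous_on (closed_segment y1 y2) \<phi>" and \<phi>: "\<phi> y1 \<le> \<delta>" "L \<le> \<phi> y2" and "\<delta> < L"
  obtains s t where "s < t" "{s..t} \<subseteq> closed_segment y1 y2"
    "\<phi> s = \<delta> \<and> \<phi> t = L \<or> \<phi> s = L \<and> \<phi> t = \<delta>" "\<And>y. y \<in> {s..t} \<Longrightarrow> \<delta> \<le> \<phi> y \<and> \<phi> y \<le> L"
proof -
  have incr: "\<exists>s t. s < t \<and> {s..t} \<subseteq> {a..b} \<and> \<psi> s = \<delta> \<and> \<psi> t = L \<and> (\<forall>y\<in>{s..t}. \<delta> \<le> \<psi> y \<and> \<psi> y \<le> L)"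
    if cont: "continuous_on {a..b} \<psi>" and \<psi>: "\<psi> a \<le> \<delta>" "L \<le> \<psi> b" and ab: "a \<le> b" for \<psi> :: "real \<Rightarrow> real" and a b
  proof -
    have "compact ({a..b} \<inter> \<psi> -` {L})"
      unfolding compact_eq_bounded_closed
      using continuous_closed_preimage[OF cont] bounded_subset[OF bounded_closed_interval Int_lower1] by auto
    moreover have "{a..b} \<inter> \<psi> -` {L} \<noteq> {}"
      using IVT'[of \<psi> a L b] cont \<psi> ab \<open>\<delta> < L\<close> by auto
    ultimately obtain t where "t \<in> {a..b} \<inter> \<psi> -` {L}" "\<forall>y\<in>{a..b} \<inter> \<psi> -` {L}. t \<le> y"
      using compact_attains_inf by blast
    then have t: "t \<in> {a..b}" "\<psi> t = L" "\<And>y. y \<in> {a..b} \<Longrightarrow> \<psi> y = L \<Longrightarrow> t \<le> y"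
      by auto
    have cont': "continuous_on {a..t} \<psi>" by (rule continuous_on_subset[OF cont]) (use t in auto)
    have "compact ({a..t} \<inter> \<psi> -` {\<delta>})"
      unfolding compact_eq_bounded_closed
      using continuous_closed_preimage[OF cont'] bounded_subset[OF bounded_closed_interval Int_lower1] by auto
    moreover have "{a..t} \<inter> \<psi> -` {\<delta>} \<noteq> {}"
      using IVT'[of \<psi> a \<delta> t] cont' \<psi> t \<open>\<delta> < L\<close> by auto
    ultimately obtain s where "s \<in> {a..t} \<inter> \<psi> -` {\<delta>}" "\<forall>y\<in>{a..t} \<inter> \<psi> -` {\<delta>}. y \<le> s"
      using compact_attains_sup by blast
    then have s: "s \<in> {a..t}" "\<psi> s = \<delta>" "\<And>y. y \<in> {a..t} \<Longrightarrow> \<psi> y = \<delta> \<Longrightarrow> y \<le> s"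
      by auto
    have "\<delta> \<le> \<psi> y \<and> \<psi> y \<le> L" if y: "y \<in> {s..t}" for y
    proof (rule ccontr)
      assume "\<not> ?thesis"
      then consider "\<psi> y < \<delta>" | "L < \<psi> y" by linarith
      then show False
      proof cases
        case 1
        have "continuous_on {y..t} \<psi>" by (rule continuous_on_subset[OF cont']) (use y s in auto)
        then obtain x where "x \<in> {y..t}" "\<psi> x = \<delta>"
          using IVT'[of \<psi> y \<delta> t] 1 t(2) \<open>\<delta> < L\<close> y by auto
        then have "x \<le> s" using s y by auto
        then have "x = y" "y = s" using \<open>x \<in> _\<close> y by auto
        then show False using 1 s by simp
      next
        case 2
        have "continuous_on {s..y} \<psi>" by (rule continuous_on_subset[OF cont']) (use y s in auto)
        then obtain x where x: "x \<in> {s..y}" "\<psi> x = L"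
          using IVT'[of \<psi> s L y] 2 s(2) \<open>\<delta> < L\<close> y by auto
        then have "t \<le> x" using t s y by auto
        then have "x = y" "y = t" using x y by auto
        then show False using 2 t by simp
      qed
    qed
    moreover have "s < t" using s t \<open>\<delta> < L\<close> by (cases "s = t") auto
    ultimately show ?thesis using s t by (intro exI[of _ s] exI[of _ t]) auto
  qed
  show ?thesis
  proof (cases "y1 \<le> y2")
    case True
    then show ?thesis
      using incr[of y1 y2 \<phi>] cont \<phi> that by (auto simp: closed_segment_eq_real_ivl)
  next
    case False
    have "continuous_on {- y1..- y2} (\<lambda>y. \<phi> (- y))"
      by (rule continuous_on_compose2[OF cont]) (use False in \<open>auto simp: closed_segment_eq_real_ivl intro!: continuous_intros\<close>)
    then obtain s t where st: "s < t" "{s..t} \<subseteq> {- y1..- y2}" "\<phi> (- s) = \<delta>" "\<phi> (- t) = L"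
        "\<forall>y\<in>{s..t}. \<delta> \<le> \<phi> (- y) \<and> \<phi> (- y) \<le> L"
      using incr[of "- y1" "- y2" "\<lambda>y. \<phi> (- y)"] \<phi> False by auto
    show ?thesis
    proof (rule that[of "- t" "- s"])
      show "{- t..- s} \<subseteq> closed_segment y1 y2"
        using st(1,2) False by (auto simp: closed_segment_eq_real_ivl)
      show "\<delta> \<le> \<phi> y \<and> \<phi> y \<le> L" if "y \<in> {- t..- s}" for y
        using st(5)[rule_format, of "- y"] that by auto
    qed (use st in auto)
  qed
qed

lemma norm_mult_add_cnj_le: "(cmod (p * h + cnj (q * h)))\<^sup>2 \<le> 2 * ((cmod p)\<^sup>2 + (cmod q)\<^sup>2) * (cmod h)\<^sup>2"
proof -
  have "cmod (p * h + cnj (q * h)) \<le> (cmod p + cmod q) * cmod h"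
    using norm_triangle_ineq[of "p * h" "cnj (q * h)"] by (simp add: norm_mult algebra_simps)
  then have "(cmod (p * h + cnj (q * h)))\<^sup>2 \<le> ((cmod p + cmod q) * cmod h)\<^sup>2"
    by (intro power_mono) auto
  also have "\<dots> \<le> 2 * ((cmod p)\<^sup>2 + (cmod q)\<^sup>2) * (cmod h)\<^sup>2"
    unfolding power_mult_distrib
    using zero_le_power2[of "cmod p - cmod q"]
    by (intro mult_right_mono) (auto simp: power2_sum power2_diff)
  finally show ?thesis .
qed

text \<open>The integrand is controlled by the arithmetic-geometric mean inequality
  \<open>w \<le> (\<mu> / 2) w\<^sup>2 + 1 / (2 \<mu>)\<close> with \<open>\<mu> = 2\<pi> / M\<close>.\<close>

lemma log_oscillation_energy:
  fixes \<gamma> :: "real \<Rightarrow> complex"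
  assumes st: "s < t" "t - s \<le> 2 * pi" and M: "0 < M" "M = \<bar>ln (cmod (\<gamma> t)) - ln (cmod (\<gamma> s))\<bar>"
    and \<gamma>: "\<And>y. y \<in> {s..t} \<Longrightarrow> (\<gamma> has_vector_derivative \<gamma>' y) (at y)"
    and nz: "\<And>y. y \<in> {s..t} \<Longrightarrow> \<gamma> y \<noteq> 0"
    and W: "continuous_on {s..t} W" "\<And>y. y \<in> {s..t} \<Longrightarrow> (cmod (\<gamma>' y) / cmod (\<gamma> y))\<^sup>2 \<le> W y"
  shows "M\<^sup>2 / (2 * pi) \<le> integral {s..t} W"
proof -
  \<comment> \<open>With this \<mu> the constant term integrates to at most M / 2 over an interval
    of length at most 2 pi and is absorbed on the left.\<close>
  define \<mu> where "\<mu> = 2 * pi / M"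
  have \<mu>: "\<mu> > 0" using M by (simp add: \<mu>_def)
  define h where "h y = \<mu> / 2 * W y + 1 / (2 * \<mu>)" for y
  have conth: "continuous_on {s..t} h" unfolding h_def by (intro continuous_intros W)
  have "norm (ln (cmod (\<gamma> t)) - ln (cmod (\<gamma> s))) \<le> integral {s..t} h - integral {s..s} h"
  proof (rule differentiable_bound_general[OF st(1), where f = "\<lambda>y. ln (cmod (\<gamma> y))"
       and f' = "\<lambda>y. (\<gamma>' y \<bullet> sgn (\<gamma> y)) / cmod (\<gamma> y)" and \<phi>' = h])
    have der: "((\<lambda>y. ln (cmod (\<gamma> y))) has_vector_derivative (\<gamma>' y \<bullet> sgn (\<gamma> y)) / cmod (\<gamma> y)) (at y)"
      if y: "y \<in> {s..t}" for y
    proof -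
      have "(norm has_derivative (\<lambda>h. h \<bullet> sgn (\<gamma> y))) (at (\<gamma> y))"
        using has_derivative_norm[OF nz[OF y]] by (simp add: inner_commute)
      from has_derivative_compose[OF \<gamma>[OF y, unfolded has_vector_derivative_def] this]
      have "((\<lambda>y. cmod (\<gamma> y)) has_real_derivative \<gamma>' y \<bullet> sgn (\<gamma> y)) (at y)"
        unfolding has_field_derivative_def by (rule has_derivative_eq_rhs) auto
      from DERIV_chain2[OF DERIV_ln this] nz[OF y]
      show ?thesis
        by (simp add: has_real_derivative_iff_has_vector_derivative divide_inverse mult.commute)
    qed
    show "continuous_on {s..t} (\<lambda>y. ln (cmod (\<gamma> y)))"
      using has_vector_derivative_continuous[OF der] by (intro continuous_at_imp_continuous_on) blast
    show "((\<lambda>y. ln (cmod (\<gamma> y))) has_vector_derivative (\<gamma>' y \<bullet> sgn (\<gamma> y)) / cmod (\<gamma> y)) (at y)"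
      if "s < y" "y < t" for y using der that by auto
    show "continuous_on {s..t} (\<lambda>y. integral {s..y} h)"
      using conth by (intro indefinite_integral_continuous_1 integrable_continuous_interval)
    show "((\<lambda>y. integral {s..y} h) has_vector_derivative h y) (at y)" if y: "s < y" "y < t" for y
      using integral_has_vector_derivative[OF conth, of y] y
      by (simp add: at_within_Icc_at)
    show "norm ((\<gamma>' y \<bullet> sgn (\<gamma> y)) / cmod (\<gamma> y)) \<le> h y" if y: "s < y" "y < t" for y
    proof -
      define w where "w = cmod (\<gamma>' y) / cmod (\<gamma> y)"
      have "\<bar>\<gamma>' y \<bullet> sgn (\<gamma> y)\<bar> \<le> cmod (\<gamma>' y)"
        using Cauchy_Schwarz_ineq2[of "\<gamma>' y" "sgn (\<gamma> y)"] nz[of y] y by (simp add: norm_sgn)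
      then have "norm ((\<gamma>' y \<bullet> sgn (\<gamma> y)) / cmod (\<gamma> y)) \<le> w"
        unfolding w_def by (simp add: divide_right_mono)
      also have "w \<le> \<mu> / 2 * w\<^sup>2 + 1 / (2 * \<mu>)"
      proof -
        have "0 \<le> (\<mu> * w - 1)\<^sup>2" by simp
        then have "2 * \<mu> * w \<le> \<mu> * \<mu> * w\<^sup>2 + 1" by (simp add: power2_eq_square algebra_simps)
        then show ?thesis using \<mu> by (simp add: field_simps)
      qed
      also have "\<dots> \<le> h y"
        using W(2)[of y] y \<mu> unfolding h_def w_def by (auto intro!: mult_left_mono)
      finally show ?thesis .
    qed
  qed
  then have "M \<le> integral {s..t} h" using M(2) by simp
  also have "\<dots> = \<mu> / 2 * integral {s..t} W + (t - s) / (2 * \<mu>)"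
    unfolding h_def using W(1) st
    by (subst Henstock_Kurzweil_Integration.integral_add)
       (auto intro!: integrable_continuous_interval continuous_intros)
  also have "(t - s) / (2 * \<mu>) \<le> 2 * pi / (2 * \<mu>)"
    using st \<mu> by (intro divide_right_mono) auto
  also have "\<dots> = M / 2" using M by (simp add: \<mu>_def)
  finally have "M \<le> pi / M * integral {s..t} W + M / 2" by (simp add: \<mu>_def)
  then have "M / 2 \<le> pi / M * integral {s..t} W" by linarith
  then have "M * (M / 2) \<le> M * (pi / M * integral {s..t} W)" using M by (intro mult_left_mono) auto
  also have "\<dots> = pi * integral {s..t} W" using M by simp
  finally show ?thesis using pi_gt_zero by (simp add: field_simps power2_eq_square)
qed

text \<open>In the coordinates \<zeta> \<mapsto> c + u exp \<zeta> circles about \<open>c\<close>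
  become vertical segments, so Tonelli's theorem replaces polar coordinates, and the dilatation
  inequality keeps its form. With M = ln (L / \<delta>), each segment carries energy at least M^2 /
  (2 pi), while the weighted area is at most 4 pi N with N \<le> 5 M. Comparing (b - a) M^2 / (2 pi)
  with 2 K (4 pi) (5 M) yields 80 pi^2 K / (b - a). Only the arc between the two angles has to lie
  in \<open>D\<close>; the rotation \<open>u\<close> decides where on the circles the angle 0
  is.\<close>

lemma length_area_estimate:
  fixes f p q :: "complex \<Rightarrow> complex"
  assumes D: "open D" and p: "continuous_on D p" and q: "continuous_on D q"
    and f: "\<And>z. z \<in> D \<Longrightarrow> (f has_derivative (\<lambda>h. p z * h + cnj (q z * h))) (at z)"
    and dil: "\<And>z. z \<in> D \<Longrightarrow> (cmod (p z))\<^sup>2 + (cmod (q z))\<^sup>2 \<le> K * \<bar>(cmod (p z))\<^sup>2 - (cmod (q z))\<^sup>2\<bar>"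
    and inj: "inj_on f D" and K: "0 \<le> K"
    and u: "cmod u = 1" and \<delta>: "0 < \<delta>" "\<delta> < L" and ab: "a < b"
    and arcs: "\<And>x. x \<in> {a<..<b} \<Longrightarrow> \<exists>y1\<in>{0..2*pi}. \<exists>y2\<in>{0..2*pi}.
        (\<forall>y\<in>closed_segment y1 y2. c + u * exp (Complex x y) \<in> D) \<and>
        cmod (f (c + u * exp (Complex x y1)) - v) \<le> \<delta> \<and> L \<le> cmod (f (c + u * exp (Complex x y2)) - v)"
  shows "ln (L / \<delta>) \<le> max 1 (80 * pi\<^sup>2 * K / (b - a))"
proof (cases "ln (L / \<delta>) \<le> 1")
  case False
  define M where "M = ln (L / \<delta>)"
  have M: "M > 1" using False by (simp add: M_def)
  define E where "E \<zeta> = c + u * exp \<zeta>" for \<zeta>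
  define H where "H \<zeta> = f (E \<zeta>) - v" for \<zeta>
  define P where "P \<zeta> = p (E \<zeta>) * (u * exp \<zeta>)" for \<zeta>
  define Q where "Q \<zeta> = q (E \<zeta>) * (u * exp \<zeta>)" for \<zeta>
  define J where "J \<zeta> = (cmod (P \<zeta>))\<^sup>2 - (cmod (Q \<zeta>))\<^sup>2" for \<zeta>
  define U where "U = E -` D"
  \<comment> \<open>Enough dyadic shells to lead from \<delta> / 2 beyond \<open>L\<close>. Starting
    at \<delta> / 2 leaves room around [\<delta>, L] for strict inequalities, so that
    \<open>R\<close> is open.\<close>
  define N where "N = nat \<lceil>log 2 (2 * L / \<delta>)\<rceil> + 1"
  \<comment> \<open>The strip 0 < Im \<zeta> < 2 pi is a period strip of exp, so \<open>f\<close>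
    stays injective in logarithmic coordinates.\<close>
  define R where "R = {\<zeta> \<in> U. a < Re \<zeta> \<and> Re \<zeta> < b \<and> 0 < Im \<zeta> \<and> Im \<zeta> < 2 * pi \<and>
     \<delta> / 2 < cmod (H \<zeta>) \<and> cmod (H \<zeta>) < 2 ^ N * (\<delta> / 2)}"
  \<comment> \<open>Upper bound for the squared logarithmic speed of \<open>H\<close> along vertical
    lines; the factor 2 stems from (|P| + |Q|)^2 \<le> 2 (|P|^2 + |Q|^2).\<close>
  define W where "W \<zeta> = 2 * K * \<bar>J \<zeta>\<bar> / (cmod (H \<zeta>))\<^sup>2" for \<zeta>
  have pos: "L > 0" using \<delta> by auto
  have N: "L < 2 ^ N * (\<delta> / 2)" "real N \<le> 5 * M"
  proof -
    have lg: "log 2 (2 * L / \<delta>) = 1 + M / ln 2"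
      using pos \<delta> by (simp add: M_def log_def ln_mult ln_div field_simps)
    have "2 * L / \<delta> < 2 ^ N"
    proof -
      have "log 2 (2 * L / \<delta>) < real N" unfolding N_def by linarith
      then have "2 * L / \<delta> < 2 powr real N" using pos \<delta> by (subst (asm) less_powr_iff[symmetric]) auto
      then show ?thesis by (simp add: powr_realpow)
    qed
    then show "L < 2 ^ N * (\<delta> / 2)" using \<delta> by (simp add: field_simps)
    \<comment> \<open>Rounding is absorbed by M > 1, since then 1.5 M + 3 \<le> 5 M. This is the
      origin of the alternative 1 in \<open>max\<close>.\<close>
    have "M / ln 2 \<le> 1.5 * M"
      using M ln2_ge_two_thirds by (simp add: field_simps)
    moreover have "0 \<le> M / ln 2" using M by simp
    then have "real N \<le> M / ln 2 + 3" unfolding N_def lg by linarith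
    ultimately show "real N \<le> 5 * M" using M by linarith
  qed
  have contE: "continuous_on UNIV E" unfolding E_def by (intro continuous_intros)
  have U: "open U" unfolding U_def by (rule open_vimage[OF D contE])
  have derE: "(E has_derivative (\<lambda>h. u * exp \<zeta> * h)) (at \<zeta>)" for \<zeta>
    unfolding E_def by (auto intro!: derivative_eq_intros simp: algebra_simps)
  have derH: "(H has_derivative (\<lambda>h. P \<zeta> * h + cnj (Q \<zeta> * h))) (at \<zeta>)" if "\<zeta> \<in> U" for \<zeta>
  proof -
    have "E \<zeta> \<in> D" using that by (simp add: U_def)
    from has_derivative_compose[OF derE f[OF this]]
    have "((\<lambda>\<zeta>. f (E \<zeta>)) has_derivative (\<lambda>h. p (E \<zeta>) * (u * exp \<zeta> * h) + cnj (q (E \<zeta>) * (u * exp \<zeta> * h)))) (at \<zeta>)" .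
    from has_derivative_diff[OF this has_derivative_const[of v]] show ?thesis
      unfolding H_def[abs_def] P_def Q_def by (simp add: mult.assoc)
  qed
  have contH: "continuous_on U H"
    using derH by (auto intro!: continuous_at_imp_continuous_on has_derivative_continuous)
  have contp: "continuous_on U P" and contq: "continuous_on U Q"
    unfolding P_def Q_def U_def
    by (intro continuous_intros continuous_on_compose2[OF p] continuous_on_compose2[OF q] continuous_on_subset[OF contE]; auto)+
  have contJ: "continuous_on U J"
    unfolding J_def by (intro continuous_intros contp contq)
  have dilH: "(cmod (P \<zeta>))\<^sup>2 + (cmod (Q \<zeta>))\<^sup>2 \<le> K * \<bar>J \<zeta>\<bar>" if "\<zeta> \<in> U" for \<zeta>
  proof -
    have "((cmod (p (E \<zeta>)))\<^sup>2 + (cmod (q (E \<zeta>)))\<^sup>2) * (cmod (u * exp \<zeta>))\<^sup>2 \<le> K * \<bar>(cmod (p (E \<zeta>)))\<^sup>2 - (cmod (q (E \<zeta>)))\<^sup>2\<bar> * (cmod (u * exp \<zeta>))\<^sup>2"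
      using that by (intro mult_right_mono dil) (auto simp: U_def)
    moreover have "J \<zeta> = ((cmod (p (E \<zeta>)))\<^sup>2 - (cmod (q (E \<zeta>)))\<^sup>2) * (cmod (u * exp \<zeta>))\<^sup>2"
      by (simp only: J_def P_def Q_def norm_mult power_mult_distrib left_diff_distrib)
    then have "K * \<bar>J \<zeta>\<bar> = K * \<bar>(cmod (p (E \<zeta>)))\<^sup>2 - (cmod (q (E \<zeta>)))\<^sup>2\<bar> * (cmod (u * exp \<zeta>))\<^sup>2"
      by (simp only: abs_mult abs_power2 mult.assoc)
    ultimately show ?thesis
      by (simp only: P_def Q_def norm_mult power_mult_distrib distrib_right)
  qed
  have R: "open R"
  proof -
    have "open (U \<inter> H -` (- cball 0 (\<delta> / 2) \<inter> ball 0 (2 ^ N * (\<delta> / 2))))"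
      by (rule continuous_open_preimage[OF contH U]) (auto intro!: open_Int)
    moreover have "open {\<zeta>. a < Re \<zeta> \<and> Re \<zeta> < b \<and> 0 < Im \<zeta> \<and> Im \<zeta> < 2 * pi}"
      by (intro open_Collect_conj open_Collect_less continuous_intros)
    ultimately have "open (U \<inter> H -` (- cball 0 (\<delta> / 2) \<inter> ball 0 (2 ^ N * (\<delta> / 2))) \<inter>
      {\<zeta>. a < Re \<zeta> \<and> Re \<zeta> < b \<and> 0 < Im \<zeta> \<and> Im \<zeta> < 2 * pi})"
      by (rule open_Int)
    also have "U \<inter> H -` (- cball 0 (\<delta> / 2) \<inter> ball 0 (2 ^ N * (\<delta> / 2))) \<inter>
      {\<zeta>. a < Re \<zeta> \<and> Re \<zeta> < b \<and> 0 < Im \<zeta> \<and> Im \<zeta> < 2 * pi} = R"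
      by (auto simp: R_def)
    finally show ?thesis .
  qed
  have RU: "R \<subseteq> U" by (auto simp: R_def)
  have injH: "inj_on H R"
  proof (rule inj_onI)
    fix \<zeta> \<xi> assume *: "\<zeta> \<in> R" "\<xi> \<in> R" "H \<zeta> = H \<xi>"
    then have "E \<zeta> = E \<xi>" using inj by (auto simp: H_def R_def U_def inj_on_def)
    then have "exp \<zeta> = exp \<xi>" using u by (auto simp: E_def)
    moreover have "\<bar>Im \<zeta> - Im \<xi>\<bar> < 2 * pi" using * by (auto simp: R_def)
    ultimately show "\<zeta> = \<xi>" using exp_complex_eqI by blast
  qed
  have "ennreal (M\<^sup>2 / (2 * pi) * (b - a)) = (\<integral>\<^sup>+x. ennreal (M\<^sup>2 / (2 * pi)) * indicator {a<..<b} x \<partial>lborel)"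
    using ab by (subst nn_integral_cmult_indicator) (auto simp: ennreal_mult[symmetric])
  also have "\<dots> \<le> (\<integral>\<^sup>+x. \<integral>\<^sup>+y. indicator R (Complex x y) * ennreal (W (Complex x y)) \<partial>lborel \<partial>lborel)"
  proof (rule nn_integral_mono)
    fix x :: real
    show "ennreal (M\<^sup>2 / (2 * pi)) * indicator {a<..<b} x \<le> (\<integral>\<^sup>+y. indicator R (Complex x y) * ennreal (W (Complex x y)) \<partial>lborel)"
    proof (cases "x \<in> {a<..<b}")
      case True
      obtain y1 y2 where y: "y1 \<in> {0..2*pi}" "y2 \<in> {0..2*pi}" "\<And>y. y \<in> closed_segment y1 y2 \<Longrightarrow> Complex x y \<in> U"
        "cmod (H (Complex x y1)) \<le> \<delta>" "L \<le> cmod (H (Complex x y2))"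
        using arcs[OF True] unfolding U_def H_def E_def by auto
      have contC: "continuous_on A (\<lambda>y. Complex x y)" for A
        by (intro continuous_intros)
      have "continuous_on (closed_segment y1 y2) (\<lambda>y. cmod (H (Complex x y)))"
        by (intro continuous_on_norm continuous_on_compose2[OF contH contC]) (use y in auto)
      then obtain s t where st: "s < t" "{s..t} \<subseteq> closed_segment y1 y2"
        "cmod (H (Complex x s)) = \<delta> \<and> cmod (H (Complex x t)) = L \<or> cmod (H (Complex x s)) = L \<and> cmod (H (Complex x t)) = \<delta>"
        "\<And>y. y \<in> {s..t} \<Longrightarrow> \<delta> \<le> cmod (H (Complex x y)) \<and> cmod (H (Complex x y)) \<le> L"
        using crossing_interval[where \<phi> = "\<lambda>y. cmod (H (Complex x y))", OF _ y(4,5) \<delta>(2)] by blast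
      have seg: "closed_segment y1 y2 \<subseteq> {0..2*pi}"
        using y(1,2) by (auto simp: closed_segment_eq_real_ivl split: if_splits)
      have st02: "0 \<le> s" "t \<le> 2 * pi"
        using st(1,2) seg by (auto simp: subset_iff)
      have inU: "Complex x y \<in> U" if "y \<in> {s..t}" for y using y(3) st(2) that by blast
      have nz: "H (Complex x y) \<noteq> 0" if "y \<in> {s..t}" for y using st(4)[OF that] \<delta> by auto
      have contW: "continuous_on {s..t} (\<lambda>y. W (Complex x y))"
        unfolding W_def using nz
        by (intro continuous_intros continuous_on_compose2[OF contJ contC] continuous_on_compose2[OF contH contC]) (use inU in auto)
      have "M\<^sup>2 / (2 * pi) \<le> integral {s..t} (\<lambda>y. W (Complex x y))"
      proof (rule log_oscillation_energy[OF st(1), where \<gamma> = "\<lambda>y. H (Complex x y)"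
            and \<gamma>' = "\<lambda>y. P (Complex x y) * \<i> + cnj (Q (Complex x y) * \<i>)"])
        show "t - s \<le> 2 * pi" "0 < M" using st02 M by auto
        show "M = \<bar>ln (cmod (H (Complex x t))) - ln (cmod (H (Complex x s)))\<bar>"
        proof -
          have "M = ln L - ln \<delta>" "ln \<delta> \<le> ln L" using \<delta> by (auto simp: M_def ln_div)
          then show ?thesis using st(3) by (elim disjE conjE) simp_all
        qed
        fix y assume y: "y \<in> {s..t}"
        have Cfun: "Complex x = (\<lambda>y. of_real x + of_real y * \<i>)" by (auto simp: complex_eq_iff)
        have "(Complex x has_derivative (\<lambda>h. of_real h * \<i>)) (at y)"
          unfolding Cfun by (auto intro!: derivative_eq_intros)
        from has_derivative_compose[OF this derH[OF inU[OF y]]]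
        show "((\<lambda>y. H (Complex x y)) has_vector_derivative P (Complex x y) * \<i> + cnj (Q (Complex x y) * \<i>)) (at y)"
          unfolding has_vector_derivative_def
          by (rule has_derivative_eq_rhs) (auto simp: scaleR_conv_of_real algebra_simps)
        have "(cmod (P (Complex x y) * \<i> + cnj (Q (Complex x y) * \<i>)))\<^sup>2 \<le> 2 * K * \<bar>J (Complex x y)\<bar>"
          using norm_mult_add_cnj_le[of "P (Complex x y)" \<i> "Q (Complex x y)"] dilH[OF inU[OF y]] by simp
        then show "(cmod (P (Complex x y) * \<i> + cnj (Q (Complex x y) * \<i>)) / cmod (H (Complex x y)))\<^sup>2 \<le> W (Complex x y)"
          unfolding W_def power_divide by (rule divide_right_mono) simp
      qed (use nz contW in auto)
      then have "ennreal (M\<^sup>2 / (2 * pi)) \<le> ennreal (integral {s<..<t} (\<lambda>y. W (Complex x y)))"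
        by (intro ennreal_leI) (simp add: integral_open_interval_real)
      also have "\<dots> = (\<integral>\<^sup>+y. ennreal (W (Complex x y)) * indicator {s<..<t} y \<partial>lborel)"
      proof (rule nn_integral_has_integral_lebesgue'[symmetric])
        show "((\<lambda>y. W (Complex x y)) has_integral integral {s<..<t} (\<lambda>y. W (Complex x y))) {s<..<t}"
          using contW by (intro integrable_integral) (simp add: integrable_on_open_interval_real integrable_continuous_interval)
      qed (use K in \<open>auto simp: W_def\<close>)
      also have "\<dots> \<le> (\<integral>\<^sup>+y. indicator R (Complex x y) * ennreal (W (Complex x y)) \<partial>lborel)"
      proof (rule nn_integral_mono)
        fix y
        show "ennreal (W (Complex x y)) * indicator {s<..<t} y \<le> indicator R (Complex x y) * ennreal (W (Complex x y))"
        proof (cases "y \<in> {s<..<t}")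
          case y: True
          then have "\<delta> \<le> cmod (H (Complex x y)) \<and> cmod (H (Complex x y)) \<le> L" by (intro st(4)) auto
          then have "Complex x y \<in> R"
            using y True st02 inU[of y] N(1) \<delta> by (auto simp: R_def)
          then show ?thesis using y by (simp add: mult.commute)
        qed simp
      qed
      finally show ?thesis using True by simp
    qed simp
  qed
  also have "\<dots> = (\<integral>\<^sup>+\<zeta>. indicator R \<zeta> * ennreal (W \<zeta>) \<partial>lborel)"
  proof (rule nn_integral_complex_eq_iterated[symmetric])
    have "continuous_on R W"
      unfolding W_def using continuous_on_subset[OF contJ RU] continuous_on_subset[OF contH RU] \<delta>
      by (intro continuous_intros) (auto simp: R_def)
    then show "(\<lambda>\<zeta>. indicator R \<zeta> * ennreal (W \<zeta>)) \<in> borel_measurable borel"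
      by (rule borel_measurable_indicator_ennreal[OF R])
  qed
  also have "\<dots> = (\<integral>\<^sup>+\<zeta>. ennreal (2 * K) * (indicator R \<zeta> * ennreal (\<bar>J \<zeta>\<bar> / (cmod (H \<zeta>))\<^sup>2)) \<partial>lborel)"
    using K by (intro nn_integral_cong) (auto simp: W_def ennreal_mult[symmetric] indicator_def)
  also have "\<dots> = ennreal (2 * K) * (\<integral>\<^sup>+\<zeta>. indicator R \<zeta> * ennreal (\<bar>J \<zeta>\<bar> / (cmod (H \<zeta>))\<^sup>2) \<partial>lborel)"
  proof (rule nn_integral_cmult)
    have "continuous_on R (\<lambda>\<zeta>. \<bar>J \<zeta>\<bar> / (cmod (H \<zeta>))\<^sup>2)"
      using continuous_on_subset[OF contJ RU] continuous_on_subset[OF contH RU] \<delta>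
      by (intro continuous_intros) (auto simp: R_def)
    from borel_measurable_indicator_ennreal[OF R this]
    show "(\<lambda>\<zeta>. indicator R \<zeta> * ennreal (\<bar>J \<zeta>\<bar> / (cmod (H \<zeta>))\<^sup>2)) \<in> borel_measurable lborel" by simp
  qed
  also have "\<dots> \<le> ennreal (2 * K) * ennreal (4 * pi * real N)"
  proof (rule mult_left_mono)
    have Jdet: "real_det (\<lambda>h. P \<zeta> * h + cnj (Q \<zeta> * h)) = J \<zeta>" for \<zeta>
      unfolding J_def by (rule real_det_harmonic)
    show "(\<integral>\<^sup>+\<zeta>. indicator R \<zeta> * ennreal (\<bar>J \<zeta>\<bar> / (cmod (H \<zeta>))\<^sup>2) \<partial>lborel) \<le> ennreal (4 * pi * real N)"
      unfolding Jdet[symmetric]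
    proof (rule log_area_bound[OF R _ injH, of _ "\<delta> / 2"])
      show "(H has_derivative (\<lambda>h. P \<zeta> * h + cnj (Q \<zeta> * h))) (at \<zeta>)" if "\<zeta> \<in> R" for \<zeta>
        using derH RU that by blast
      show "continuous_on R (\<lambda>z. real_det (\<lambda>h. P z * h + cnj (Q z * h)))"
        unfolding Jdet using contJ RU continuous_on_subset by blast
    qed (use \<delta> in \<open>auto simp: R_def\<close>)
  qed simp
  also have "\<dots> = ennreal (2 * K * (4 * pi * real N))"
    using K by (subst ennreal_mult[symmetric]) auto
  finally have "M\<^sup>2 / (2 * pi) * (b - a) \<le> 2 * K * (4 * pi * real N)"
    using K by (subst (asm) ennreal_le_iff) auto
  also have "\<dots> \<le> 2 * K * (4 * pi * (5 * M))"
    using N(2) K by (intro mult_left_mono) auto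
  finally have "M * M * (b - a) \<le> M * (80 * pi\<^sup>2 * K)"
    by (simp add: field_simps power2_eq_square)
  then have "M * (b - a) \<le> 80 * pi\<^sup>2 * K" using M by (simp add: mult.assoc)
  then have "M \<le> 80 * pi\<^sup>2 * K / (b - a)" using ab by (simp add: field_simps)
  then show ?thesis by (simp add: M_def)
qed simp

subsection \<open>Gradient estimate and Harnack inequality\<close>

text \<open>Cauchy's estimate for \<open>exp (G / B)\<close>, where \<open>G\<close> is holomorphic with real part \<open>u - k\<close>.\<close>

lemma harmonic_gradient_bound:
  assumes r: "0 < r" and B: "0 < B" and a: "a holomorphic_on ball z r"
    and u: "\<And>w. w \<in> ball z r \<Longrightarrow> (u has_derivative (\<lambda>h. Re (a w * h))) (at w)"
    and bound: "\<And>w. w \<in> ball z r \<Longrightarrow> \<bar>u w - k\<bar> \<le> B"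
  shows "cmod (a z) \<le> 2 * exp 2 * B / r"
proof -
  obtain G0 where G0: "\<And>w. w \<in> ball z r \<Longrightarrow> (G0 has_field_derivative a w) (at w within ball z r)"
    using holomorphic_convex_primitive'[OF convex_ball open_ball a] by blast
  define G where "G w = G0 w - G0 z + of_real (u z - k)" for w
  have G: "(G has_field_derivative a w) (at w)" if "w \<in> ball z r" for w
  proof -
    have "(G0 has_field_derivative a w) (at w)" using G0[OF that] at_within_open[OF that open_ball] by simp
    then show ?thesis unfolding G_def[abs_def] by (auto intro!: derivative_eq_intros)
  qed
  have ReG: "Re (G w) = u w - k" if w: "w \<in> ball z r" for w
  proof -
    have "(\<lambda>w. Re (G w) - u w) w = (\<lambda>w. Re (G w) - u w) z"
    proof (rule has_derivative_zero_unique_connected[where f = "\<lambda>w. Re (G w) - u w", OF open_ball connected_ball])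
      fix x assume x: "x \<in> ball z r"
      have "((\<lambda>w. Re (G w)) has_derivative (\<lambda>h. Re (a x * h))) (at x)"
        using G[OF x] unfolding has_field_derivative_def by (rule bounded_linear.has_derivative[OF bounded_linear_Re])
      from has_derivative_diff[OF this u[OF x]]
      show "((\<lambda>w. Re (G w) - u w) has_derivative (\<lambda>h. 0)) (at x)" by simp
    qed (use w r in auto)
    then show ?thesis by (simp add: G_def)
  qed
  define F where "F w = exp (G w / of_real B)" for w
  have derF: "(F has_field_derivative (a w / of_real B) * F w) (at w)" if "w \<in> ball z r" for w
    unfolding F_def using G[OF that] B by (auto intro!: derivative_eq_intros)
  have normF: "exp (- 1) \<le> cmod (F w) \<and> cmod (F w) \<le> exp 1" if "w \<in> ball z r" for w
  proof -
    have "cmod (F w) = exp ((u w - k) / B)" using ReG[OF that] B by (simp add: F_def)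
    moreover have "- 1 \<le> (u w - k) / B" "(u w - k) / B \<le> 1"
      using bound[OF that] B by (auto simp: field_simps abs_le_iff)
    ultimately show ?thesis by simp
  qed
  have holF: "F holomorphic_on ball z r"
    unfolding holomorphic_on_open[OF open_ball] using derF by blast
  have sub: "cball z (r / 2) \<subseteq> ball z r" using r by auto
  have "norm ((deriv ^^ 1) F z) \<le> fact 1 * exp 1 / (r / 2) ^ 1"
  proof (rule Cauchy_inequality)
    show "F holomorphic_on ball z (r / 2)" using holF by (rule holomorphic_on_subset) (use r in auto)
    show "continuous_on (cball z (r / 2)) F"
      using holomorphic_on_imp_continuous_on[OF holF] sub continuous_on_subset by blast
    fix x assume "norm (z - x) = r / 2"
    then have "x \<in> ball z r" using r by (simp add: dist_norm)
    then show "norm (F x) \<le> exp 1" using normF by blast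
  qed (use r in auto)
  moreover have "deriv F z = a z / of_real B * F z"
    using derF[of z] r by (intro DERIV_imp_deriv) auto
  \<comment> \<open>One factor e is the bound for |F| on the circle, the other comes from the lower
    bound e^(-1) for |F z|; the 2 is due to the radius r / 2.\<close>
  ultimately have "cmod (a z) / B * cmod (F z) \<le> 2 * exp 1 / r"
    using B by (simp add: norm_mult norm_divide field_simps)
  moreover have "cmod (a z) / B * exp (- 1) \<le> cmod (a z) / B * cmod (F z)"
    using normF[of z] r B by (intro mult_left_mono) auto
  ultimately have "cmod (a z) / B * exp (- 1) \<le> 2 * exp 1 / r" by linarith
  then have "cmod (a z) / B * exp (- 1) * exp 1 \<le> 2 * exp 1 / r * exp 1" by (rule mult_right_mono) simp
  moreover have "exp (- 1) * exp 1 = (1::real)" "exp 1 * exp 1 = exp (2::real)"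
    by (simp_all add: exp_add[symmetric])
  ultimately have "cmod (a z) / B \<le> 2 * exp 2 / r"
    by (simp add: mult.assoc)
  then show ?thesis using B by (simp add: field_simps)
qed

text \<open>With \<open>U = ln M - log m\<close>, which has positive real part, Schwarz's lemma applies to
  \<open>(U - U(z1)) / (U + cnj U(z1))\<close>.\<close>

lemma harnack_log:
  assumes r: "0 < r" and m: "m holomorphic_on ball z1 r" and nz: "\<And>w. w \<in> ball z1 r \<Longrightarrow> m w \<noteq> 0"
    and M: "\<And>w. w \<in> ball z1 r \<Longrightarrow> cmod (m w) < M" and z: "cmod (z - z1) \<le> r / 2"
  shows "ln (M / cmod (m z)) \<le> 3 * ln (M / cmod (m z1))"
proof -
  have zin: "z \<in> ball z1 r" "z1 \<in> ball z1 r" using z r by (auto simp: dist_norm norm_minus_commute)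
  obtain l where l: "l holomorphic_on ball z1 r" "\<And>w. w \<in> ball z1 r \<Longrightarrow> m w = exp (l w)"
    using contractible_imp_holomorphic_log[OF m convex_imp_contractible[OF convex_ball] nz] by blast
  have Mpos: "0 < M" using M[OF zin(2)] norm_ge_zero order_le_less_trans by blast
  define U where "U w = of_real (ln M) - l w" for w
  have ReU: "Re (U w) = ln (M / cmod (m w))" if "w \<in> ball z1 r" for w
    using l(2)[OF that] Mpos by (simp add: U_def ln_div)
  have posU: "0 < Re (U w)" if "w \<in> ball z1 r" for w
    using ReU[OF that] M[OF that] nz[OF that] by (simp add: ln_gt_zero field_simps)
  have holU: "U holomorphic_on ball z1 r" unfolding U_def by (intro holomorphic_intros l)
  define c where "c = U z1"
  have c: "0 < Re c" using posU zin by (simp add: c_def)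
  have nzd: "U w + cnj c \<noteq> 0" if "w \<in> ball z1 r" for w
  proof
    assume "U w + cnj c = 0"
    then have "Re (U w + cnj c) = 0" by simp
    then show False using posU[OF that] c by simp
  qed
  define \<Phi> where "\<Phi> \<xi> = (U (z1 + of_real r * \<xi>) - c) / (U (z1 + of_real r * \<xi>) + cnj c)" for \<xi>
  have inb: "z1 + of_real r * \<xi> \<in> ball z1 r" if "cmod \<xi> < 1" for \<xi>
    using that r by (simp add: dist_norm norm_mult)
  have hol\<Phi>: "\<Phi> holomorphic_on ball 0 1"
  proof -
    have "(U \<circ> (\<lambda>\<xi>. z1 + of_real r * \<xi>)) holomorphic_on ball 0 1"
      by (rule holomorphic_on_compose_gen[OF _ holU]) (use inb in \<open>auto intro!: holomorphic_intros\<close>)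
    then have "(\<lambda>\<xi>. U (z1 + of_real r * \<xi>)) holomorphic_on ball 0 1" by (simp add: o_def)
    then show ?thesis unfolding \<Phi>_def using inb nzd by (intro holomorphic_intros) auto
  qed
  have norm\<Phi>: "cmod (\<Phi> \<xi>) < 1" if "cmod \<xi> < 1" for \<xi>
  proof -
    let ?x = "U (z1 + of_real r * \<xi>)"
    have x: "0 < Re ?x" using posU inb that by blast
    have "(cmod (?x + cnj c))\<^sup>2 - (cmod (?x - c))\<^sup>2 = 4 * Re ?x * Re c"
      unfolding cmod_power2 by (simp add: power2_eq_square algebra_simps)
    also have "\<dots> > 0" using x c by simp
    finally have "(cmod (?x - c))\<^sup>2 < (cmod (?x + cnj c))\<^sup>2" by simp
    then have "cmod (?x - c) < cmod (?x + cnj c)" by (rule power2_less_imp_less) simp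
    then show ?thesis using nzd[OF inb[OF that]] by (simp add: \<Phi>_def norm_divide)
  qed
  define \<xi> where "\<xi> = (z - z1) / of_real r"
  have \<xi>: "cmod \<xi> \<le> 1 / 2" "z = z1 + of_real r * \<xi>" using z r by (auto simp: \<xi>_def norm_divide field_simps)
  have "\<Phi> 0 = 0" by (simp add: \<Phi>_def c_def)
  then have "cmod (\<Phi> \<xi>) \<le> cmod \<xi>"
    using Schwarz_Lemma(1)[OF hol\<Phi> _ norm\<Phi>, of \<xi>] \<xi> by auto
  then have "cmod (\<Phi> \<xi>) \<le> 1 / 2" using \<xi> by linarith
  \<comment> \<open>As \<open>U z + cnj c\<close> and \<open>U z - c\<close> differ by 2 Re c, this
    gives |U z - c| \<le> 2 Re c and so Re (U z) \<le> 3 Re c, the factor 3 of the claim.\<close>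
  then have "cmod (U z - c) \<le> 1 / 2 * cmod (U z + cnj c)"
    using nzd[OF zin(1)] \<xi>(2) by (simp add: \<Phi>_def norm_divide field_simps)
  also have "U z + cnj c = (U z - c) + of_real (2 * Re c)" by (simp add: complex_eq_iff)
  also have "cmod \<dots> \<le> cmod (U z - c) + 2 * Re c"
    using norm_triangle_ineq[of "U z - c" "of_real (2 * Re c)"] c by simp
  finally have "cmod (U z - c) \<le> 2 * Re c" by simp
  then have "Re (U z) \<le> 3 * Re c" using complex_Re_le_cmod[of "U z - c"] by simp
  then show ?thesis using ReU zin by (simp add: c_def)
qed

subsection \<open>Distortion of discs\<close>

text \<open>If \<open>T\<close> missed the image of the circle, it would be split by the image of
  the open disc, which is open by invariance of domain, and the complement of the compact image of
  the closed disc.\<close>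

lemma connected_meets_image_sphere:
  fixes f :: "complex \<Rightarrow> complex"
  assumes f: "continuous_on (cball z r) f" "inj_on f (cball z r)" and T: "connected T"
    and x: "x \<in> T" "x \<in> f ` ball z r" and y: "y \<in> T" "y \<notin> f ` cball z r"
  shows "\<exists>\<zeta>\<in>sphere z r. f \<zeta> \<in> T"
proof (rule ccontr)
  assume none: "\<not> (\<exists>\<zeta>\<in>sphere z r. f \<zeta> \<in> T)"
  have "open (f ` ball z r)"
    using continuous_on_subset[OF f(1)] inj_on_subset[OF f(2)] by (intro invariance_of_domain_gen) auto
  moreover have "open (- (f ` cball z r))"
    using compact_imp_closed[OF compact_continuous_image[OF f(1) compact_cball]] by (rule open_Compl)
  moreover have "T \<subseteq> f ` ball z r \<union> - (f ` cball z r)"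
  proof
    fix t assume "t \<in> T"
    then show "t \<in> f ` ball z r \<union> - (f ` cball z r)"
      using none by (fastforce simp: less_le)
  qed
  moreover have "f ` ball z r \<inter> - (f ` cball z r) \<inter> T = {}" by force
  ultimately show False using connectedD[OF T] x y by blast
qed

lemma sphere_eq_exp:
  assumes "\<zeta> \<in> sphere c (exp x)" "cmod u = 1"
  obtains y where "0 \<le> y" "y < 2 * pi" "\<zeta> = c + u * exp (Complex x y)"
proof -
  have u: "u \<noteq> 0" using assms(2) by auto
  define w where "w = (\<zeta> - c) / u"
  have w: "cmod w = exp x" using assms by (simp add: w_def norm_divide dist_norm norm_minus_commute)
  have "w = of_real (exp x) * exp (\<i> * of_real (Arg2pi w))"
    using Arg2pi_eq[of w] w by simp
  also have "\<dots> = exp (Complex x (Arg2pi w))"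
    by (simp add: Complex_eq exp_add exp_of_real)
  finally have "\<zeta> = c + u * exp (Complex x (Arg2pi w))"
    using u by (simp add: w_def field_simps)
  then show ?thesis using that Arg2pi_ge_0 Arg2pi_lt_2pi by blast
qed

text \<open>The hypotheses are symmetric in \<open>p\<close> and \<open>q\<close>, so the distortion
  estimates serve maps of both orientations.\<close>

locale planar_dilatation_map =
  fixes D :: "complex set" and f p q :: "complex \<Rightarrow> complex" and K :: real
  assumes open_D: "open D" and hol_p: "p holomorphic_on D" and hol_q: "q holomorphic_on D"
    and der_f: "\<And>z. z \<in> D \<Longrightarrow> (f has_derivative (\<lambda>h. p z * h + cnj (q z * h))) (at z)"
    and dilatation: "\<And>z. z \<in> D \<Longrightarrow> (cmod (p z))\<^sup>2 + (cmod (q z))\<^sup>2 \<le> K * \<bar>(cmod (p z))\<^sup>2 - (cmod (q z))\<^sup>2\<bar>"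
    and inj_f: "inj_on f D" and K_ge_1: "1 \<le> K"
begin

lemma cont_f: "continuous_on D f"
  using der_f by (auto intro!: continuous_at_imp_continuous_on has_derivative_continuous)

lemma length_area:
  assumes "cmod u = 1" "0 < \<delta>" "\<delta> < L" "a < b"
    and "\<And>x. x \<in> {a<..<b} \<Longrightarrow> \<exists>y1\<in>{0..2*pi}. \<exists>y2\<in>{0..2*pi}.
        (\<forall>y\<in>closed_segment y1 y2. c + u * exp (Complex x y) \<in> D) \<and>
        cmod (f (c + u * exp (Complex x y1)) - v) \<le> \<delta> \<and> L \<le> cmod (f (c + u * exp (Complex x y2)) - v)"
  shows "L \<le> exp (max 1 (80 * pi\<^sup>2 * K / (b - a))) * \<delta>"
proof -
  have "ln (L / \<delta>) \<le> max 1 (80 * pi\<^sup>2 * K / (b - a))"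
    using K_ge_1 by (intro length_area_estimate[OF open_D holomorphic_on_imp_continuous_on[OF hol_p]
      holomorphic_on_imp_continuous_on[OF hol_q] der_f dilatation inj_f _ assms]) auto
  then have "exp (ln (L / \<delta>)) \<le> exp (max 1 (80 * pi\<^sup>2 * K / (b - a)))" by simp
  then have "L / \<delta> \<le> exp (max 1 (80 * pi\<^sup>2 * K / (b - a)))"
    using assms(2,3) by (subst (asm) exp_ln) auto
  then show ?thesis using assms(2) by (simp add: field_simps)
qed

text \<open>The image of each circle about \<open>z0\<close> meets the segment from \<open>f z0\<close> to the omitted point \<open>w\<close>
  and the ray from \<open>f z0\<close> beyond \<open>f z1\<close>.\<close>

lemma image_bounded_by_omitted:
  assumes d: "0 < d" "ball z0 d \<subseteq> D" and w: "w \<notin> f ` D" and z1: "cmod (z1 - z0) \<le> d / 2"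
  shows "cmod (f z1 - f z0) \<le> exp (max 1 (80 * pi\<^sup>2 * K / ln 2)) * cmod (w - f z0)"
proof (cases "cmod (f z1 - f z0) \<le> cmod (w - f z0)")
  case True
  moreover have "1 * cmod (w - f z0) \<le> exp (max 1 (80 * pi\<^sup>2 * K / ln 2)) * cmod (w - f z0)"
    by (rule mult_right_mono) auto
  ultimately show ?thesis by linarith
next
  case False
  have z0: "z0 \<in> D" using d by auto
  \<comment> \<open>Circles with radius between d / 2 and d lie in \<open>D\<close> and enclose
    \<open>z1\<close>; this annulus gives the ln 2 of the constant.\<close>
  have ab: "ln (d / 2) < ln d" "ln d - ln (d / 2) = ln 2" using d by (auto simp: ln_div)
  show ?thesis
    unfolding ab(2)[symmetric]
  proof (rule length_area[where u = 1 and c = z0 and v = "f z0"])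
    show "0 < cmod (w - f z0)" using w z0 by auto
    fix x assume "x \<in> {ln (d / 2)<..<ln d}"
    then have r: "d / 2 < exp x" "exp x < d"
      using d exp_less_mono[of "ln (d / 2)" x] exp_less_mono[of x "ln d"] by auto
    have cb: "cball z0 (exp x) \<subseteq> D" using r d by (auto simp: subset_iff)
    note circ = connected_meets_image_sphere[OF continuous_on_subset[OF cont_f cb] inj_on_subset[OF inj_f cb]]
    have f0: "f z0 \<in> f ` ball z0 (exp x)" by simp
    obtain \<zeta>1 where \<zeta>1: "\<zeta>1 \<in> sphere z0 (exp x)" "f \<zeta>1 \<in> closed_segment (f z0) w"
    proof -
      have "w \<notin> f ` cball z0 (exp x)" using w cb by blast
      then have "\<exists>\<zeta>\<in>sphere z0 (exp x). f \<zeta> \<in> closed_segment (f z0) w"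
        using circ[of "closed_segment (f z0) w" "f z0" w] f0 by simp
      then show ?thesis using that by blast
    qed
    let ?g = "\<lambda>t. f z0 + of_real t * (f z1 - f z0)"
    have con: "connected (?g ` {1..})"
      by (intro connected_continuous_image continuous_intros) (rule connected_Ici)
    have ne: "cmod (f z1 - f z0) > 0" using False norm_ge_zero[of "w - f z0"] by linarith
    have "bounded (f ` cball z0 (exp x))"
      by (intro compact_imp_bounded compact_continuous_image continuous_on_subset[OF cont_f cb]) simp
    then obtain B where B: "\<And>z. z \<in> cball z0 (exp x) \<Longrightarrow> cmod (f z) \<le> B"
      unfolding bounded_iff by blast
    \<comment> \<open>Far enough out on the ray to leave the compact image of the closed
      disc.\<close>
    define t where "t = max 1 ((B + cmod (f z0) + 1) / cmod (f z1 - f z0))"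
    have "B + cmod (f z0) + 1 \<le> t * cmod (f z1 - f z0)"
      using ne by (simp add: t_def max_def field_simps)
    also have "\<dots> \<le> cmod (?g t) + cmod (f z0)"
      using norm_triangle_ineq4[of "?g t" "f z0"] by (simp add: norm_mult t_def)
    finally have gt: "?g t \<notin> f ` cball z0 (exp x)" using B by force
    have z1b: "z1 \<in> ball z0 (exp x)" using z1 r by (simp add: dist_norm norm_minus_commute)
    have "\<exists>\<zeta>\<in>sphere z0 (exp x). f \<zeta> \<in> ?g ` {1..}"
    proof (rule circ[OF con])
      show "f z1 \<in> ?g ` {1..}" by (rule image_eqI[of _ _ 1]) auto
      show "f z1 \<in> f ` ball z0 (exp x)" using z1b by blast
      show "?g t \<in> ?g ` {1..}" by (rule imageI) (simp add: t_def)
      show "?g t \<notin> f ` cball z0 (exp x)" by (rule gt)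
    qed
    then obtain \<zeta>2 where \<zeta>2: "\<zeta>2 \<in> sphere z0 (exp x)" "f \<zeta>2 \<in> ?g ` {1..}" by blast
    obtain y1 where y1: "0 \<le> y1" "y1 < 2 * pi" "\<zeta>1 = z0 + 1 * exp (Complex x y1)"
      by (rule sphere_eq_exp[OF \<zeta>1(1), of 1]) auto
    obtain y2 where y2: "0 \<le> y2" "y2 < 2 * pi" "\<zeta>2 = z0 + 1 * exp (Complex x y2)"
      by (rule sphere_eq_exp[OF \<zeta>2(1), of 1]) auto
    show "\<exists>y1\<in>{0..2*pi}. \<exists>y2\<in>{0..2*pi}.
        (\<forall>y\<in>closed_segment y1 y2. z0 + 1 * exp (Complex x y) \<in> D) \<and>
        cmod (f (z0 + 1 * exp (Complex x y1)) - f z0) \<le> cmod (w - f z0) \<and>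
        cmod (f z1 - f z0) \<le> cmod (f (z0 + 1 * exp (Complex x y2)) - f z0)"
    proof (rule bexI[of _ y1], rule bexI[of _ y2], intro conjI ballI)
      fix y
      have "z0 + 1 * exp (Complex x y) \<in> cball z0 (exp x)" by (simp add: dist_norm)
      then show "z0 + 1 * exp (Complex x y) \<in> D" using cb by blast
    next
      show "cmod (f (z0 + 1 * exp (Complex x y1)) - f z0) \<le> cmod (w - f z0)"
        using segment_bound(1)[OF \<zeta>1(2)] y1(3) by simp
      obtain t where t: "1 \<le> t" "f \<zeta>2 = ?g t" using \<zeta>2(2) by auto
      have "1 * cmod (f z1 - f z0) \<le> t * cmod (f z1 - f z0)"
        using t(1) by (intro mult_right_mono) auto
      also have "\<dots> = cmod (f \<zeta>2 - f z0)" using t by (simp add: norm_mult)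
      finally show "cmod (f z1 - f z0) \<le> cmod (f (z0 + 1 * exp (Complex x y2)) - f z0)"
        unfolding y2(3) by simp
    qed (use y1 y2 in auto)
  qed (use False ab in auto)
qed

text \<open>A circle about the omitted point \<open>w\<close> cannot lie in the preimage of a disc, which is simply connected.\<close>

lemma image_bounded_below:
  assumes d: "0 < d" and w: "w \<notin> D" "cmod (z0 - w) = d" and z0: "ball z0 d \<subseteq> D"
    and R: "0 < R" "ball (f z0) R \<subseteq> f ` D"
    and \<delta>: "\<And>z. z \<in> cball z0 (d / 8) \<Longrightarrow> cmod (f z - f z0) \<le> \<delta>"
  shows "R / 2 \<le> exp (max 1 (80 * pi\<^sup>2 * K / ln (9 / 7))) * \<delta>"
proof (cases "R / 2 \<le> \<delta>")
  case True
  moreover have "1 * \<delta> \<le> exp (max 1 (80 * pi\<^sup>2 * K / ln (9 / 7))) * \<delta>"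
    using True R by (intro mult_right_mono) auto
  ultimately show ?thesis by linarith
next
  case False
  \<comment> \<open>Unit direction from \<open>w\<close> to \<open>z0\<close>: the angle 0 on each
    circle about \<open>w\<close> then points at \<open>z0\<close>.\<close>
  define u where "u = (z0 - w) / of_real d"
  have u: "cmod u = 1" using d w by (simp add: u_def norm_divide)
  have z0D: "z0 \<in> D" using d z0 by auto
  obtain g where g: "homeomorphism D (f ` D) f g"
    using invariance_of_domain_homeomorphism[OF open_D cont_f _ inj_f] by auto
  \<comment> \<open>Radii within d / 8 of d, so that each circle about \<open>w\<close> meets
    \<open>cball z0 (d / 8)\<close>, where \<open>f\<close> moves by at most \<delta>.\<close>
  have ab: "ln (7 * d / 8) < ln (9 * d / 8)" "ln (9 * d / 8) - ln (7 * d / 8) = ln (9 / 7)"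
    using d ln_div[of "9 * d / 8" "7 * d / 8"] by auto
  have \<delta>0: "0 < \<delta>"
  proof -
    have "z0 + of_real (d / 8) \<in> cball z0 (d / 8)" using d by (simp add: dist_norm)
    moreover from this have "z0 + of_real (d / 8) \<in> D" using z0 d by (force simp: subset_iff)
    then have "f (z0 + of_real (d / 8)) \<noteq> f z0" using inj_onD[OF inj_f _ _ z0D] d by fastforce
    then have "0 < cmod (f (z0 + of_real (d / 8)) - f z0)" by simp
    ultimately show ?thesis using \<delta>[of "z0 + of_real (d / 8)"] by linarith
  qed
  define V where "V = {z \<in> D. cmod (f z - f z0) < R}"
  have V: "simply_connected V"
  proof -
    have "f ` V = ball (f z0) R"
    proof (intro equalityI subsetI)
      fix x assume x: "x \<in> ball (f z0) R"
      then obtain z where "z \<in> D" "x = f z" using R(2) by blast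
      then show "x \<in> f ` V" using x by (auto simp: V_def dist_norm norm_minus_commute)
    qed (auto simp: V_def dist_norm norm_minus_commute)
    then have "homeomorphism V (ball (f z0) R) f g"
      by (intro homeomorphism_of_subsets[OF g _ R(2)]) (auto simp: V_def)
    then have "V homeomorphic ball (f z0) R" unfolding homeomorphic_def by blast
    then show ?thesis using homeomorphic_simply_connected_eq convex_imp_simply_connected convex_ball by blast
  qed
  \<comment> \<open>The circle is followed while it stays in \<open>O'\<close>, up to its first
    exit. Compactness of \<open>Kc\<close> inside \<open>D\<close> keeps the exit point in
    \<open>D\<close>, although the rest of the circle may leave \<open>D\<close>.\<close>
  define Kc where "Kc = {z \<in> D. cmod (f z - f z0) \<le> R / 2}"
  define O' where "O' = {z \<in> D. cmod (f z - f z0) < R / 2}"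
  have "compact Kc"
  proof -
    have sub: "cball (f z0) (R / 2) \<subseteq> f ` D" using R by (auto simp: subset_iff)
    have "Kc = g ` cball (f z0) (R / 2)"
    proof (intro equalityI subsetI)
      fix z assume "z \<in> Kc"
      then have "z = g (f z)" "f z \<in> cball (f z0) (R / 2)"
        using g by (auto simp: Kc_def homeomorphism_def dist_norm norm_minus_commute)
      then show "z \<in> g ` cball (f z0) (R / 2)" by blast
    next
      fix z assume "z \<in> g ` cball (f z0) (R / 2)"
      then obtain x where x: "x \<in> cball (f z0) (R / 2)" "z = g x" by blast
      then have "x \<in> f ` D" using sub by blast
      then have "f (g x) = x" "g x \<in> D" using g unfolding homeomorphism_def by auto
      then show "z \<in> Kc" using x by (simp add: Kc_def dist_norm norm_minus_commute)
    qed
    moreover have "continuous_on (f ` D) g" using g unfolding homeomorphism_def by blast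
    ultimately show ?thesis
      using compact_continuous_image[OF continuous_on_subset[OF _ sub] compact_cball] by metis
  qed
  then have closedK: "closed Kc" by (rule compact_imp_closed)
  have openO: "open O'"
  proof -
    have "open (D \<inter> f -` ball (f z0) (R / 2))"
      by (rule continuous_open_preimage[OF cont_f open_D]) simp
    also have "D \<inter> f -` ball (f z0) (R / 2) = O'"
      by (auto simp: O'_def dist_norm norm_minus_commute)
    finally show ?thesis .
  qed
  show ?thesis
    unfolding ab(2)[symmetric]
  proof (rule length_area[OF u \<delta>0, where c = w and v = "f z0"])
    fix x assume "x \<in> {ln (7 * d / 8)<..<ln (9 * d / 8)}"
    then have r: "7 * d / 8 < exp x" "exp x < 9 * d / 8"
      using d exp_less_mono[of "ln (7 * d / 8)" x] exp_less_mono[of x "ln (9 * d / 8)"] by auto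
    define \<theta> where "\<theta> y = w + u * exp (Complex x y)" for y
    have cont\<theta>: "continuous_on A \<theta>" for A unfolding \<theta>_def by (intro continuous_intros)
    have "\<theta> 0 - z0 = u * of_real (exp x - d)"
      using d by (simp add: \<theta>_def u_def field_simps Complex_eq exp_of_real)
    then have "cmod (\<theta> 0 - z0) = \<bar>exp x - d\<bar>" using u by (simp only: norm_mult norm_of_real) simp
    then have "\<theta> 0 \<in> cball z0 (d / 8)" using r by (simp add: dist_norm norm_minus_commute abs_if)
    then have \<theta>0: "cmod (f (\<theta> 0) - f z0) \<le> \<delta>" "\<theta> 0 \<in> D"
      using \<delta> z0 d by (auto simp: subset_iff)
    \<comment> \<open>The angles at which the circle is outside \<open>O'\<close>; the least of them
      is the end of the arc, where |f - f z0| has reached R / 2.\<close>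
    define Y where "Y = {y \<in> {0..2*pi}. \<theta> y \<notin> O'}"
    have "Y \<noteq> {}"
    proof
      assume "Y = {}"
      have "sphere w (exp x) \<subseteq> O'"
      proof (intro subsetI)
        fix \<zeta> assume "\<zeta> \<in> sphere w (exp x)"
        then obtain y where "0 \<le> y" "y < 2 * pi" "\<zeta> = \<theta> y"
          using sphere_eq_exp[OF _ u] unfolding \<theta>_def by blast
        moreover from this have "y \<notin> Y" using \<open>Y = {}\<close> by simp
        ultimately show "\<zeta> \<in> O'" by (simp add: Y_def)
      qed
      then have sub: "path_image (circlepath w (exp x)) \<subseteq> V"
        using R by (auto simp: O'_def V_def)
      have "winding_number (circlepath w (exp x)) w = 0"
        by (rule simply_connected_imp_winding_number_zero[OF V _ sub]) (use w in \<open>auto simp: V_def\<close>)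
      then show False by (simp add: winding_number_circlepath_centre)
    qed
    moreover have "compact Y"
    proof -
      have "closed ({0..2*pi} \<inter> \<theta> -` (- O'))"
        by (rule continuous_closed_preimage[OF cont\<theta>]) (use openO in auto)
      also have "{0..2*pi} \<inter> \<theta> -` (- O') = Y" by (auto simp: Y_def)
      finally show ?thesis
        using bounded_subset[OF bounded_closed_interval, of Y 0 "2*pi"]
        unfolding compact_eq_bounded_closed by (force simp: Y_def)
    qed
    ultimately have "\<exists>t\<in>Y. \<forall>y\<in>Y. t \<le> y" by (intro compact_attains_inf)
    then obtain t where t: "t \<in> Y" "\<And>y. y \<in> Y \<Longrightarrow> t \<le> y" by auto
    have t02: "0 \<le> t" "t \<le> 2 * pi" "\<theta> t \<notin> O'" using t(1) by (auto simp: Y_def)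
    have "\<theta> 0 \<in> O'" using \<theta>0 False by (auto simp: O'_def)
    then have tpos: "0 < t" using t02 by (cases "t = 0") auto
    have below: "\<theta> ` {0..<t} \<subseteq> Kc"
    proof
      fix z assume "z \<in> \<theta> ` {0..<t}"
      then obtain y where y: "0 \<le> y" "y < t" "z = \<theta> y" by auto
      then have "y \<notin> Y" using t(2) by force
      then have "\<theta> y \<in> O'" using y t02 by (auto simp: Y_def)
      then show "z \<in> Kc" using y by (auto simp: O'_def Kc_def)
    qed
    have "\<theta> ` closure {0..<t} \<subseteq> Kc"
      by (rule image_closure_subset[OF cont\<theta> closedK below])
    then have inK: "\<theta> y \<in> Kc" if "y \<in> {0..t}" for y using tpos that by auto
    show "\<exists>y1\<in>{0..2*pi}. \<exists>y2\<in>{0..2*pi}.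
        (\<forall>y\<in>closed_segment y1 y2. w + u * exp (Complex x y) \<in> D) \<and>
        cmod (f (w + u * exp (Complex x y1)) - f z0) \<le> \<delta> \<and>
        R / 2 \<le> cmod (f (w + u * exp (Complex x y2)) - f z0)"
    proof (rule bexI[of _ 0], rule bexI[of _ t], intro conjI ballI)
      show "w + u * exp (Complex x y) \<in> D" if "y \<in> closed_segment 0 t" for y
        using inK[of y] that tpos by (auto simp: Kc_def \<theta>_def closed_segment_eq_real_ivl)
      show "cmod (f (w + u * exp (Complex x 0)) - f z0) \<le> \<delta>" using \<theta>0(1) by (simp add: \<theta>_def)
      show "R / 2 \<le> cmod (f (w + u * exp (Complex x t)) - f z0)"
        using inK[of t] t02 by (auto simp: Kc_def O'_def \<theta>_def)
    qed (use t02 in auto)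
  qed (use False ab in auto)
qed

end

subsection \<open>Quasihyperbolic distances\<close>

lemma proper_subdomain_frontier:
  assumes D: "proper_subdomain D" and z: "z \<in> D"
  shows "0 < infdist z (frontier D)" "ball z (infdist z (frontier D)) \<subseteq> D"
    and "\<exists>w. w \<notin> D \<and> cmod (w - z) = infdist z (frontier D)"
proof -
  have o: "open D" and ne: "frontier D \<noteq> {}"
    using D by (auto simp: proper_subdomain_def frontier_eq_empty)
  have disj: "frontier D \<inter> D = {}" using o by (simp add: frontier_disjoint_eq)
  show pos: "0 < infdist z (frontier D)"
    using infdist_pos_not_in_closed[OF frontier_closed ne, of z] disj z by auto
  show "ball z (infdist z (frontier D)) \<subseteq> D"
  proof (rule ccontr)
    assume "\<not> ?thesis"
    moreover have "z \<in> ball z (infdist z (frontier D)) \<inter> D" using z pos by simp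
    ultimately have "ball z (infdist z (frontier D)) \<inter> frontier D \<noteq> {}"
      using connected_Int_frontier[OF connected_ball] by blast
    then obtain x where "x \<in> frontier D" "dist z x < infdist z (frontier D)" by auto
    then show False using infdist_le[of x "frontier D" z] by simp
  qed
  obtain w where "w \<in> frontier D" "infdist z (frontier D) = dist z w"
    using infdist_attains_inf[OF frontier_closed ne] by blast
  then show "\<exists>w. w \<notin> D \<and> cmod (w - z) = infdist z (frontier D)"
    using disj by (intro exI[of _ w]) (auto simp: dist_norm norm_minus_commute)
qed

lemma polygon_lengths_identity:
  assumes "x \<in> polygon_lengths (\<lambda>t::real. t) a b" "a \<le> b"
  shows "x = b - a"
proof -
  obtain K where K: "K division_of cbox a b" "x = (\<Sum>k\<in>K. dist (Inf k) (Sup k))"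
    using assms unfolding polygon_lengths_def by (auto simp: cbox_interval)
  have "dist (Inf k) (Sup k) = measure lborel k" if "k \<in> K" for k
    using division_ofD(3,4)[OF K(1) that] by (auto simp: cbox_interval dist_real_def)
  then show ?thesis
    using additive_content_division[OF K(1)] K(2) assms(2) by (simp add: cbox_interval)
qed

text \<open>Ensures that the infimum in \<open>quasihyperbolic_dist\<close> is over a nonempty set.
  A polynomial path has bounded speed on {0..1}, so its polygons are at most the speed bound times
  those of the identity path, which have length 1.\<close>

lemma rectifiable_path_exists:
  fixes D :: "'a::euclidean_space set"
  assumes "open D" "connected D" "x \<in> D" "y \<in> D"
  obtains g where "rectifiable_path g" "path_image g \<subseteq> D" "pathstart g = x" "pathfinish g = y"
proof -
  obtain g where g: "polynomial_function g" "path_image g \<subseteq> D" "pathstart g = x" "pathfinish g = y"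
    using connected_open_polynomial_connected[OF assms] by blast
  obtain g' where g': "polynomial_function g'" "\<And>t. (g has_vector_derivative g' t) (at t)"
    using has_vector_derivative_polynomial_function[OF g(1)] by blast
  have "bounded (g' ` {0..1})"
    using g'(1) by (intro compact_imp_bounded compact_continuous_image continuous_on_polymonial_function) auto
  then obtain B where B: "\<And>t. t \<in> {0..1} \<Longrightarrow> norm (g' t) \<le> B"
    unfolding bounded_iff by blast
  have lip: "dist (g s) (g t) \<le> B * dist s t" if "s \<in> {0..1}" "t \<in> {0..1}" for s t
    unfolding dist_norm
  proof (rule differentiable_bound[OF convex_real_interval(5)[of 0 1] _ _ that])
    show "(g has_derivative (\<lambda>h. h *\<^sub>R g' u)) (at u within {0..1})" for u
      using g'(2) unfolding has_vector_derivative_def by (rule has_derivative_at_withinI)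
    show "onorm (\<lambda>h. h *\<^sub>R g' u) \<le> B" if "u \<in> {0..1}" for u
    proof (rule onorm_bound)
      show "0 \<le> B" using B[OF that] norm_ge_zero order_trans by blast
      show "norm (h *\<^sub>R g' u) \<le> B * norm h" for h
        using mult_right_mono[OF B[OF that], of "\<bar>h\<bar>"] by (simp add: mult.commute)
    qed
  qed
  have "bdd_above (polygon_lengths g 0 1)"
  proof (rule bdd_aboveI)
    fix l assume "l \<in> polygon_lengths g 0 1"
    then obtain l' where "l' \<in> polygon_lengths (\<lambda>t. t) 0 (1::real)" "l \<le> B * l'"
      using polygon_lengths_mono[where h = g and g = "\<lambda>t. t" and c = B, OF _ lip] by metis
    then show "l \<le> B" using polygon_lengths_identity[of l' 0 1] by simp
  qed
  moreover have "path g" using g(1) by (rule path_polynomial_function)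
  ultimately show ?thesis using that g unfolding rectifiable_path_def by blast
qed

lemma quasihyperbolic_integral_nonneg:
  assumes D: "proper_subdomain D" and g: "rectifiable_path g" "path_image g \<subseteq> D"
  shows "0 \<le> arclength_integral (\<lambda>z. 1 / infdist z (frontier D)) g"
proof (rule arclength_integral_nonneg[OF g(1)])
  have "infdist z (frontier D) \<noteq> 0" if "z \<in> path_image g" for z
    using proper_subdomain_frontier(1)[OF D, of z] that g(2) by auto
  then show "continuous_on (path_image g) (\<lambda>z. 1 / infdist z (frontier D))"
    by (intro continuous_on_divide continuous_on_infdist continuous_on_id continuous_on_const) auto
qed (simp add: infdist_nonneg)

lemma quasihyperbolic_dist_nonneg:
  assumes D: "proper_subdomain D" and z: "z1 \<in> D" "z2 \<in> D"
  shows "0 \<le> quasihyperbolic_dist D z1 z2"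
proof -
  obtain g where "rectifiable_path g" "path_image g \<subseteq> D" "pathstart g = z1" "pathfinish g = z2"
    using rectifiable_path_exists[of D z1 z2] D z by (auto simp: proper_subdomain_def)
  then show ?thesis
    unfolding quasihyperbolic_dist_def using quasihyperbolic_integral_nonneg[OF D]
    by (intro cInf_greatest) auto
qed

text \<open>The infinitesimal Lipschitz bound suffices: the quotient of the two boundary distances
  is continuous, so on a small ball the derivative bound holds with twice its value at the centre,
  which gives a Lipschitz bound there, and path integrals can be compared. The estimate serves both
  for a map and for its inverse.\<close>

lemma quasihyperbolic_dist_image_le:
  assumes D: "proper_subdomain D" and D': "proper_subdomain D'" and f: "f ` D \<subseteq> D'"
    and der: "\<And>z. z \<in> D \<Longrightarrow> (f has_derivative f' z) (at z)"
    and bound: "\<And>z. z \<in> D \<Longrightarrow> onorm (f' z) \<le> C * infdist (f z) (frontier D') / infdist z (frontier D)"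
    and C: "0 < C" and z12: "z1 \<in> D" "z2 \<in> D"
  shows "quasihyperbolic_dist D' (f z1) (f z2) \<le> 16 * C * quasihyperbolic_dist D z1 z2"
proof -
  define d where "d z = infdist z (frontier D)" for z
  define d' where "d' z = infdist z (frontier D')" for z
  have dpos: "0 < d z" if "z \<in> D" for z using proper_subdomain_frontier(1)[OF D that] by (simp add: d_def)
  have d'pos: "0 < d' z" if "z \<in> D'" for z using proper_subdomain_frontier(1)[OF D' that] by (simp add: d'_def)
  have contd: "continuous_on A d" "continuous_on A d'" for A
    unfolding d_def[abs_def] d'_def[abs_def] by (auto intro!: continuous_on_infdist continuous_on_id)
  have oD: "open D" "connected D" using D by (auto simp: proper_subdomain_def)
  have contf: "continuous_on D f"
    using der by (auto intro!: continuous_at_imp_continuous_on has_derivative_continuous)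
  define P where "P E x y = {g. rectifiable_path g \<and> path_image g \<subseteq> E \<and> pathstart g = x \<and> pathfinish g = y}"
    for E and x y :: complex
  have qh: "quasihyperbolic_dist E x y = Inf ((\<lambda>g. arclength_integral (\<lambda>z. 1 / infdist z (frontier E)) g) ` P E x y)" for E x y
    unfolding quasihyperbolic_dist_def P_def by (rule arg_cong[of _ _ Inf]) auto
  have ne: "P D z1 z2 \<noteq> {}"
    using rectifiable_path_exists[OF oD z12] unfolding P_def by blast
  have bdd: "bdd_below ((\<lambda>g. arclength_integral (\<lambda>z. 1 / d' z) g) ` P D' x y)" for x y
    using quasihyperbolic_integral_nonneg[OF D'] unfolding P_def d'_def by (intro bdd_belowI2[of _ 0]) auto
  have main: "quasihyperbolic_dist D' (f z1) (f z2) \<le> 16 * C * arclength_integral (\<lambda>z. 1 / d z) g"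
    if g: "g \<in> P D z1 z2" for g
  proof -
    have gD: "path_image g \<subseteq> D" and rect: "rectifiable_path g" using g by (auto simp: P_def)
    have cf: "continuous_on (path_image g) f" using contf gD continuous_on_subset by blast
    have c1: "continuous_on (path_image g) (\<lambda>z. 1 / d z)"
      using gD dpos by (intro continuous_on_divide contd continuous_on_const) force
    have c2: "continuous_on (f ` path_image g) (\<lambda>z. 1 / d' z)"
      using gD f d'pos by (intro continuous_on_divide contd continuous_on_const) force
    \<comment> \<open>The doubling accounts for 2 C and leaves room up to 4 C; the comparison of
      path integrals contributes another factor 4, whence 16 C.\<close>
    have loc: "\<exists>r>0. \<forall>x \<in> path_image g \<inter> ball z r. \<forall>y \<in> path_image g \<inter> ball z r.
       1 / d' (f z) * dist (f x) (f y) \<le> 4 * C * (1 / d z) * dist x y" if z: "z \<in> path_image g" for z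
    proof -
      have zD: "z \<in> D" and fz: "f z \<in> D'" using z gD f by auto
      define h where "h x = d' (f x) / d x" for x
      have ch: "continuous_on D h"
        unfolding h_def using dpos
        by (intro continuous_on_divide contd continuous_on_compose2[OF contd(2)[of UNIV] contf]) force+
      have hz: "0 < h z" using dpos[OF zD] d'pos[OF fz] by (simp add: h_def)
      obtain r1 where r1: "r1 > 0" "ball z r1 \<subseteq> D" using oD(1) zD open_contains_ball by blast
      obtain r2 where r2: "r2 > 0" "\<And>x. x \<in> D \<Longrightarrow> dist x z < r2 \<Longrightarrow> dist (h x) (h z) < h z"
        using ch zD hz unfolding continuous_on_iff by metis
      define r where "r = min r1 r2"
      have r: "r > 0" "ball z r \<subseteq> D" using r1 r2 by (auto simp: r_def)
      have on: "onorm (f' x) \<le> C * (2 * h z)" if "x \<in> ball z r" for x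
      proof -
        have xD: "x \<in> D" using that r by blast
        have "onorm (f' x) \<le> C * h x" using bound[OF xD] by (simp add: h_def d_def d'_def)
        also have "h x \<le> 2 * h z" using r2(2)[OF xD] that by (simp add: r_def dist_commute dist_real_def abs_if split: if_splits)
        finally show ?thesis using C by simp
      qed
      have "dist (f x) (f y) \<le> C * (2 * h z) * dist x y" if "x \<in> ball z r" "y \<in> ball z r" for x y
        unfolding dist_norm
        by (rule differentiable_bound[OF convex_ball has_derivative_at_withinI[OF der] on that]) (use r(2) in auto)
      moreover have "1 / d' (f z) * (C * (2 * h z) * t) \<le> 4 * C * (1 / d z) * t" if "0 \<le> t" for t
        using dpos[OF zD] d'pos[OF fz] C that by (simp add: h_def field_simps)
      ultimately have "1 / d' (f z) * dist (f x) (f y) \<le> 4 * C * (1 / d z) * dist x y" if "x \<in> ball z r" "y \<in> ball z r" for x y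
        using that d'pos[OF fz] by (meson mult_left_mono order_trans zero_le_dist less_imp_le zero_less_divide_1_iff)
      then show ?thesis using r(1) by blast
    qed
    note im = arclength_integral_image_le[OF rect cf c1 _ c2 _ _ loc]
    have pos1: "0 < 1 / d x" if "x \<in> path_image g" for x using dpos that gD by auto
    have pos2: "0 < 1 / d' (f x)" if "x \<in> path_image g" for x using d'pos that gD f by (auto simp: image_subset_iff)
    have "rectifiable_path (f \<circ> g)" "arclength_integral (\<lambda>z. 1 / d' z) (f \<circ> g) \<le> 4 * (4 * C) * arclength_integral (\<lambda>z. 1 / d z) g"
      using im pos1 pos2 C by auto
    moreover from this have "f \<circ> g \<in> P D' (f z1) (f z2)"
      using g gD f by (auto simp: P_def path_image_compose pathstart_compose pathfinish_compose)
    then have "quasihyperbolic_dist D' (f z1) (f z2) \<le> arclength_integral (\<lambda>z. 1 / d' z) (f \<circ> g)"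
      unfolding qh using bdd unfolding d'_def by (intro cInf_lower) auto
    ultimately show ?thesis by simp
  qed
  have "quasihyperbolic_dist D' (f z1) (f z2) / (16 * C) \<le> quasihyperbolic_dist D z1 z2"
    unfolding qh[of D]
    by (rule cInf_greatest) (use ne main C in \<open>auto simp: d_def field_simps\<close>)
  then show ?thesis using C by (simp add: field_simps)
qed

section \<open>Size of the derivative against the boundary distances\<close>

context planar_dilatation_map
begin

text \<open>\<open>p + q\<close> and \<open>-i (p - q)\<close> are the holomorphic functions u_x - i
  u_y for u = Re f and u = Im f. The gradient estimate bounds both, and \<open>p\<close>,
  \<open>q\<close> are half the sum and half the difference of p + q and p - q.\<close>

lemma derivative_coefficients_le:
  assumes r: "0 < r" "ball z r \<subseteq> D" and B: "0 < B" and bound: "\<And>w. w \<in> ball z r \<Longrightarrow> cmod (f w - v) \<le> B"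
  shows "cmod (p z) \<le> 2 * exp 2 * B / r" "cmod (q z) \<le> 2 * exp 2 * B / r"
proof -
  have hol: "p holomorphic_on ball z r" "q holomorphic_on ball z r"
    using hol_p hol_q r(2) holomorphic_on_subset by blast+
  have "cmod (p z + q z) \<le> 2 * exp 2 * B / r"
  proof (rule harmonic_gradient_bound[OF r(1) B, where u = "\<lambda>w. Re (f w)" and k = "Re v" and a = "\<lambda>z. p z + q z"])
    fix w assume w: "w \<in> ball z r"
    then have "((\<lambda>w. Re (f w)) has_derivative (\<lambda>h. Re (p w * h + cnj (q w * h)))) (at w)"
      using r(2) by (intro bounded_linear.has_derivative[OF bounded_linear_Re der_f]) blast
    then show "((\<lambda>w. Re (f w)) has_derivative (\<lambda>h. Re ((p w + q w) * h))) (at w)"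
      by (rule has_derivative_eq_rhs) (auto simp: algebra_simps)
    show "\<bar>Re (f w) - Re v\<bar> \<le> B" using bound[OF w] abs_Re_le_cmod[of "f w - v"] by simp
  qed (intro holomorphic_intros hol)
  moreover have "cmod (- \<i> * (p z - q z)) \<le> 2 * exp 2 * B / r"
  proof (rule harmonic_gradient_bound[OF r(1) B, where u = "\<lambda>w. Im (f w)" and k = "Im v" and a = "\<lambda>z. - \<i> * (p z - q z)"])
    fix w assume w: "w \<in> ball z r"
    then have "((\<lambda>w. Im (f w)) has_derivative (\<lambda>h. Im (p w * h + cnj (q w * h)))) (at w)"
      using r(2) by (intro bounded_linear.has_derivative[OF bounded_linear_Im der_f]) blast
    then show "((\<lambda>w. Im (f w)) has_derivative (\<lambda>h. Re (- \<i> * (p w - q w) * h))) (at w)"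
      by (rule has_derivative_eq_rhs) (auto simp: algebra_simps)
    show "\<bar>Im (f w) - Im v\<bar> \<le> B" using bound[OF w] abs_Im_le_cmod[of "f w - v"] by simp
  qed (intro holomorphic_intros hol)
  ultimately have 1: "cmod (p z + q z) \<le> 2 * exp 2 * B / r" and 2: "cmod (p z - q z) \<le> 2 * exp 2 * B / r"
    by (auto simp: norm_mult)
  have "2 * cmod (p z) = cmod ((p z + q z) + (p z - q z))" "2 * cmod (q z) = cmod ((p z + q z) - (p z - q z))"
    by (simp_all add: norm_mult[symmetric])
  then show "cmod (p z) \<le> 2 * exp 2 * B / r" "cmod (q z) \<le> 2 * exp 2 * B / r"
    using 1 2 norm_triangle_ineq[of "p z + q z" "p z - q z"] norm_triangle_ineq4[of "p z + q z" "p z - q z"] by linarith+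
qed

lemma onorm_derivative_le:
  assumes "cmod (p z) \<le> B" "cmod (q z) \<le> B"
  shows "onorm (\<lambda>h. p z * h + cnj (q z * h)) \<le> 2 * B"
proof (rule onorm_bound)
  show "0 \<le> 2 * B" using assms(1) norm_ge_zero[of "p z"] by linarith
  fix h
  have "cmod (p z * h + cnj (q z * h)) \<le> cmod (p z) * cmod h + cmod (q z) * cmod h"
    using norm_triangle_ineq[of "p z * h" "cnj (q z * h)"] by (simp add: norm_mult)
  also have "\<dots> \<le> B * cmod h + B * cmod h" using assms by (intro add_mono mult_right_mono) auto
  finally show "cmod (p z * h + cnj (q z * h)) \<le> 2 * B * cmod h" by simp
qed

text \<open>Let d and R be the boundary distances of z and f z. Above: \<open>f\<close> oscillates
  by at most \<open>CA\<close> R on the disc of radius d / 2, and the gradient estimate is used on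
  discs of radius d / 8 inside it. Below: \<open>f\<close> moves by more than \<open>cB\<close> R
  within distance d / 8, so |m| is large at some z1 there, and Harnack on the disc of radius d / 4
  about z1 returns to z. The radii match: z is within half that radius of z1, and the disc stays in
  \<open>cball z (3 d / 8)\<close>, where the upper bound holds.\<close>

lemma derivative_comparison:
  assumes D: "proper_subdomain D" and D': "proper_subdomain D'" and img: "f ` D = D'"
    and m: "m = p \<or> m = q" and dom: "\<And>z. z \<in> D \<Longrightarrow> cmod (p z) \<le> cmod (m z) \<and> cmod (q z) \<le> cmod (m z)"
    and nz: "\<And>z. z \<in> D \<Longrightarrow> m z \<noteq> 0"
  shows "\<exists>c>0. \<exists>G>0. \<forall>z\<in>D.
     c * infdist (f z) (frontier D') / infdist z (frontier D) \<le> cmod (m z) \<and>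
     cmod (m z) \<le> G * infdist (f z) (frontier D') / infdist z (frontier D)"
proof -
  define CA where "CA = exp (max 1 (80 * pi\<^sup>2 * K / ln 2))"
  define CB where "CB = exp (max 1 (80 * pi\<^sup>2 * K / ln (9 / 7)))"
  \<comment> \<open>\<open>G\<close> is 2 e^2 B / r with B = \<open>CA\<close> R and r = d / 8.
    \<open>cB\<close> turns a failure of the lower oscillation bound into R / 2 \<le> R / 4.
    \<open>H\<close> is the quotient of 2 G R / d and 4 cB R / d, and \<open>c\<close> satisfies 2 G
    / H^3 = c, the cube being Harnack's factor 3.\<close>
  define G where "G = 16 * exp 2 * CA"
  define cB where "cB = 1 / (4 * CB)"
  define H where "H = G / (2 * cB)"
  define c where "c = 2 * G / H ^ 3"
  have pos: "0 < CA" "0 < CB" by (auto simp: CA_def CB_def)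
  then have pos': "0 < G" "0 < cB" by (auto simp: G_def cB_def)
  then have H: "0 < H" "0 < c" by (auto simp: H_def c_def)
  have hol_m: "m holomorphic_on D" using m hol_p hol_q by auto
  have "c * infdist (f z) (frontier D') / infdist z (frontier D) \<le> cmod (m z) \<and>
     cmod (m z) \<le> G * infdist (f z) (frontier D') / infdist z (frontier D)" if z: "z \<in> D" for z
  proof -
    define d where "d = infdist z (frontier D)"
    define R where "R = infdist (f z) (frontier D')"
    have fz: "f z \<in> D'" using z img by blast
    note fr = proper_subdomain_frontier[OF D z, folded d_def]
    note fr' = proper_subdomain_frontier[OF D' fz, folded R_def]
    obtain w where w: "w \<notin> D" "cmod (w - z) = d" using fr(3) by blast
    obtain w' where w': "w' \<notin> D'" "cmod (w' - f z) = R" using fr'(3) by blast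
    have osc: "cmod (f x - f z) \<le> CA * R" if "cmod (x - z) \<le> d / 2" for x
      using image_bounded_by_omitted[OF fr(1,2), of w' x] w' img that by (simp add: CA_def)
    have upper: "cmod (m x) \<le> G * R / d" if x: "cmod (x - z) \<le> 3 * d / 8" for x
    proof -
      have sub: "ball x (d / 8) \<subseteq> cball z (d / 2)"
      proof
        fix y assume "y \<in> ball x (d / 8)"
        then show "y \<in> cball z (d / 2)"
          using x dist_triangle[of z y x] by (simp add: dist_norm norm_minus_commute)
      qed
      have "cball z (d / 2) \<subseteq> D" using fr by (auto simp: subset_iff)
      then have "cmod (p x) \<le> 2 * exp 2 * (CA * R) / (d / 8) \<and> cmod (q x) \<le> 2 * exp 2 * (CA * R) / (d / 8)"
        using sub fr(1) fr'(1) pos osc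
        by (intro conjI derivative_coefficients_le[where v = "f z"]) (auto simp: subset_iff dist_norm norm_minus_commute)
      then show ?thesis using m by (auto simp: G_def field_simps)
    qed
    have subD: "cball z (3 * d / 8) \<subseteq> D" using fr by (auto simp: subset_iff)
    have "\<exists>z2\<in>cball z (d / 8). cB * R < cmod (f z2 - f z)"
    proof (rule ccontr)
      assume "\<not> ?thesis"
      then have "R / 2 \<le> CB * (cB * R)"
        unfolding CB_def
        by (intro image_bounded_below[OF fr(1) w(1) _ fr(2) fr'(1)])
           (use w(2) fr'(2) img in \<open>auto simp: norm_minus_commute not_less\<close>)
      also have "\<dots> = R / 4" using pos by (simp add: cB_def)
      finally show False using fr'(1) by simp
    qed
    then obtain z2 where z2: "z2 \<in> cball z (d / 8)" "cB * R < cmod (f z2 - f z)" by blast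
    \<comment> \<open>Otherwise the derivative has norm at most 2 (4 cB R / d), and over a distance
      d / 8 the map moves by at most cB R.\<close>
    have "\<exists>z1\<in>cball z (d / 8). 4 * cB * R / d \<le> cmod (m z1)"
    proof (rule ccontr)
      assume no: "\<not> ?thesis"
      have "norm (f z2 - f z) \<le> 2 * (4 * cB * R / d) * norm (z2 - z)"
      proof (rule differentiable_bound[OF convex_cball[of z "d / 8"], where f' = "\<lambda>z h. p z * h + cnj (q z * h)"])
        fix x assume x: "x \<in> cball z (d / 8)"
        then have xD: "x \<in> D" using subD fr(1) by (auto simp: subset_iff)
        show "(f has_derivative (\<lambda>h. p x * h + cnj (q x * h))) (at x within cball z (d / 8))"
          using der_f[OF xD] by (rule has_derivative_at_withinI)
        show "onorm (\<lambda>h. p x * h + cnj (q x * h)) \<le> 2 * (4 * cB * R / d)"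
        proof (rule onorm_derivative_le)
          have "cmod (m x) \<le> 4 * cB * R / d" using no x by (meson linear)
          then show "cmod (p x) \<le> 4 * cB * R / d" "cmod (q x) \<le> 4 * cB * R / d"
            using dom[OF xD] by linarith+
        qed
      qed (use z2 fr(1) in auto)
      also have "\<dots> \<le> 2 * (4 * cB * R / d) * (d / 8)"
        using z2(1) pos' fr(1) fr'(1) by (intro mult_left_mono) (auto simp: dist_norm norm_minus_commute)
      also have "\<dots> = cB * R" using fr(1) by simp
      finally show False using z2(2) by simp
    qed
    then obtain z1 where z1: "z1 \<in> cball z (d / 8)" "4 * cB * R / d \<le> cmod (m z1)" by blast
    \<comment> \<open>Twice the upper bound, since Harnack asks for a strict majorant of
      |m|.\<close>
    define M where "M = 2 * G * R / d"
    have Mpos: "0 < M" using pos' fr(1) fr'(1) by (simp add: M_def)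
    have sub1: "ball z1 (d / 4) \<subseteq> cball z (3 * d / 8)"
    proof
      fix y assume "y \<in> ball z1 (d / 4)"
      then show "y \<in> cball z (3 * d / 8)"
        using z1(1) dist_triangle[of z y z1] by simp
    qed
    have z1D: "z1 \<in> D" using sub1 subD fr(1) by (auto simp: subset_iff)
    have "ln (M / cmod (m z)) \<le> 3 * ln (M / cmod (m z1))"
    proof (rule harnack_log[where r = "d / 4" and m = m and z = z and ?z1.0 = z1])
      show "m holomorphic_on ball z1 (d / 4)" using hol_m sub1 subD holomorphic_on_subset by (metis order_trans)
      fix x assume x: "x \<in> ball z1 (d / 4)"
      then show "m x \<noteq> 0" using nz sub1 subD by blast
      have "cmod (m x) \<le> G * R / d" using x sub1 by (intro upper) (auto simp: subset_iff dist_norm norm_minus_commute)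
      also have "\<dots> < M" using Mpos by (simp add: M_def)
      finally show "cmod (m x) < M" .
    qed (use fr(1) z1 in \<open>auto simp: dist_norm norm_minus_commute\<close>)
    also have "\<dots> \<le> 3 * ln H"
    proof -
      have "M / cmod (m z1) \<le> M / (4 * cB * R / d)"
        using z1(2) Mpos pos' fr(1) fr'(1) nz[OF z1D] by (intro divide_left_mono mult_pos_pos) auto
      also have "\<dots> = H" using pos' fr(1) fr'(1) by (simp add: M_def H_def field_simps)
      finally show ?thesis using Mpos nz[OF z1D] H by simp
    qed
    also have "\<dots> = ln (H ^ 3)" using H by (simp add: ln_realpow)
    finally have "M / cmod (m z) \<le> H ^ 3" using Mpos nz[OF z] H by simp
    then have "M \<le> H ^ 3 * cmod (m z)" using nz[OF z] by (simp add: field_simps)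
    then have "M / H ^ 3 \<le> cmod (m z)" using H by (simp add: field_simps)
    moreover have "M / H ^ 3 = c * R / d" by (simp add: M_def c_def field_simps)
    ultimately show ?thesis using upper[of z] fr(1) by (simp add: d_def R_def)
  qed
  then show ?thesis using pos' H by blast
qed

end

text \<open>The last condition of \<open>dom\<close> says that the coefficient other than
  \<open>m\<close> is at most \<kappa> |m|, without naming it. Thus the derivative stretches every
  vector by at least (1 - \<kappa>) |m|, so it is invertible, \<open>g\<close> is differentiable,
  and the path estimate applies to \<open>f\<close> and to \<open>g\<close>.\<close>

lemma harmonic_dilatation_bilipschitz:
  assumes map: "planar_dilatation_map D f p q K" and D: "proper_subdomain D" and D': "proper_subdomain D'"
    and g: "homeomorphism D D' f g" and m: "m = p \<or> m = q" and nz: "\<And>z. z \<in> D \<Longrightarrow> m z \<noteq> 0"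
    and \<kappa>: "0 \<le> \<kappa>" "\<kappa> < 1"
    and dom: "\<And>z. z \<in> D \<Longrightarrow> cmod (p z) \<le> cmod (m z) \<and> cmod (q z) \<le> cmod (m z) \<and>
      cmod (p z) + cmod (q z) \<le> (1 + \<kappa>) * cmod (m z)"
  shows "\<exists>C\<ge>1. \<forall>z1\<in>D. \<forall>z2\<in>D.
           (1 / C) * quasihyperbolic_dist D z1 z2 \<le> quasihyperbolic_dist D' (f z1) (f z2) \<and>
           quasihyperbolic_dist D' (f z1) (f z2) \<le> C * quasihyperbolic_dist D z1 z2"
proof -
  interpret planar_dilatation_map D f p q K by (rule map)
  have img: "f ` D = D'" using g by (simp add: homeomorphism_def)
  obtain c G where cG: "0 < c" "0 < G" "\<And>z. z \<in> D \<Longrightarrow>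
     c * infdist (f z) (frontier D') / infdist z (frontier D) \<le> cmod (m z) \<and>
     cmod (m z) \<le> G * infdist (f z) (frontier D') / infdist z (frontier D)"
    using derivative_comparison[OF D D' img m _ nz] dom by metis
  let ?L = "\<lambda>z h. p z * h + cnj (q z * h)"
  have lower: "(1 - \<kappa>) * cmod (m z) * cmod h \<le> cmod (?L z h)" if z: "z \<in> D" for z h
  proof -
    have "\<bar>cmod (p z) - cmod (q z)\<bar> * cmod h \<le> cmod (?L z h)"
      using norm_diff_ineq[of "p z * h" "cnj (q z * h)"] norm_diff_ineq[of "cnj (q z * h)" "p z * h"]
      by (simp add: norm_mult abs_if algebra_simps)
    moreover have "(1 - \<kappa>) * cmod (m z) \<le> \<bar>cmod (p z) - cmod (q z)\<bar>"
      using m dom[OF z] by (auto simp: algebra_simps)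
    ultimately show ?thesis using mult_right_mono[of _ _ "cmod h"] norm_ge_zero[of h] by (meson order_trans)
  qed
  have "\<exists>g'. (g has_derivative g') (at y) \<and>
      onorm g' \<le> 1 / ((1 - \<kappa>) * c) * infdist (g y) (frontier D) / infdist y (frontier D')" if y: "y \<in> D'" for y
  proof -
    define z where "z = g y"
    have z: "z \<in> D" "f z = y" using g y by (auto simp: homeomorphism_def z_def)
    have d: "0 < infdist z (frontier D)" "0 < infdist y (frontier D')"
      using proper_subdomain_frontier(1) D D' y z by auto
    have mpos: "0 < (1 - \<kappa>) * cmod (m z)" using nz[OF z(1)] \<kappa> by simp
    have lin: "linear (?L z)" using der_f[OF z(1)] has_derivative_linear by blast
    have "inj (?L z)"
    proof (rule linear_injective_0[OF lin, THEN iffD2], intro allI impI)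
      fix h assume "?L z h = 0"
      then have "(1 - \<kappa>) * cmod (m z) * cmod h \<le> (1 - \<kappa>) * cmod (m z) * 0"
        using lower[OF z(1), of h] by simp
      then have "cmod h \<le> 0" by (rule mult_left_le_imp_le) (rule mpos)
      then show "h = 0" by simp
    qed
    then obtain g' where g': "linear g'" "\<And>h. ?L z (g' h) = h"
      using linear_injective_isomorphism[OF lin] by metis
    have "(g has_derivative g') (at (f z))"
    proof (rule has_derivative_inverse_strong[OF open_D z(1) cont_f _ der_f[OF z(1)]])
      show "g (f x) = x" if "x \<in> D" for x using g that by (simp add: homeomorphism_def)
      show "?L z \<circ> g' = id" using g'(2) by auto
    qed
    moreover have "onorm g' \<le> 1 / ((1 - \<kappa>) * cmod (m z))"
    proof (rule onorm_bound)
      fix h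
      have "(1 - \<kappa>) * cmod (m z) * cmod (g' h) \<le> cmod h" using lower[OF z(1), of "g' h"] g'(2) by simp
      then show "norm (g' h) \<le> 1 / ((1 - \<kappa>) * cmod (m z)) * norm h" using mpos by (simp add: field_simps)
    qed (use mpos in simp)
    moreover have "1 / ((1 - \<kappa>) * cmod (m z)) \<le> 1 / ((1 - \<kappa>) * (c * infdist y (frontier D') / infdist z (frontier D)))"
      using cG(3)[OF z(1)] z(2) mpos \<kappa> cG(1) d
      by (intro divide_left_mono mult_left_mono mult_pos_pos) auto
    moreover have "1 / ((1 - \<kappa>) * (c * infdist y (frontier D') / infdist z (frontier D))) =
        1 / ((1 - \<kappa>) * c) * infdist z (frontier D) / infdist y (frontier D')"
      by simp
    ultimately show ?thesis using z(2) by (auto simp: z_def)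
  qed
  then obtain g' where g': "\<And>y. y \<in> D' \<Longrightarrow> (g has_derivative g' y) (at y)"
    "\<And>y. y \<in> D' \<Longrightarrow> onorm (g' y) \<le> 1 / ((1 - \<kappa>) * c) * infdist (g y) (frontier D) / infdist y (frontier D')"
    by metis
  have up: "quasihyperbolic_dist D' (f z1) (f z2) \<le> 16 * (2 * G) * quasihyperbolic_dist D z1 z2"
    if "z1 \<in> D" "z2 \<in> D" for z1 z2
  proof (rule quasihyperbolic_dist_image_le[OF D D' _ der_f _ _ that])
    fix z assume z: "z \<in> D"
    have "onorm (?L z) \<le> 2 * (G * infdist (f z) (frontier D') / infdist z (frontier D))"
      using cG(3)[OF z] dom[OF z] by (intro onorm_derivative_le) (auto intro: order_trans)
    then show "onorm (?L z) \<le> 2 * G * infdist (f z) (frontier D') / infdist z (frontier D)" by simp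
  qed (use img cG in auto)
  have lo: "quasihyperbolic_dist D z1 z2 \<le> 16 * (1 / ((1 - \<kappa>) * c)) * quasihyperbolic_dist D' (f z1) (f z2)"
    if z: "z1 \<in> D" "z2 \<in> D" for z1 z2
  proof -
    have gf: "g (f z1) = z1" "g (f z2) = z2" "f z1 \<in> D'" "f z2 \<in> D'"
      using g z by (auto simp: homeomorphism_def)
    have "quasihyperbolic_dist D (g (f z1)) (g (f z2)) \<le> 16 * (1 / ((1 - \<kappa>) * c)) * quasihyperbolic_dist D' (f z1) (f z2)"
      by (rule quasihyperbolic_dist_image_le[OF D' D _ g' _ gf(3,4)]) (use g \<kappa> cG in \<open>auto simp: homeomorphism_def\<close>)
    then show ?thesis using gf by simp
  qed
  \<comment> \<open>Passing from the two separate constants to a common one uses that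
    quasihyperbolic distances are nonnegative.\<close>
  define C where "C = max 1 (max (32 * G) (16 * (1 / ((1 - \<kappa>) * c))))"
  have C: "1 \<le> C" by (simp add: C_def)
  show ?thesis
  proof (intro exI[of _ C] conjI ballI C)
    fix z1 z2 assume z: "z1 \<in> D" "z2 \<in> D"
    then have fz: "f z1 \<in> D'" "f z2 \<in> D'" using img by auto
    have "quasihyperbolic_dist D z1 z2 \<le> C * quasihyperbolic_dist D' (f z1) (f z2)"
      by (rule order_trans[OF lo[OF z] mult_right_mono[OF _ quasihyperbolic_dist_nonneg[OF D' fz]]])
         (simp add: C_def)
    then show "(1 / C) * quasihyperbolic_dist D z1 z2 \<le> quasihyperbolic_dist D' (f z1) (f z2)"
      using C by (simp add: field_simps)
    show "quasihyperbolic_dist D' (f z1) (f z2) \<le> C * quasihyperbolic_dist D z1 z2"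
      by (rule order_trans[OF up[OF z] mult_right_mono[OF _ quasihyperbolic_dist_nonneg[OF D z]]])
         (simp add: C_def)
  qed
qed

theorem theorem4p1:
  fixes D D' :: "complex set" and f :: "complex \<Rightarrow> complex" and K :: real
  assumes "proper_subdomain D"
    and "proper_subdomain D'"
    and "quasiconformal K D D' f"
    and "harmonic_map_on D f"
  shows "\<exists>C\<ge>1. \<forall>z1\<in>D. \<forall>z2\<in>D.
           (1 / C) * quasihyperbolic_dist D z1 z2 \<le> quasihyperbolic_dist D' (f z1) (f z2) \<and>
           quasihyperbolic_dist D' (f z1) (f z2) \<le> C * quasihyperbolic_dist D z1 z2"
proof -
  have D: "open D" "connected D" "D \<noteq> {}" using assms(1) by (auto simp: proper_subdomain_def)
  have K: "1 \<le> K" using assms(3) by (simp add: quasiconformal_def)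
  obtain g where g: "homeomorphism D D' f g" using assms(3) by (auto simp: quasiconformal_def)
  have inj: "inj_on f D" using g unfolding homeomorphism_def by (metis inj_onI)
  obtain p q where p: "p holomorphic_on D" and q: "q holomorphic_on D"
    and der: "\<And>z. z \<in> D \<Longrightarrow> (f has_derivative (\<lambda>h. p z * h + cnj (q z * h))) (at z)"
    using harmonic_map_derivative[OF D(1) assms(4)] by blast
  have dil: "(cmod (p z))\<^sup>2 + (cmod (q z))\<^sup>2 \<le> K * \<bar>(cmod (p z))\<^sup>2 - (cmod (q z))\<^sup>2\<bar>" if "z \<in> D" for z
    by (rule quasiconformal_harmonic_dilatation[OF D(1) holomorphic_on_imp_continuous_on[OF p]
          holomorphic_on_imp_continuous_on[OF q] der _ that])
       (use assms(3) in \<open>simp_all add: quasiconformal_def\<close>)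
  have map: "planar_dilatation_map D f p q K"
    by unfold_locales (use D p q der dil inj K in auto)
  \<comment> \<open>The exact norm |p| + |q| would give (K - 1) / (K + 1) itself; the quadratic
    inequality gives its square root, which is also below 1.\<close>
  define \<kappa> where "\<kappa> = sqrt ((K - 1) / (K + 1))"
  have \<kappa>: "0 \<le> \<kappa>" "\<kappa> < 1" using K by (auto simp: \<kappa>_def)
  have quot: "b \<le> \<kappa> * a" if "a\<^sup>2 + b\<^sup>2 \<le> K * \<bar>a\<^sup>2 - b\<^sup>2\<bar>" "0 \<le> b" "b \<le> a" for a b :: real
  proof -
    have "b\<^sup>2 \<le> (K - 1) / (K + 1) * a\<^sup>2" by (rule dilatation_dominated[OF that K])
    also have "\<dots> = (\<kappa> * a)\<^sup>2" using K by (simp add: \<kappa>_def power_mult_distrib)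
    finally show ?thesis using \<kappa> that by (intro power2_le_imp_le[of b]) auto
  qed
  \<comment> \<open>If |p| = |q| throughout, the dilatation inequality makes the derivative vanish,
    and \<open>f\<close> would be constant on \<open>D\<close>, against injectivity.\<close>
  have "\<exists>z\<in>D. cmod (p z) \<noteq> cmod (q z)"
  proof (rule ccontr)
    assume eq: "\<not> ?thesis"
    have zero: "p z = 0 \<and> q z = 0" if "z \<in> D" for z
    proof -
      have "(cmod (p z))\<^sup>2 + (cmod (q z))\<^sup>2 \<le> 0" using dil[OF that] eq that by auto
      then show ?thesis by (simp add: sum_power2_le_zero_iff)
    qed
    have "f x = f y" if "x \<in> D" "y \<in> D" for x y
      by (rule has_derivative_zero_unique_connected[OF D(1,2) _ that]) (use der zero in force)
    note const = this
    obtain z r where z: "z \<in> D" "0 < r" "ball z r \<subseteq> D" using D open_contains_ball by blast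
    have "z + of_real (r / 2) \<in> ball z r" using z by (simp add: dist_norm)
    then have "z + of_real (r / 2) \<in> D" using z by blast
    then have "z + of_real (r / 2) = z" using inj_onD[OF inj const[OF _ z(1)]] z(1) by blast
    then show False using z(2) by simp
  qed
  then obtain z0 where z0: "z0 \<in> D" "cmod (p z0) \<noteq> cmod (q z0)" by blast
  then consider "cmod (q z0) < cmod (p z0)" | "cmod (p z0) < cmod (q z0)" by linarith
  then show ?thesis
  proof cases
    case 1
    have le: "cmod (q z) \<le> cmod (p z)" if "z \<in> D" for z
      by (rule dilatation_sense[OF D(1,2) p q dil z0(1) 1 that])
    have le\<kappa>: "cmod (q z) \<le> \<kappa> * cmod (p z)" if "z \<in> D" for z
      by (rule quot[OF dil[OF that] _ le[OF that]]) simp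
    have "p z \<noteq> 0" if "z \<in> D" for z
      by (rule injective_harmonic_nonvanishing[OF D(1,2) p der le\<kappa> \<kappa> inj that z0(1)]) (use 1 in auto)
    then show ?thesis
      by (rule harmonic_dilatation_bilipschitz[OF map assms(1,2) g disjI1[OF refl] _ \<kappa>])
         (use le le\<kappa> in \<open>auto simp: algebra_simps\<close>)
  next
    case 2
    have dil': "(cmod (q z))\<^sup>2 + (cmod (p z))\<^sup>2 \<le> K * \<bar>(cmod (q z))\<^sup>2 - (cmod (p z))\<^sup>2\<bar>" if "z \<in> D" for z
      using dil[OF that] by (simp add: abs_minus_commute add.commute)
    have le: "cmod (p z) \<le> cmod (q z)" if "z \<in> D" for z
      by (rule dilatation_sense[OF D(1,2) q p dil' z0(1) 2 that])
    have le\<kappa>: "cmod (p z) \<le> \<kappa> * cmod (q z)" if "z \<in> D" for z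
      by (rule quot[OF dil'[OF that] _ le[OF that]]) simp
    \<comment> \<open>Conjugating \<open>f\<close> exchanges \<open>p\<close> and \<open>q\<close>,
      which brings the absence of zeros of \<open>q\<close> into the sense-preserving form; the
      distortion result is then applied to \<open>f\<close> itself with
      \<open>m = q\<close>.\<close>
    have der': "((\<lambda>z. cnj (f z)) has_derivative (\<lambda>h. q z * h + cnj (p z * h))) (at z)" if "z \<in> D" for z
      using bounded_linear.has_derivative[OF bounded_linear_cnj der[OF that]]
      by (rule has_derivative_eq_rhs) (auto simp: algebra_simps)
    have inj': "inj_on (\<lambda>z. cnj (f z)) D" using inj by (auto simp: inj_on_def)
    have "q z \<noteq> 0" if "z \<in> D" for z
      by (rule injective_harmonic_nonvanishing[OF D(1,2) q der' le\<kappa> \<kappa> inj' that z0(1)]) (use 2 in auto)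
    then show ?thesis
      by (rule harmonic_dilatation_bilipschitz[OF map assms(1,2) g disjI2[OF refl] _ \<kappa>])
         (use le le\<kappa> in \<open>auto simp: algebra_simps\<close>)
  qed
qed

end
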